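(* Let $T:X\to X$ be a Ritt$_E$ operator of type $r\in(0,1)$ on a Banach space $X$, and assume that $T$ admits a quadratic $H^\infty(E_s)$ functional calculus for some $s\in(r,1)$. Then for any $\alpha>0$ there exists a constant $C>0$ such that $$\|x\|_{T,\alpha}\le C\|x\|,\qquad x\in X.$$
   Context: $X$ is a complex Banach space, $B(X)$ the algebra of bounded operators on $X$, $R(z,T)=(z-T)^{-1}$, $\mathbb D$ the open unit disc, $\mathbb T$ the unit circle, $D(0,2)$ the open disc of radius 2. $E=\{\xi_1,\dots,\xi_N\}\subset\mathbb T$ is a fixed finite set of $N\ge1$ distinct points. $T\in B(X)$ is a Ritt$_E$ operator if $\sigma(T)\subset\overline{\mathbb D}$, $\sigma(T)\cap\mathbb T\subset E$ and for every $C>1$ the set $\{\prod_{j=1}^N(1-\overline{\xi_j}z)R(z,T):1<|z|<C\}$ is bounded. For such $T$ each $I-\overline{\xi_j}T$ is a bounded sectorial operator, and $(I-\overline{\xi_j}T)^\alpha$ is the usual fractional power, a bounded operator. For $r\in(0,1)$, $E_r$ is the interior of the convex hull of $E\cup r\mathbb D$; $r$ is $E$-large enough if every segment $[\xi_i,\xi_j]$, $i\neq j$, meets $r\mathbb D$. A Ritt$_E$ operator $T$ is of type $r$ if $r$ is $E$-large enough, $\sigma(T)\subset\overline{E_r}$, and for every $s\in(r,1)$ the set $\{R(z,T)\prod_{j=1}^N(\xi_j-z): z\in D(0,2)\setminus\overline{E_s}\}$ is bounded. $H_0^\infty(E_s)$ is the space of bounded holomorphic $\phi:E_s\to\mathbb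 C$ such that $|\phi(z)|\le C_1\prod_{j=1}^N|\xi_j-z|^{s_j}$ on $E_s$ for some $C_1,s_1,\dots,s_N>0$; $\|\cdot\|_{\infty,E_s}$ is the sup norm on $E_s$. If $T$ is of type $r<s$ and $\phi\in H_0^\infty(E_s)$, then $\phi(T)=\frac1{2\pi i}\int_{\partial E_u}\phi(z)R(z,T)\,dz$ for any $u\in(r,s)$. $(\varepsilon_k)_{k\ge1}$ are independent Rademacher variables on a probability space $(\Omega,\mathbb P)$ and $\|\sum_k\varepsilon_k\otimes x_k\|_{\mathrm{Rad}(X)}=\big(\int_\Omega\|\sum_k\varepsilon_k(u)x_k\|_X^2\,d\mathbb P(u)\big)^{1/2}$. $T$ admits a quadratic $H^\infty(E_s)$ functional calculus if there is $K>0$ such that for all $n\ge1$, $\phi_1,\dots,\phi_n\in H_0^\infty(E_s)$, $x\in X$, $$\Big\|\sum_{l=1}^n\varepsilon_l\otimes\phi_l(T)x\Big\|_{\mathrm{Rad}(X)}\le K\|x\|\,\Big\|\Big(\sum_{l=1}^n|\phi_l|^2\Big)^{1/2}\Big\|_{\infty,E_s}.$$ For $\alpha>0$ and $x\in X$ the square function is (nondecreasing limit, possibly $+\infty$) $$\|x\|_{T,\alpha}=\lim_{n\to\infty}\Big\|\sum_{k=1}^nk^{\alpha-1/2}\varepsilon_k\otimes T^{k-1}\prod_{j=1}^N(I-\overline{\xi_j}T)^\alpha x\Big\|_{\mathrm{Rad}(X)}.$$ *)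

theory Defs
  imports "HOL-Probability.Probability"
begin

class complex_banach = banach +
  fixes scaleC :: "complex \<Rightarrow> 'a \<Rightarrow> 'a" (infixr "*\<^sub>C" 75)
  assumes scaleC_add_right: "c *\<^sub>C (x + y) = c *\<^sub>C x + c *\<^sub>C y"
    and scaleC_add_left: "(c + d) *\<^sub>C x = c *\<^sub>C x + d *\<^sub>C x"
    and scaleC_scaleC: "c *\<^sub>C d *\<^sub>C x = (c * d) *\<^sub>C x"
    and scaleC_of_real: "of_real a *\<^sub>C x = a *\<^sub>R x"
    and norm_scaleC: "norm (c *\<^sub>C x) = cmod c * norm x"

instantiation complex :: complex_banach
begin

definition scaleC_complex :: "complex \<Rightarrow> complex \<Rightarrow> complex"
  where "scaleC_complex c z = c * z"

instance
  by standard (auto simp: scaleC_complex_def algebra_simps norm_mult scaleR_conv_of_real)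

end

lemma bounded_linear_scaleC: "bounded_linear (\<lambda>x::'a::complex_banach. c *\<^sub>C x)"
proof (rule bounded_linear_intro)
  show "c *\<^sub>C (x + y) = c *\<^sub>C x + c *\<^sub>C y" for x y :: 'a
    by (rule scaleC_add_right)
  show "c *\<^sub>C (a *\<^sub>R x) = a *\<^sub>R (c *\<^sub>C x)" for a :: real and x :: 'a
    by (simp flip: scaleC_of_real add: scaleC_scaleC mult.commute)
  show "norm (c *\<^sub>C x) \<le> norm x * cmod c" for x :: 'a
    by (simp add: norm_scaleC)
qed

text \<open>
  The library type of bounded real-linear operators becomes a complex Banach space when
  its codomain is one.  The bounded complex-linear operators \<open>B(X)\<close> are a closed complex
  subspace of it, stable under composition.
\<close>

instantiation blinfun :: (real_normed_vector, complex_banach) complex_banach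
begin

definition scaleC_blinfun :: "complex \<Rightarrow> 'a \<Rightarrow>\<^sub>L 'b \<Rightarrow> 'a \<Rightarrow>\<^sub>L 'b"
  where "scaleC_blinfun c A = Blinfun (\<lambda>x. c *\<^sub>C blinfun_apply A x)"

lemma blinfun_apply_scaleC: "blinfun_apply (c *\<^sub>C A) x = c *\<^sub>C blinfun_apply A x"
  for A :: "'a \<Rightarrow>\<^sub>L 'b"
  unfolding scaleC_blinfun_def
  by (simp add: bounded_linear_Blinfun_apply
      bounded_linear_compose[OF bounded_linear_scaleC blinfun.bounded_linear_right])

instance
proof
  fix c d :: complex and a :: real and A B :: "'a \<Rightarrow>\<^sub>L 'b"
  show "c *\<^sub>C (A + B) = c *\<^sub>C A + c *\<^sub>C B"
    by (rule blinfun_eqI) (simp add: blinfun_apply_scaleC blinfun.add_left scaleC_add_right)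
  show "(c + d) *\<^sub>C A = c *\<^sub>C A + d *\<^sub>C A"
    by (rule blinfun_eqI) (simp add: blinfun_apply_scaleC blinfun.add_left scaleC_add_left)
  show "c *\<^sub>C d *\<^sub>C A = (c * d) *\<^sub>C A"
    by (rule blinfun_eqI) (simp add: blinfun_apply_scaleC scaleC_scaleC)
  show "of_real a *\<^sub>C A = a *\<^sub>R A"
    by (rule blinfun_eqI) (simp add: blinfun_apply_scaleC blinfun.scaleR_left scaleC_of_real)
  have le: "norm (e *\<^sub>C D) \<le> cmod e * norm D" for e and D :: "'a \<Rightarrow>\<^sub>L 'b"
  proof (rule norm_blinfun_bound)
    show "norm (blinfun_apply (e *\<^sub>C D) x) \<le> cmod e * norm D * norm x" for x
      using mult_left_mono[OF norm_blinfun[of D x], of "cmod e"]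
      by (simp add: blinfun_apply_scaleC norm_scaleC mult.assoc)
  qed simp
  show "norm (c *\<^sub>C A) = cmod c * norm A"
  proof (cases "c = 0")
    case True
    then show ?thesis using le[of 0 A] by simp
  next
    case False
    have "inverse c *\<^sub>C c *\<^sub>C A = A"
      by (rule blinfun_eqI)
        (use False in \<open>simp add: blinfun_apply_scaleC scaleC_scaleC scaleC_of_real[of 1, simplified]\<close>)
    then have "norm A \<le> cmod (inverse c) * norm (c *\<^sub>C A)"
      using le[of "inverse c" "c *\<^sub>C A"] by simp
    then have "cmod c * norm A \<le> norm (c *\<^sub>C A)"
      using False by (simp add: norm_divide field_simps)
    with le[of c A] show ?thesis by simp
  qed
qed

end

definition BX :: "('a::complex_banach \<Rightarrow>\<^sub>L 'a) set"
  where "BX = {A. \<forall>c x. blinfun_apply A (c *\<^sub>C x) = c *\<^sub>C blinfun_apply A x}"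

primrec op_power :: "('a::real_normed_vector \<Rightarrow>\<^sub>L 'a) \<Rightarrow> nat \<Rightarrow> 'a \<Rightarrow>\<^sub>L 'a" where
  "op_power A 0 = id_blinfun"
| "op_power A (Suc n) = A o\<^sub>L op_power A n"

text \<open>\<open>op_prod A n\<close> is \<open>A 1 \<circ> \<dots> \<circ> A n\<close>; it is only applied to commuting families.\<close>

primrec op_prod :: "(nat \<Rightarrow> 'a::real_normed_vector \<Rightarrow>\<^sub>L 'a) \<Rightarrow> nat \<Rightarrow> 'a \<Rightarrow>\<^sub>L 'a" where
  "op_prod A 0 = id_blinfun"
| "op_prod A (Suc n) = op_prod A n o\<^sub>L A (Suc n)"

definition is_op_inv :: "('a::complex_banach \<Rightarrow>\<^sub>L 'a) \<Rightarrow> ('a \<Rightarrow>\<^sub>L 'a) \<Rightarrow> bool"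
  where "is_op_inv A B \<longleftrightarrow> B \<in> BX \<and> A o\<^sub>L B = id_blinfun \<and> B o\<^sub>L A = id_blinfun"

definition op_inv :: "('a::complex_banach \<Rightarrow>\<^sub>L 'a) \<Rightarrow> 'a \<Rightarrow>\<^sub>L 'a"
  where "op_inv A = (THE B. is_op_inv A B)"

definition spectrum :: "('a::complex_banach \<Rightarrow>\<^sub>L 'a) \<Rightarrow> complex set"
  where "spectrum T = {z. \<not> (\<exists>B. is_op_inv (z *\<^sub>C id_blinfun - T) B)}"

definition resolvent :: "complex \<Rightarrow> ('a::complex_banach \<Rightarrow>\<^sub>L 'a) \<Rightarrow> 'a \<Rightarrow>\<^sub>L 'a"
  where "resolvent z T = op_inv (z *\<^sub>C id_blinfun - T)"

text \<open>
  Fractional power \<open>A\<^sup>\<alpha>\<close>, \<open>\<alpha> > 0\<close>, of a bounded sectorial operator, after Balakrishnan: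
  with \<open>\<alpha> = n + \<beta>\<close>, \<open>n\<close> a natural number and \<open>0 \<le> \<beta> < 1\<close>, it is \<open>A\<^sup>n A\<^sup>\<beta>\<close>, where \<open>A\<^sup>0 = I\<close> and,
  for \<open>0 < \<beta> < 1\<close>,
  \<open>A\<^sup>\<beta> = sin(\<pi>\<beta>)/\<pi> \<integral>\<^sub>0\<^sup>\<infinity> t\<^sup>\<beta>\<^sup>-\<^sup>1 (t + A)\<^sup>-\<^sup>1 A dt\<close>.
  By sectoriality and boundedness of \<open>A\<close> this integral converges absolutely in operator norm.
\<close>

definition frac_power :: "('a::complex_banach \<Rightarrow>\<^sub>L 'a) \<Rightarrow> real \<Rightarrow> 'a \<Rightarrow>\<^sub>L 'a"
  where "frac_power A \<alpha> =
    op_power A (nat \<lfloor>\<alpha>\<rfloor>) o\<^sub>L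
    (if frac \<alpha> = 0 then id_blinfun
     else (sin (pi * frac \<alpha>) / pi) *\<^sub>R
       integral {0<..} (\<lambda>t::real. t powr (frac \<alpha> - 1) *\<^sub>R (op_inv (t *\<^sub>R id_blinfun + A) o\<^sub>L A)))"

text \<open>Throughout, \<open>E = {\<xi> 1, \<dots>, \<xi> N}\<close> is represented by \<open>\<xi>\<close> and \<open>N\<close>.\<close>

definition E_dom :: "(nat \<Rightarrow> complex) \<Rightarrow> nat \<Rightarrow> real \<Rightarrow> complex set"
  where "E_dom \<xi> N r = interior (convex hull (\<xi> ` {1..N} \<union> ball 0 r))"

definition E_large_enough :: "(nat \<Rightarrow> complex) \<Rightarrow> nat \<Rightarrow> real \<Rightarrow> bool"
  where "E_large_enough \<xi> N r \<longleftrightarrow>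
    (\<forall>i\<in>{1..N}. \<forall>j\<in>{1..N}. i \<noteq> j \<longrightarrow> closed_segment (\<xi> i) (\<xi> j) \<inter> ball 0 r \<noteq> {})"

definition Ritt_E :: "(nat \<Rightarrow> complex) \<Rightarrow> nat \<Rightarrow> ('a::complex_banach \<Rightarrow>\<^sub>L 'a) \<Rightarrow> bool"
  where "Ritt_E \<xi> N T \<longleftrightarrow>
    T \<in> BX \<and> spectrum T \<subseteq> cball 0 1 \<and> spectrum T \<inter> sphere 0 1 \<subseteq> \<xi> ` {1..N} \<and>
    (\<forall>C>1. bounded ((\<lambda>z. (\<Prod>j=1..N. 1 - cnj (\<xi> j) * z) *\<^sub>C resolvent z T) ` {z. 1 < cmod z \<and> cmod z < C}))"

definition Ritt_E_type :: "(nat \<Rightarrow> complex) \<Rightarrow> nat \<Rightarrow> real \<Rightarrow> ('a::complex_banach \<Rightarrow>\<^sub>L 'a) \<Rightarrow> bool"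
  where "Ritt_E_type \<xi> N r T \<longleftrightarrow>
    Ritt_E \<xi> N T \<and> E_large_enough \<xi> N r \<and> spectrum T \<subseteq> closure (E_dom \<xi> N r) \<and>
    (\<forall>s\<in>{r<..<1}. bounded ((\<lambda>z. (\<Prod>j=1..N. \<xi> j - z) *\<^sub>C resolvent z T) `
       (ball 0 2 - closure (E_dom \<xi> N s))))"

definition H0_inf :: "(nat \<Rightarrow> complex) \<Rightarrow> nat \<Rightarrow> real \<Rightarrow> (complex \<Rightarrow> complex) set"
  where "H0_inf \<xi> N s = {\<phi>. \<phi> holomorphic_on E_dom \<xi> N s \<and> bounded (\<phi> ` E_dom \<xi> N s) \<and>
    (\<exists>C\<^sub>1>0. \<exists>p :: nat \<Rightarrow> real. (\<forall>j\<in>{1..N}. p j > 0) \<and>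
      (\<forall>z\<in>E_dom \<xi> N s. cmod (\<phi> z) \<le> C\<^sub>1 * (\<Prod>j=1..N. cmod (\<xi> j - z) powr p j)))}"

text \<open>
  Polar parametrization, once counterclockwise, of the boundary of a bounded open convex set
  containing \<open>0\<close>.  For \<open>E_dom\<close> it is Lipschitz and piecewise \<open>C\<^sup>1\<close>.
\<close>

definition boundary_path :: "complex set \<Rightarrow> real \<Rightarrow> complex"
  where "boundary_path \<Omega> t =
    of_real (Sup {\<rho>. \<rho> \<ge> 0 \<and> of_real \<rho> * cis (2 * pi * t) \<in> \<Omega>}) * cis (2 * pi * t)"

text \<open>The counterpart, for integrands with values in \<open>'a\<close>, of the library's contour integral.\<close>

definition vec_contour_integral :: "(real \<Rightarrow> complex) \<Rightarrow> (complex \<Rightarrow> 'a::complex_banach) \<Rightarrow> 'a"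
  where "vec_contour_integral g f =
    integral {0..1} (\<lambda>t. vector_derivative g (at t within {0..1}) *\<^sub>C f (g t))"

text \<open>
  \<open>\<phi>(T)\<close> for \<open>T\<close> of type \<open>r\<close> and \<open>\<phi> \<in> H0_inf \<xi> N s\<close>, \<open>r < s\<close>.  The integral does not depend on the
  choice of \<open>u \<in> (r,s)\<close>.  The path meets the complement of \<open>E_dom \<xi> N s\<close> only in points of \<open>E\<close>,
  that is for finitely many parameter values, where the integrand is irrelevant.
\<close>

definition H0_calc :: "(nat \<Rightarrow> complex) \<Rightarrow> nat \<Rightarrow> real \<Rightarrow> real \<Rightarrow> (complex \<Rightarrow> complex) \<Rightarrow>
    ('a::complex_banach \<Rightarrow>\<^sub>L 'a) \<Rightarrow> 'a \<Rightarrow>\<^sub>L 'a"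
  where "H0_calc \<xi> N r s \<phi> T =
    (let u = (SOME u. r < u \<and> u < s) in
      (1 / (2 * of_real pi * \<i>)) *\<^sub>C
        vec_contour_integral (boundary_path (E_dom \<xi> N u)) (\<lambda>z. \<phi> z *\<^sub>C resolvent z T))"

definition rademacher_seq :: "'w measure \<Rightarrow> (nat \<Rightarrow> 'w \<Rightarrow> real) \<Rightarrow> bool"
  where "rademacher_seq M \<epsilon> \<longleftrightarrow>
    prob_space M \<and> prob_space.indep_vars M (\<lambda>_. borel) \<epsilon> {1..} \<and>
    (\<forall>k\<ge>1. measure M {u \<in> space M. \<epsilon> k u = 1} = 1/2 \<and> measure M {u \<in> space M. \<epsilon> k u = -1} = 1/2)"

definition Rad_norm :: "'w measure \<Rightarrow> (nat \<Rightarrow> 'w \<Rightarrow> real) \<Rightarrow> nat \<Rightarrow> (nat \<Rightarrow> 'a::real_normed_vector) \<Rightarrow> real"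
  where "Rad_norm M \<epsilon> n x = sqrt (\<integral>u. (norm (\<Sum>k=1..n. \<epsilon> k u *\<^sub>R x k))\<^sup>2 \<partial>M)"

definition quadratic_Hinf_calculus :: "'w measure \<Rightarrow> (nat \<Rightarrow> 'w \<Rightarrow> real) \<Rightarrow> (nat \<Rightarrow> complex) \<Rightarrow> nat \<Rightarrow>
    real \<Rightarrow> real \<Rightarrow> ('a::complex_banach \<Rightarrow>\<^sub>L 'a) \<Rightarrow> bool"
  where "quadratic_Hinf_calculus M \<epsilon> \<xi> N r s T \<longleftrightarrow>
    (\<exists>K>0. \<forall>n\<ge>1. \<forall>\<phi>. (\<forall>l\<in>{1..n}. \<phi> l \<in> H0_inf \<xi> N s) \<longrightarrow>
      (\<forall>x. Rad_norm M \<epsilon> n (\<lambda>l. blinfun_apply (H0_calc \<xi> N r s (\<phi> l) T) x)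
        \<le> K * norm x * (SUP z\<in>E_dom \<xi> N s. sqrt (\<Sum>l=1..n. (cmod (\<phi> l z))\<^sup>2))))"

definition square_fun :: "'w measure \<Rightarrow> (nat \<Rightarrow> 'w \<Rightarrow> real) \<Rightarrow> (nat \<Rightarrow> complex) \<Rightarrow> nat \<Rightarrow>
    ('a::complex_banach \<Rightarrow>\<^sub>L 'a) \<Rightarrow> real \<Rightarrow> 'a \<Rightarrow> ennreal"
  where "square_fun M \<epsilon> \<xi> N T \<alpha> x =
    lim (\<lambda>n. ennreal (Rad_norm M \<epsilon> n (\<lambda>k. (real k powr (\<alpha> - 1/2)) *\<^sub>R
      blinfun_apply (op_power T (k - 1) o\<^sub>L
        op_prod (\<lambda>j. frac_power (id_blinfun - cnj (\<xi> j) *\<^sub>C T) \<alpha>) N) x)))"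

end

theory Submission
  imports Defs "HOL-Complex_Analysis.Complex_Analysis" "HOL-Real_Asymp.Real_Asymp"
begin

text \<open>
  The square function of \<open>x\<close> is the Rademacher average of the \<open>\<phi>\<^sub>k(T)x\<close> with
  \<open>\<phi>\<^sub>k(z) = k\<^sup>\<alpha>\<^sup>-\<^sup>1\<^sup>/\<^sup>2 z\<^sup>k\<^sup>-\<^sup>1 \<Prod>\<^sub>j (1 - cnj (\<xi> j) z)\<^sup>\<alpha>\<close>, and \<open>\<Sum>\<^sub>k \<bar>\<phi>\<^sub>k\<bar>\<^sup>2\<close> is bounded on
  \<open>E_dom \<xi> N s\<close>: the sum over \<open>k\<close> of \<open>k\<^sup>2\<^sup>\<alpha>\<^sup>-\<^sup>1 \<bar>z\<bar>\<^sup>2\<^sup>k\<^sup>-\<^sup>2\<close> is of order \<open>(1 - \<bar>z\<bar>\<^sup>2)\<^sup>-\<^sup>2\<^sup>\<alpha>\<close>, while near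
  \<open>\<xi> j\<close> the domain is contained in a Stolz angle, where \<open>\<bar>\<xi> j - z\<bar>\<close> is dominated by \<open>1 - \<bar>z\<bar>\<close>.

  To avoid identifying \<open>\<phi>\<^sub>k(T)\<close>, given by a contour integral, with an operator containing the
  fractional powers, given by Balakrishnan's integral, we replace \<open>(1 - cnj (\<xi> j) z)\<^sup>\<alpha>\<close> by rational
  functions with a double zero at \<open>\<xi> j\<close>: Riemann sums of the Balakrishnan integral, which obey the
  same bounds on the disc and whose values at \<open>T\<close> converge in norm. For a rational \<open>\<phi>\<close> the
  operator \<open>\<phi>(T)\<close> is defined algebraically, and \<open>\<phi>(z) - \<phi>(T)\<close> is divisible by \<open>z - T\<close>.
  Hence \<open>\<phi>(z) R(z,T) = \<phi>(T) R(z,T) + \<Psi>(z)\<close>, where \<open>\<Psi>\<close> integrates to 0 along loops; the integral of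
  the resolvent is computed along dilations of the boundary path, and the double zeros allow to
  pass to the limit as the dilation factor tends to 1.
\<close>

subsection \<open>Bounded operators and resolvents\<close>

text \<open>The obstacle is that the contour of \<open>H0_calc\<close> passes through the points
  \<xi> j, which may belong to the spectrum; there the resolvent is an unspecified value. Two zeros
  are wanted at each \<xi> j because the type condition controls the resolvent only after
  multiplication by the product of the \<open>\<xi> j - z\<close>: one zero pays for that, the other
  makes the integrand tend to 0. The condition on the segments enters through one picture: the
  convex hull is a union of drops, the hulls of the disc and a single point. This yields the polar
  radius of the boundary, hence its velocity and its winding, and also the Stolz estimate. The limit
  is legitimate because of the order of choices: the constant bounding the rational symbols by
  \<open>cmod (\<xi> j - z) powr \<alpha>\<close> is fixed before the accuracy of the approximation.
  It comes from two facts: \<open>1 - cnj (\<xi> j) * z\<close> has nonnegative real part on the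
  disc, and right-endpoint Riemann sums of a decreasing function lie below its integral.\<close>

lemma scaleC_one [simp]: "1 *\<^sub>C (x::'a::complex_banach) = x"
  using scaleC_of_real[of 1 x] by simp

lemma scaleC_zero_left [simp]: "0 *\<^sub>C (x::'a::complex_banach) = 0"
  using scaleC_of_real[of 0 x] by simp

lemma scaleC_zero_right [simp]: "c *\<^sub>C (0::'a::complex_banach) = 0"
  by (rule linear_0[OF bounded_linear.linear[OF bounded_linear_scaleC]])

lemma scaleC_minus_right: "c *\<^sub>C (- x) = - (c *\<^sub>C (x::'a::complex_banach))"
  by (rule linear_neg[OF bounded_linear.linear[OF bounded_linear_scaleC]])

lemma scaleC_diff_right: "c *\<^sub>C (x - y) = c *\<^sub>C x - c *\<^sub>C (y::'a::complex_banach)"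
  by (rule linear_diff[OF bounded_linear.linear[OF bounded_linear_scaleC]])

lemma scaleC_minus_left: "(- c) *\<^sub>C x = - (c *\<^sub>C (x::'a::complex_banach))"
  using scaleC_add_left[of c "-c" x] by (simp add: eq_neg_iff_add_eq_0 add.commute)

lemma scaleC_diff_left: "(c - d) *\<^sub>C x = c *\<^sub>C x - d *\<^sub>C (x::'a::complex_banach)"
  using scaleC_add_left[of c "-d" x] by (simp add: scaleC_minus_left)

lemmas scaleC_simps = scaleC_scaleC scaleC_add_left scaleC_add_right scaleC_diff_left
  scaleC_diff_right scaleC_minus_left scaleC_minus_right

lemma bounded_bilinear_scaleC:
  "bounded_bilinear (\<lambda>c (x::'a::complex_banach). c *\<^sub>C x)"
proof
  show "(r *\<^sub>R a) *\<^sub>C b = r *\<^sub>R a *\<^sub>C b" for r a and b :: 'a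
    by (simp add: scaleC_scaleC scaleR_conv_of_real flip: scaleC_of_real)
  show "a *\<^sub>C r *\<^sub>R b = r *\<^sub>R a *\<^sub>C b" for r a and b :: 'a
    by (simp add: scaleC_scaleC mult.commute flip: scaleC_of_real)
  show "\<exists>K. \<forall>a (b::'a). norm (a *\<^sub>C b) \<le> norm a * norm b * K"
    by (rule exI[of _ 1]) (simp add: norm_scaleC)
qed (simp_all add: scaleC_simps)

lemmas continuous_on_scaleC [continuous_intros] =
  bounded_bilinear.continuous_on[OF bounded_bilinear_scaleC]
lemmas tendsto_scaleC [tendsto_intros] =
  bounded_bilinear.tendsto[OF bounded_bilinear_scaleC]
lemmas has_integral_scaleC_left =
  has_integral_linear[OF _ bounded_bilinear.bounded_linear_left[OF bounded_bilinear_scaleC], unfolded o_def]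
lemmas has_integral_scaleC_right =
  has_integral_linear[OF _ bounded_linear_scaleC, unfolded o_def]

lemma scaleC_compose_left [simp]: "(c *\<^sub>C A) o\<^sub>L B = c *\<^sub>C (A o\<^sub>L B)"
  for A :: "'b::real_normed_vector \<Rightarrow>\<^sub>L 'a::complex_banach"
  by (rule blinfun_eqI) (simp add: blinfun_apply_scaleC)

lemma scaleC_compose_right: "A \<in> BX \<Longrightarrow> A o\<^sub>L (c *\<^sub>C B) = c *\<^sub>C (A o\<^sub>L B)"
  by (rule blinfun_eqI) (simp add: blinfun_apply_scaleC BX_def)

lemma compose_id [simp]: "A o\<^sub>L id_blinfun = A" "id_blinfun o\<^sub>L A = A"
  by (auto intro: blinfun_eqI)

lemma compose_assoc: "(A o\<^sub>L B) o\<^sub>L C = A o\<^sub>L (B o\<^sub>L C)"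
  by (rule blinfun_eqI) simp

interpretation blinfun_compose: bounded_bilinear
  "(o\<^sub>L) :: ('b::real_normed_vector \<Rightarrow>\<^sub>L 'c::real_normed_vector) \<Rightarrow> ('a::real_normed_vector \<Rightarrow>\<^sub>L 'b) \<Rightarrow> _"
  by (rule bounded_bilinear_blinfun_compose)

lemma BX_id [simp]: "id_blinfun \<in> BX"
  and BX_compose: "A \<in> BX \<Longrightarrow> B \<in> BX \<Longrightarrow> A o\<^sub>L B \<in> BX"
  and BX_add: "A \<in> BX \<Longrightarrow> B \<in> BX \<Longrightarrow> A + B \<in> BX"
  and BX_diff: "A \<in> BX \<Longrightarrow> B \<in> BX \<Longrightarrow> A - B \<in> BX"
  and BX_scaleC: "A \<in> BX \<Longrightarrow> c *\<^sub>C A \<in> BX"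
  by (auto simp: BX_def blinfun.add_left blinfun.diff_left scaleC_add_right scaleC_diff_right
      blinfun_apply_scaleC scaleC_scaleC mult.commute)

lemma op_inv_eqI:
  assumes "is_op_inv A B"
  shows "op_inv A = B"
  unfolding op_inv_def
proof (rule the_equality[of "is_op_inv A", OF assms])
  fix C assume "is_op_inv A C"
  then have "C = C o\<^sub>L (A o\<^sub>L B)" "(C o\<^sub>L A) o\<^sub>L B = B"
    using assms by (auto simp: is_op_inv_def)
  then show "C = B" by (simp add: compose_assoc)
qed

lemma is_op_inv_scaleC:
  assumes "is_op_inv A B" "c \<noteq> 0" "A \<in> BX"
  shows "is_op_inv (c *\<^sub>C A) (inverse c *\<^sub>C B)"
  using assms by (simp add: is_op_inv_def BX_scaleC scaleC_compose_right scaleC_scaleC)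

section \<open>The resolvent: identities, continuity and differentiation along a curve\<close>

locale operator =
  fixes T :: "'a::complex_banach \<Rightarrow>\<^sub>L 'a"
  assumes T_BX: "T \<in> BX"
begin

abbreviation R :: "complex \<Rightarrow> 'a \<Rightarrow>\<^sub>L 'a" where "R z \<equiv> resolvent z T"

lemma resolvent_is_op_inv:
  assumes "z \<notin> spectrum T"
  shows "is_op_inv (z *\<^sub>C id_blinfun - T) (R z)"
proof -
  obtain B where B: "is_op_inv (z *\<^sub>C id_blinfun - T) B"
    using assms by (auto simp: spectrum_def)
  then show ?thesis by (simp add: resolvent_def op_inv_eqI)
qed

lemma resolvent_BX: "z \<notin> spectrum T \<Longrightarrow> R z \<in> BX"
  using resolvent_is_op_inv by (simp add: is_op_inv_def)

lemma resolvent_cancel: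
  "z \<notin> spectrum T \<Longrightarrow> (z *\<^sub>C id_blinfun - T) o\<^sub>L R z = id_blinfun"
  "z \<notin> spectrum T \<Longrightarrow> R z o\<^sub>L (z *\<^sub>C id_blinfun - T) = id_blinfun"
  using resolvent_is_op_inv[of z] by (simp_all add: is_op_inv_def)

lemma resolvent_right:
  assumes "z \<notin> spectrum T"
  shows "T o\<^sub>L R z = z *\<^sub>C R z - id_blinfun"
proof -
  have "z *\<^sub>C R z - (T o\<^sub>L R z) = id_blinfun"
    using resolvent_cancel(1)[OF assms] by (simp add: blinfun_compose.diff_left)
  then show ?thesis by (simp add: diff_eq_eq eq_diff_eq add.commute)
qed

lemma resolvent_left:
  assumes "z \<notin> spectrum T"
  shows "R z o\<^sub>L T = z *\<^sub>C R z - id_blinfun"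
proof -
  have "z *\<^sub>C R z - (R z o\<^sub>L T) = id_blinfun"
    using resolvent_cancel(2)[OF assms]
    by (simp add: blinfun_compose.diff_right scaleC_compose_right[OF resolvent_BX[OF assms]])
  then show ?thesis by (simp add: diff_eq_eq eq_diff_eq add.commute)
qed

text \<open>The weights serve two uses. With \<open>a = b = 1\<close> this is the resolvent
  identity; for \<open>z = l * \<gamma>\<close>, \<open>w = m * \<gamma>\<close>,
  \<open>a = l\<close>, \<open>b = m\<close> the identity term cancels, and only a multiple of
  \<open>T\<close> remains between the two resolvents.\<close>

lemma resolvent_scaled_identity:
  assumes z: "z \<notin> spectrum T" and w: "w \<notin> spectrum T"
  shows "b *\<^sub>C R w - a *\<^sub>C R z = R z o\<^sub>L ((b * z - a * w) *\<^sub>C id_blinfun - (b - a) *\<^sub>C T) o\<^sub>L R w"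
proof -
  have "b *\<^sub>C R w - a *\<^sub>C R z
      = b *\<^sub>C ((R z o\<^sub>L (z *\<^sub>C id_blinfun - T)) o\<^sub>L R w) - a *\<^sub>C (R z o\<^sub>L ((w *\<^sub>C id_blinfun - T) o\<^sub>L R w))"
    using resolvent_cancel[OF z] resolvent_cancel[OF w] by simp
  also have "\<dots> = R z o\<^sub>L (b *\<^sub>C (z *\<^sub>C id_blinfun - T) - a *\<^sub>C (w *\<^sub>C id_blinfun - T)) o\<^sub>L R w"
    by (simp only: scaleC_compose_right[OF resolvent_BX[OF z]] scaleC_compose_left compose_assoc
        blinfun_compose.diff_left blinfun_compose.diff_right)
  also have "b *\<^sub>C (z *\<^sub>C id_blinfun - T) - a *\<^sub>C (w *\<^sub>C id_blinfun - T)
    = (b * z - a * w) *\<^sub>C id_blinfun - (b - a) *\<^sub>C T"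
    by (simp add: scaleC_simps algebra_simps)
  finally show ?thesis .
qed

lemma resolvent_identity:
  assumes "z \<notin> spectrum T" "w \<notin> spectrum T"
  shows "R w - R z = (z - w) *\<^sub>C (R z o\<^sub>L R w)"
  using resolvent_scaled_identity[OF assms, of 1 1] resolvent_BX[OF assms(1)]
  by (simp add: scaleC_compose_right)

text \<open>Half of \<open>norm (R w)\<close> is absorbed in the resolvent identity. This a priori
  bound is what turns that identity into continuity of \<open>R\<close>.\<close>

lemma norm_resolvent_near:
  assumes z: "z \<notin> spectrum T" and w: "w \<notin> spectrum T" and d: "cmod (z - w) * norm (R z) \<le> 1/2"
  shows "norm (R w) \<le> 2 * norm (R z)"
proof -
  have "norm (R w) \<le> norm (R z) + norm ((z - w) *\<^sub>C (R z o\<^sub>L R w))"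
    using resolvent_identity[OF z w] norm_triangle_sub[of "R w" "R z"] by simp
  also have "norm ((z - w) *\<^sub>C (R z o\<^sub>L R w)) \<le> cmod (z - w) * (norm (R z) * norm (R w))"
    by (simp add: norm_scaleC mult_left_mono norm_blinfun_compose)
  also have "\<dots> \<le> 1/2 * norm (R w)"
    using mult_right_mono[OF d norm_ge_zero[of "R w"]] by (simp add: mult.assoc)
  finally show ?thesis by simp
qed

lemma isCont_resolvent:
  assumes "open U" "U \<inter> spectrum T = {}" "z \<in> U"
  shows "isCont R z"
proof -
  have z: "z \<notin> spectrum T" using assms by auto
  have "((\<lambda>w. cmod (z - w) * norm (R z)) \<longlongrightarrow> cmod (z - z) * norm (R z)) (at z)"
    by (intro tendsto_intros)
  then have "\<forall>\<^sub>F w in at z. cmod (z - w) * norm (R z) < 1/2"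
    by (rule order_tendstoD) simp
  moreover have "\<forall>\<^sub>F w in at z. w \<in> U"
    using assms by (simp add: eventually_at_in_open')
  ultimately have ev: "\<forall>\<^sub>F w in at z. norm (R w - R z) \<le> cmod (z - w) * (norm (R z) * (2 * norm (R z)))"
  proof eventually_elim
    case (elim w)
    then have w: "w \<notin> spectrum T" using assms by auto
    have "norm (R w - R z) \<le> cmod (z - w) * norm (R z o\<^sub>L R w)"
      by (simp add: resolvent_identity[OF z w] norm_scaleC)
    also have "norm (R z o\<^sub>L R w) \<le> norm (R z) * (2 * norm (R z))"
      using norm_resolvent_near[OF z w] elim
      by (intro order_trans[OF norm_blinfun_compose] mult_left_mono) auto
    finally show ?case by (simp add: mult_left_mono)
  qed
  have "((\<lambda>w. cmod (z - w) * (norm (R z) * (2 * norm (R z)))) \<longlongrightarrow> cmod (z - z) * (norm (R z) * (2 * norm (R z)))) (at z)"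
    by (intro tendsto_intros)
  then have "((\<lambda>w. R w - R z) \<longlongrightarrow> 0) (at z)"
    using ev by (intro Lim_null_comparison[OF ev]) simp
  then show ?thesis by (simp add: isCont_def LIM_zero_iff)
qed

lemma continuous_on_resolvent:
  assumes "open U" "U \<inter> spectrum T = {}"
  shows "continuous_on U R"
  using isCont_resolvent[OF assms] by (simp add: continuous_at_imp_continuous_on)

lemma resolvent_along_curve_has_vector_derivative:
  assumes U: "open U" "U \<inter> spectrum T = {}" "g t \<in> U" and g: "(g has_vector_derivative g') (at t)"
  shows "((\<lambda>x. R (g x)) has_vector_derivative - (g' *\<^sub>C (R (g t) o\<^sub>L R (g t)))) (at t)"
proof -
  have gc: "isCont g t"
    using g by (rule has_vector_derivative_continuous)
  have Rg: "((\<lambda>x. R (g x)) \<longlongrightarrow> R (g t)) (at t)"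
    using isCont_o2[OF gc isCont_resolvent[OF U]] by (simp add: isCont_def)
  define q where "q x = (g x - g t - (x - t) *\<^sub>R g') /\<^sub>R norm (x - t)" for x
  define N where "N x = R (g t) o\<^sub>L R (g x)" for x
  have q: "(q \<longlongrightarrow> 0) (at t)"
    using g by (simp add: has_vector_derivative_def has_derivative_at_within q_def[abs_def])
  have N: "(N \<longlongrightarrow> N t) (at t)"
    unfolding N_def by (intro tendsto_intros Rg)
  have ev: "\<forall>\<^sub>F x in at t. g x \<in> U"
    using gc U by (auto simp: isCont_def topological_tendstoD)
  \<comment> \<open>The error of the difference quotient splits into the first-order remainder
    \<open>q\<close> of the curve, which tends to 0, and a bounded sign times the increment of
    \<open>N\<close>, which tends to 0 by continuity of \<open>R\<close>.\<close>
  have eq: "- (q x *\<^sub>C N x) - sgn (x - t) *\<^sub>R (g' *\<^sub>C (N x - N t))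
      = (R (g x) - R (g t) - (x - t) *\<^sub>R - (g' *\<^sub>C N t)) /\<^sub>R norm (x - t)" if "g x \<in> U" for x
  proof -
    have "R (g x) - R (g t) = - ((g x - g t) *\<^sub>C N x)"
      using resolvent_identity[of "g t" "g x"] U that
      by (auto simp: N_def scaleC_diff_left)
    then have *: "R (g x) - R (g t) - (x - t) *\<^sub>R - (g' *\<^sub>C N t)
        = - ((g x - g t - (x - t) *\<^sub>R g') *\<^sub>C N x) - (x - t) *\<^sub>R (g' *\<^sub>C (N x - N t))"
      by (simp add: scaleC_simps scaleR_conv_of_real flip: scaleC_of_real)
    show ?thesis
      unfolding * q_def sgn_div_norm bounded_bilinear.scaleR_left[OF bounded_bilinear_scaleC]
      by (simp only: scaleR_diff_right[of _ "- _"] scaleR_minus_right scaleR_scaleR real_norm_def real_scaleR_def)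
  qed
  have "((\<lambda>x. - (q x *\<^sub>C N x) - sgn (x - t) *\<^sub>R (g' *\<^sub>C (N x - N t))) \<longlongrightarrow> - (0 *\<^sub>C N t) - 0) (at t)"
  proof (intro tendsto_diff tendsto_minus tendsto_scaleC q N)
    have "((\<lambda>x. norm (g' *\<^sub>C (N x - N t))) \<longlongrightarrow> norm (g' *\<^sub>C (N t - N t))) (at t)"
      by (intro tendsto_intros N)
    then have lim0: "((\<lambda>x. norm (g' *\<^sub>C (N x - N t))) \<longlongrightarrow> 0) (at t)"
      by simp
    have "norm (sgn (x - t) *\<^sub>R v) \<le> norm v" for x and v :: "'a \<Rightarrow>\<^sub>L 'a"
      by (simp add: abs_sgn_eq)
    then show "((\<lambda>x. sgn (x - t) *\<^sub>R (g' *\<^sub>C (N x - N t))) \<longlongrightarrow> 0) (at t)"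
      by (intro Lim_null_comparison[OF always_eventually lim0] allI)
  qed
  then have "((\<lambda>x. - (q x *\<^sub>C N x) - sgn (x - t) *\<^sub>R (g' *\<^sub>C (N x - N t))) \<longlongrightarrow> 0) (at t)"
    by simp
  moreover have "\<forall>\<^sub>F x in at t. - (q x *\<^sub>C N x) - sgn (x - t) *\<^sub>R (g' *\<^sub>C (N x - N t))
      = (R (g x) - R (g t) - (x - t) *\<^sub>R - (g' *\<^sub>C N t)) /\<^sub>R norm (x - t)"
    using ev by eventually_elim (rule eq)
  ultimately have "((\<lambda>x. (R (g x) - R (g t) - (x - t) *\<^sub>R - (g' *\<^sub>C N t)) /\<^sub>R norm (x - t)) \<longlongrightarrow> 0) (at t)"
    by (rule Lim_transform_eventually)
  then show ?thesis
    unfolding has_vector_derivative_def has_derivative_at_within N_def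
    by (intro conjI bounded_linear_scaleR_left)
qed

text \<open>Solves \<open>z R = T R + I\<close> for the norm instead of summing a Neumann series.
  The norm of the identity is kept as it is, since it is 0 on the trivial space.\<close>

lemma norm_resolvent_le:
  assumes z: "z \<notin> spectrum T" and big: "norm T < cmod z"
  shows "norm (R z) \<le> norm (id_blinfun :: 'a \<Rightarrow>\<^sub>L 'a) / (cmod z - norm T)"
proof -
  have "z *\<^sub>C R z = (T o\<^sub>L R z) + id_blinfun"
    using resolvent_right[OF z] by simp
  then have "cmod z * norm (R z) = norm ((T o\<^sub>L R z) + id_blinfun)"
    by (simp flip: norm_scaleC)
  also have "\<dots> \<le> norm T * norm (R z) + norm (id_blinfun :: 'a \<Rightarrow>\<^sub>L 'a)"
    by (intro order_trans[OF norm_triangle_ineq] add_mono norm_blinfun_compose) simp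
  finally show ?thesis
    using big by (simp add: field_simps)
qed

end

subsection \<open>Integrals of operator-valued functions along loops\<close>

text \<open>At the points of \<open>B\<close> the velocity may be any value of modulus at most
  \<open>L\<close>, since \<open>vector_derivative\<close> is unspecified at a corner. No continuity
  of the velocity is recorded elsewhere either; integrability comes from the fundamental theorem of
  calculus.\<close>

locale bounded_velocity_loop =
  fixes \<gamma> \<gamma>' :: "real \<Rightarrow> complex" and B :: "real set" and L :: real
  assumes cont: "continuous_on {0..1} \<gamma>"
    and closed_loop: "\<gamma> 0 = \<gamma> 1"
    and finite_B: "finite B"
    and deriv: "t \<in> {0<..<1} - B \<Longrightarrow> (\<gamma> has_vector_derivative \<gamma>' t) (at t)"
    and velocity_bound: "t \<in> {0..1} \<Longrightarrow> cmod (\<gamma>' t) \<le> L"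
begin

lemma L_nonneg: "0 \<le> L"
  using order_trans[OF norm_ge_zero velocity_bound[of 0]] by simp

lemma velocity_has_integral:
  assumes "0 \<le> a" "a \<le> b" "b \<le> 1"
  shows "(\<gamma>' has_integral \<gamma> b - \<gamma> a) {a..b}"
proof (rule fundamental_theorem_of_calculus_interior_strong[OF finite_B])
  show "continuous_on {a..b} \<gamma>"
    by (rule continuous_on_subset[OF cont]) (use assms in auto)
qed (use assms deriv in auto)

text \<open>A uniform limit of integrable functions: freezing \<open>f\<close> at the tag of each
  cell leaves the velocity times a fixed vector, which is integrable because \<gamma> is a primitive
  of the velocity.\<close>

lemma integrable_velocity_scaleC:
  fixes f :: "real \<Rightarrow> 'b::complex_banach"
  assumes f: "continuous_on {0..1} f"
  shows "(\<lambda>t. \<gamma>' t *\<^sub>C f t) integrable_on {0..1}"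
proof -
  have "(\<lambda>t. \<gamma>' t *\<^sub>C f t) integrable_on cbox 0 1"
  proof (rule integrable_uniform_limit)
    fix e :: real assume e: "e > 0"
    \<comment> \<open>\<open>L + 1\<close> instead of \<open>L\<close>, which may be 0.\<close>
    define e' where "e' = e / (L + 1)"
    have e': "e' > 0" using e L_nonneg by (simp add: e'_def)
    obtain d where d: "0 < d" "\<And>x x'. \<lbrakk>x \<in> {0..1}; x' \<in> {0..1}; dist x' x < d\<rbrakk> \<Longrightarrow> dist (f x') (f x) < e'"
      using compact_uniformly_continuous[OF f] e' unfolding uniformly_continuous_on_def by force
    obtain p where ptag: "p tagged_division_of cbox 0 (1::real)" and finep: "(\<lambda>x. ball x d) fine p"
      using fine_division_exists[OF gauge_ball[OF \<open>0 < d\<close>], of 0 "1::real"] .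
    have *: "\<forall>i\<in>snd ` p. \<exists>g. (\<forall>x\<in>i. norm (\<gamma>' x *\<^sub>C f x - g x) \<le> e) \<and> g integrable_on i"
    proof clarsimp
      fix x K assume xK: "(x, K) \<in> p"
      then have x: "x \<in> {0..1}" and K: "K \<subseteq> {0..1}" "K \<subseteq> ball x d"
        using tagged_division_ofD(2,3)[OF ptag xK] finep by (auto simp: fine_def)
      obtain a b where ab: "K = cbox a b" using tagged_division_ofD(4)[OF ptag xK] by blast
      have "a \<le> b" using tagged_division_ofD(2)[OF ptag xK] ab by auto
      then have "(\<lambda>t. \<gamma>' t *\<^sub>C f x) integrable_on K"
        using K ab has_integral_scaleC_left[OF velocity_has_integral[of a b]]
        by (auto simp: integrable_on_def)
      moreover have "norm (\<gamma>' t *\<^sub>C f t - \<gamma>' t *\<^sub>C f x) \<le> e" if "t \<in> K" for t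
      proof -
        have "norm (\<gamma>' t *\<^sub>C f t - \<gamma>' t *\<^sub>C f x) = cmod (\<gamma>' t) * norm (f t - f x)"
          by (simp add: norm_scaleC flip: scaleC_diff_right)
        also have "\<dots> \<le> L * e'"
          using velocity_bound[of t] d(2)[of x t] that K x L_nonneg
          by (intro mult_mono) (auto simp: dist_norm abs_minus_commute subset_eq less_imp_le)
        also have "\<dots> \<le> e" using e L_nonneg by (simp add: e'_def field_simps)
        finally show ?thesis .
      qed
      ultimately show "\<exists>g. (\<forall>t\<in>K. norm (\<gamma>' t *\<^sub>C f t - g t) \<le> e) \<and> g integrable_on K"
        by (intro exI[of _ "\<lambda>t. \<gamma>' t *\<^sub>C f x"] conjI ballI)
    qed
    show "\<exists>g. (\<forall>x\<in>cbox 0 1. norm (\<gamma>' x *\<^sub>C f x - g x) \<le> e) \<and> g integrable_on cbox 0 1"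
      by (rule approximable_on_division[OF less_imp_le[OF e] division_of_tagged_division[OF ptag] *]) blast
  qed
  then show ?thesis by simp
qed

abbreviation path_integral :: "(real \<Rightarrow> 'b::complex_banach) \<Rightarrow> 'b"
  where "path_integral f \<equiv> integral {0..1} (\<lambda>t. \<gamma>' t *\<^sub>C f t)"

lemma path_integral_has_integral:
  fixes f :: "real \<Rightarrow> 'b::complex_banach"
  shows "continuous_on {0..1} f \<Longrightarrow> ((\<lambda>t. \<gamma>' t *\<^sub>C f t) has_integral path_integral f) {0..1}"
  by (simp add: integrable_velocity_scaleC integrable_integral)

lemma norm_path_integral_le:
  fixes f :: "real \<Rightarrow> 'b::complex_banach"
  assumes "continuous_on {0..1} f" "\<And>t. t \<in> {0..1} \<Longrightarrow> norm (f t) \<le> C"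
  shows "norm (path_integral f) \<le> L * C"
proof -
  have C: "0 \<le> C" using order_trans[OF norm_ge_zero assms(2)[of 0]] by simp
  have "norm (\<gamma>' t *\<^sub>C f t) \<le> L * C" if "t \<in> {0..1}" for t
    unfolding norm_scaleC by (intro mult_mono velocity_bound assms(2) that L_nonneg norm_ge_zero)
  then have "norm (path_integral f) \<le> (L * C) * measure lborel {0..1::real}"
    using C L_nonneg
    by (intro has_integral_bound_real[OF _ finite.emptyI path_integral_has_integral[OF assms(1)]]) auto
  then show ?thesis by simp
qed

lemma path_integral_diff:
  fixes f g :: "real \<Rightarrow> 'b::complex_banach"
  assumes "continuous_on {0..1} f" "continuous_on {0..1} g"
  shows "path_integral (\<lambda>t. f t - g t) = path_integral f - path_integral g"
  using assms by (simp add: scaleC_diff_right integral_diff integrable_velocity_scaleC)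

lemma path_integral_add:
  fixes f g :: "real \<Rightarrow> 'b::complex_banach"
  assumes "continuous_on {0..1} f" "continuous_on {0..1} g"
  shows "path_integral (\<lambda>t. f t + g t) = path_integral f + path_integral g"
  using assms by (simp add: scaleC_add_right integral_add integrable_velocity_scaleC)

lemma path_integral_linear:
  fixes f :: "real \<Rightarrow> 'b::complex_banach"
  assumes "continuous_on {0..1} f" "bounded_linear h" "\<And>c x. h (c *\<^sub>C x) = c *\<^sub>C (h x :: 'c::complex_banach)"
  shows "path_integral (\<lambda>t. h (f t)) = h (path_integral f)"
  using integral_linear[OF integrable_velocity_scaleC[OF assms(1)] assms(2)]
  by (simp add: o_def assms(3))

text \<open>On a convex open set \<open>h\<close> has a primitive; composed with the dilated loop it
  is a primitive of the integrand off \<open>B\<close>, and the loop is closed. The factor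
  \<open>l\<close> is the derivative of the dilation.\<close>

lemma path_integral_holomorphic:
  assumes h: "h holomorphic_on S" "open S" "convex S"
    and g: "\<And>t. t \<in> {0..1} \<Longrightarrow> of_real l * \<gamma> t \<in> S"
  shows "path_integral (\<lambda>t. of_real l * h (of_real l * \<gamma> t)) = 0"
proof -
  obtain H where H: "\<And>z. z \<in> S \<Longrightarrow> (H has_field_derivative h z) (at z)"
    using holomorphic_convex_primitive'[OF h(3,2,1)] h(2) by (metis at_within_open)
  have "((\<lambda>t. \<gamma>' t *\<^sub>C (of_real l * h (of_real l * \<gamma> t))) has_integral
      H (of_real l * \<gamma> 1) - H (of_real l * \<gamma> 0)) {0..1}"
  proof (rule fundamental_theorem_of_calculus_interior_strong[OF finite_B])
    show "((\<lambda>t. H (of_real l * \<gamma> t)) has_vector_derivative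
        \<gamma>' t *\<^sub>C (of_real l * h (of_real l * \<gamma> t))) (at t)" if "t \<in> {0<..<1} - B" for t
    proof -
      have "((\<lambda>t. of_real l * \<gamma> t) has_vector_derivative of_real l * \<gamma>' t) (at t)"
        by (rule has_vector_derivative_mult_right[OF deriv[OF that]])
      from field_vector_diff_chain_at[OF this H[OF g]] that
      show ?thesis by (simp add: o_def scaleC_complex_def mult_ac)
    qed
    show "continuous_on {0..1} (\<lambda>t. H (of_real l * \<gamma> t))"
      by (rule continuous_on_compose2[of S H, OF _ continuous_on_mult_left[OF cont]])
        (use H g in \<open>auto intro: DERIV_continuous_on has_field_derivative_at_within\<close>)
  qed simp
  then show ?thesis by (simp add: closed_loop integral_unique)
qed

end

text \<open>
  Dilating the loop by \<open>l > 1\<close> moves it away from the spectrum.  The integral of the resolvent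
  along the dilated loop has derivative 0 in \<open>l\<close>, and its value is read off as \<open>l \<rightarrow> \<infinity>\<close>.
\<close>

locale resolvent_loop = bounded_velocity_loop + operator T
  for T :: "'a::complex_banach \<Rightarrow>\<^sub>L 'a" +
  fixes U :: "complex set"
  assumes open_U: "open U" and U_spectrum: "U \<inter> spectrum T = {}"
    and dilate_U: "t \<in> {0..1} \<Longrightarrow> 1 < l \<Longrightarrow> of_real l * \<gamma> t \<in> U"
    and nonzero: "t \<in> {0..1} \<Longrightarrow> \<gamma> t \<noteq> 0"
    and winding: "path_integral (\<lambda>t. inverse (\<gamma> t)) = 2 * of_real pi * \<i>"
begin

definition J :: "real \<Rightarrow> 'a \<Rightarrow>\<^sub>L 'a"
  where "J l = path_integral (\<lambda>t. of_real l *\<^sub>C R (of_real l * \<gamma> t))"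

lemma dilate_spectrum: "t \<in> {0..1} \<Longrightarrow> 1 < l \<Longrightarrow> of_real l * \<gamma> t \<notin> spectrum T"
  using dilate_U U_spectrum by blast

lemma continuous_on_dilate_resolvent:
  assumes "1 < l"
  shows "continuous_on {0..1} (\<lambda>t. R (of_real l * \<gamma> t))"
  by (rule continuous_on_compose2[OF continuous_on_resolvent[OF open_U U_spectrum] continuous_on_mult_left[OF cont]])
    (use dilate_U assms in auto)

text \<open>Along the dilated loop \<open>R\<close> itself is, up to sign, a primitive of its
  square. This takes the place of a Cauchy theorem for operator-valued functions.\<close>

lemma path_integral_resolvent_square:
  assumes l: "1 < l"
  shows "path_integral (\<lambda>t. R (of_real l * \<gamma> t) o\<^sub>L R (of_real l * \<gamma> t)) = 0"
proof -
  have "((\<lambda>t. - ((of_real l * \<gamma>' t) *\<^sub>C (R (of_real l * \<gamma> t) o\<^sub>L R (of_real l * \<gamma> t)))) has_integral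
      R (of_real l * \<gamma> 1) - R (of_real l * \<gamma> 0)) {0..1}"
  proof (rule fundamental_theorem_of_calculus_interior_strong[OF finite_B])
    show "((\<lambda>t. R (of_real l * \<gamma> t)) has_vector_derivative
        - ((of_real l * \<gamma>' t) *\<^sub>C (R (of_real l * \<gamma> t) o\<^sub>L R (of_real l * \<gamma> t)))) (at t)"
      if "t \<in> {0<..<1} - B" for t
      by (rule resolvent_along_curve_has_vector_derivative[OF open_U U_spectrum
            _ has_vector_derivative_mult_right[OF deriv[OF that]]])
        (use that l dilate_U in auto)
  qed (use continuous_on_dilate_resolvent l in auto)
  from has_integral_scaleC_right[OF this, of "- inverse (of_real l)"] l
  show ?thesis
    by (intro integral_unique) (simp add: closed_loop scaleC_simps field_simps)
qed

text \<open>The factor \<open>m - l\<close> is gained twice: first from the scaled resolvent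
  identity, then because the integral of \<open>P t o\<^sub>L P t\<close> is 0 and may be
  subtracted, so that \<open>Q t - P t\<close> appears.\<close>

lemma J_quadratic:
  assumes "1 < l" "1 < m"
    and l: "\<And>t. t \<in> {0..1} \<Longrightarrow> norm (R (of_real l * \<gamma> t)) \<le> C"
    and m: "\<And>t. t \<in> {0..1} \<Longrightarrow> norm (R (of_real m * \<gamma> t)) \<le> C"
    and G: "\<And>t. t \<in> {0..1} \<Longrightarrow> cmod (\<gamma> t) \<le> G"
  shows "norm (J m - J l) \<le> (m - l)\<^sup>2 * (norm T * (L * (G * C ^ 3)))"
proof -
  define P where "P = (\<lambda>t. R (of_real l * \<gamma> t))"
  define Q where "Q = (\<lambda>t. R (of_real m * \<gamma> t))"
  note [continuous_intros] = bounded_bilinear.continuous_on[OF bounded_bilinear_blinfun_compose]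
  have cP [continuous_intros]: "continuous_on {0..1} P" and cQ [continuous_intros]: "continuous_on {0..1} Q"
    using assms by (auto simp: P_def Q_def intro: continuous_on_dilate_resolvent)
  have JP: "J l = path_integral (\<lambda>t. of_real l *\<^sub>C P t)" and JQ: "J m = path_integral (\<lambda>t. of_real m *\<^sub>C Q t)"
    by (simp_all add: J_def P_def Q_def)
  have PBX: "P t \<in> BX" if "t \<in> {0..1}" for t
    using resolvent_BX dilate_spectrum assms that by (auto simp: P_def)
  have PT: "P t o\<^sub>L T = T o\<^sub>L P t" if "t \<in> {0..1}" for t
    using resolvent_left resolvent_right dilate_spectrum assms that by (auto simp: P_def)
  have step: "of_real m *\<^sub>C Q t - of_real l *\<^sub>C P t = - (of_real (m - l) *\<^sub>C (T o\<^sub>L (P t o\<^sub>L Q t)))"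
    if t: "t \<in> {0..1}" for t
  proof -
    have "of_real m *\<^sub>C Q t - of_real l *\<^sub>C P t = P t o\<^sub>L ((of_real m * (of_real l * \<gamma> t) - of_real l * (of_real m * \<gamma> t))
       *\<^sub>C id_blinfun - (of_real m - of_real l) *\<^sub>C T) o\<^sub>L Q t"
      unfolding P_def Q_def using dilate_spectrum assms t by (intro resolvent_scaled_identity) auto
    also have "\<dots> = - (of_real (m - l) *\<^sub>C ((P t o\<^sub>L T) o\<^sub>L Q t))"
      by (simp add: blinfun_compose.minus_right blinfun_compose.minus_left
          scaleC_compose_right[OF PBX[OF t]] mult_ac)
    finally show ?thesis by (simp add: PT[OF t] compose_assoc)
  qed
  have step2: "Q t - P t = - (of_real (m - l) *\<^sub>C (\<gamma> t *\<^sub>C (P t o\<^sub>L Q t)))" if t: "t \<in> {0..1}" for t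
    using resolvent_identity[of "of_real l * \<gamma> t" "of_real m * \<gamma> t"] dilate_spectrum assms t
    by (simp add: P_def Q_def scaleC_scaleC scaleC_minus_left[symmetric] algebra_simps)
  have "J m - J l = path_integral (\<lambda>t. of_real m *\<^sub>C Q t - of_real l *\<^sub>C P t)"
    unfolding JP JQ by (rule path_integral_diff[symmetric]) (intro continuous_intros cP cQ)+
  also have "\<dots> = path_integral (\<lambda>t. - (of_real (m - l) *\<^sub>C (T o\<^sub>L (P t o\<^sub>L Q t))))"
    by (rule integral_cong) (simp add: step)
  also have "\<dots> = - (of_real (m - l) *\<^sub>C (T o\<^sub>L path_integral (\<lambda>t. P t o\<^sub>L Q t)))"
  proof (rule path_integral_linear)
    show "bounded_linear (\<lambda>A. - (of_real (m - l) *\<^sub>C (T o\<^sub>L A)))"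
      by (intro bounded_linear_minus bounded_linear_compose[OF bounded_linear_scaleC]
          bounded_bilinear.bounded_linear_right[OF bounded_bilinear_blinfun_compose])
  qed (auto intro!: continuous_intros cP cQ
      simp: scaleC_compose_right[OF T_BX] scaleC_scaleC scaleC_minus_right mult.commute)
  also have "path_integral (\<lambda>t. P t o\<^sub>L Q t)
      = path_integral (\<lambda>t. P t o\<^sub>L Q t) - path_integral (\<lambda>t. P t o\<^sub>L P t)"
    using path_integral_resolvent_square assms by (simp add: P_def)
  also have "\<dots> = path_integral (\<lambda>t. (P t o\<^sub>L Q t) - (P t o\<^sub>L P t))"
    by (rule path_integral_diff[symmetric]) (intro continuous_intros cP cQ)+
  also have "\<dots> = path_integral (\<lambda>t. - (of_real (m - l) *\<^sub>C (\<gamma> t *\<^sub>C (P t o\<^sub>L (P t o\<^sub>L Q t)))))"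
    by (rule integral_cong)
      (simp add: step2 blinfun_compose.minus_right scaleC_compose_right[OF PBX]
        flip: blinfun_compose.diff_right)
  also have "\<dots> = - (of_real (m - l) *\<^sub>C path_integral (\<lambda>t. \<gamma> t *\<^sub>C (P t o\<^sub>L (P t o\<^sub>L Q t))))"
    by (rule path_integral_linear)
      (auto intro!: continuous_intros cP cQ cont bounded_linear_minus bounded_linear_scaleC
        simp: scaleC_scaleC scaleC_minus_right mult.commute)
  finally have eq: "J m - J l = of_real ((m - l)\<^sup>2) *\<^sub>C (T o\<^sub>L path_integral (\<lambda>t. \<gamma> t *\<^sub>C (P t o\<^sub>L (P t o\<^sub>L Q t))))"
    by (simp add: blinfun_compose.minus_right scaleC_compose_right[OF T_BX] scaleC_scaleC scaleC_minus_right
        power2_eq_square del: of_real_diff)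
  have C0: "0 \<le> C" using order_trans[OF norm_ge_zero l[of 0]] by simp
  have G0: "0 \<le> G" using order_trans[OF norm_ge_zero G[of 0]] by simp
  have "norm (path_integral (\<lambda>t. \<gamma> t *\<^sub>C (P t o\<^sub>L (P t o\<^sub>L Q t)))) \<le> L * (G * C ^ 3)"
  proof (rule norm_path_integral_le)
    show "norm (\<gamma> t *\<^sub>C (P t o\<^sub>L (P t o\<^sub>L Q t))) \<le> G * C ^ 3" if t: "t \<in> {0..1}" for t
    proof -
      have "norm (P t o\<^sub>L (P t o\<^sub>L Q t)) \<le> norm (P t) * (norm (P t) * norm (Q t))"
        by (intro order_trans[OF norm_blinfun_compose] mult_left_mono norm_blinfun_compose) auto
      also have "\<dots> \<le> C * (C * C)"
        using l[OF t] m[OF t] C0 by (intro mult_mono) (auto simp: P_def Q_def)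
      finally show ?thesis
        using G[OF t] G0 by (auto simp: norm_scaleC power3_eq_cube mult.assoc intro!: mult_mono)
    qed
  qed (intro continuous_intros cont cP cQ)
  then have "norm (T o\<^sub>L path_integral (\<lambda>t. \<gamma> t *\<^sub>C (P t o\<^sub>L (P t o\<^sub>L Q t)))) \<le> norm T * (L * (G * C ^ 3))"
    by (intro order_trans[OF norm_blinfun_compose] mult_left_mono) auto
  then show ?thesis
    unfolding eq norm_scaleC by (simp add: mult_left_mono norm_power del: of_real_power of_real_diff)
qed

lemma loop_bounded: obtains G where "\<forall>t\<in>{0..1}. cmod (\<gamma> t) \<le> G"
proof -
  have "bounded (\<gamma> ` {0..1})"
    by (intro compact_imp_bounded compact_continuous_image cont) auto
  then obtain G where "\<forall>t\<in>{0..1}. cmod (\<gamma> t) \<le> G" by (auto simp: bounded_iff)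
  then show ?thesis using that by blast
qed

lemma dilate_resolvent_bounded:
  assumes "1 < a"
  obtains C where "\<And>t l. t \<in> {0..1} \<Longrightarrow> l \<in> {a..b} \<Longrightarrow> norm (R (of_real l * \<gamma> t)) \<le> C"
proof -
  define K where "K = (\<lambda>(l, t). of_real l * \<gamma> t) ` ({a..b} \<times> {0..1})"
  have "compact K"
    unfolding K_def case_prod_unfold
    by (intro compact_continuous_image compact_Times continuous_intros
        continuous_on_compose2[OF cont continuous_on_snd]) auto
  moreover have "K \<subseteq> U" using dilate_U assms by (auto simp: K_def)
  ultimately have "bounded (R ` K)"
    by (intro compact_imp_bounded compact_continuous_image
        continuous_on_subset[OF continuous_on_resolvent[OF open_U U_spectrum]])
  then show ?thesis using that by (force simp: bounded_iff K_def)
qed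

text \<open>Quadratically small increments force the derivative to be 0.\<close>

lemma J_constant:
  assumes "1 < l" "l \<le> m"
  shows "J m = J l"
proof -
  obtain G where G: "\<forall>t\<in>{0..1}. cmod (\<gamma> t) \<le> G" by (rule loop_bounded)
  obtain C where C: "\<And>t x. t \<in> {0..1} \<Longrightarrow> x \<in> {l..m} \<Longrightarrow> norm (R (of_real x * \<gamma> t)) \<le> C"
    using dilate_resolvent_bounded[OF assms(1)] by blast
  define D where "D = norm T * (L * (G * C ^ 3))"
  have quad: "norm (J y - J x) \<le> (y - x)\<^sup>2 * D" if "x \<in> {l..m}" "y \<in> {l..m}" for x y
    unfolding D_def using J_quadratic[of x y C G] C G that assms by auto
  have "(J has_derivative (\<lambda>h. 0)) (at x within {l..m})" if x: "x \<in> {l..m}" for x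
    unfolding has_derivative_within
  proof (intro conjI bounded_linear_zero)
    have "((\<lambda>y. \<bar>y - x\<bar> * D) \<longlongrightarrow> \<bar>x - x\<bar> * D) (at x within {l..m})"
      by (intro tendsto_intros)
    then have lim: "((\<lambda>y. \<bar>y - x\<bar> * D) \<longlongrightarrow> 0) (at x within {l..m})" by simp
    have ev: "\<forall>\<^sub>F y in at x within {l..m}. norm ((1 / norm (y - x)) *\<^sub>R (J y - (J x + 0))) \<le> \<bar>y - x\<bar> * D"
      unfolding eventually_at_filter
    proof (intro always_eventually allI impI)
      fix y assume "y \<noteq> x" "y \<in> {l..m}"
      then have "norm (J y - J x) \<le> (y - x)\<^sup>2 * D" by (intro quad x)
      also have "(y - x)\<^sup>2 = \<bar>y - x\<bar> * \<bar>y - x\<bar>" by (simp add: power2_eq_square)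
      also have "\<dots> * D = \<bar>y - x\<bar> * D * \<bar>y - x\<bar>" by (simp only: mult_ac)
      finally show "norm ((1 / norm (y - x)) *\<^sub>R (J y - (J x + 0))) \<le> \<bar>y - x\<bar> * D"
        using \<open>y \<noteq> x\<close> by (simp add: divide_le_eq)
    qed
    show "((\<lambda>y. (1 / norm (y - x)) *\<^sub>R (J y - (J x + 0))) \<longlongrightarrow> 0) (at x within {l..m})"
      by (rule Lim_null_comparison[OF ev lim])
  qed
  then have "\<exists>c. \<forall>x\<in>{l..m}. J x = c"
    by (intro has_derivative_zero_constant) auto
  then show ?thesis using assms by force
qed

text \<open>Since \<open>J\<close> is constant it may be evaluated at \<open>m\<close> tending to
  infinity. There the integrand differs from
  \<open>inverse (\<gamma> t) *\<^sub>C id_blinfun\<close> by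
  \<open>inverse (\<gamma> t) *\<^sub>C (T o\<^sub>L R z)\<close>, of order \<open>1 / m\<close>,
  and the winding hypothesis integrates the main term.\<close>

lemma J_eq:
  assumes l: "1 < l"
  shows "J l = (2 * of_real pi * \<i>) *\<^sub>C id_blinfun"
proof -
  have "compact (\<gamma> ` {0..1})" by (intro compact_continuous_image cont) auto
  moreover have "0 \<notin> \<gamma> ` {0..1}" using nonzero by force
  ultimately obtain g where g: "g > 0" "\<And>t. t \<in> {0..1} \<Longrightarrow> g \<le> cmod (\<gamma> t)"
    using separate_point_closed[of "\<gamma> ` {0..1}" 0] by (auto simp: compact_imp_closed)
  define I where "I = norm (id_blinfun :: 'a \<Rightarrow>\<^sub>L 'a)"
  note [continuous_intros] = bounded_bilinear.continuous_on[OF bounded_bilinear_blinfun_compose]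
  have cinv: "continuous_on {0..1} (\<lambda>t. inverse (\<gamma> t))"
    using nonzero by (auto intro!: continuous_intros cont)
  have bound: "norm (J l - (2 * of_real pi * \<i>) *\<^sub>C id_blinfun) \<le> L * (inverse g * (norm T * (I / (m * g - norm T))))"
    if m: "m \<ge> l" "norm T < m * g" for m
  proof -
    have m1: "1 < m" using m l by simp
    have "(2 * of_real pi * \<i>) *\<^sub>C id_blinfun = path_integral (\<lambda>t. inverse (\<gamma> t) *\<^sub>C (id_blinfun :: 'a \<Rightarrow>\<^sub>L 'a))"
      unfolding winding[symmetric]
      by (rule path_integral_linear[OF cinv, symmetric])
        (auto intro: bounded_bilinear.bounded_linear_left[OF bounded_bilinear_scaleC]
          simp: scaleC_scaleC scaleC_complex_def)
    then have "J m - (2 * of_real pi * \<i>) *\<^sub>C id_blinfun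
        = path_integral (\<lambda>t. of_real m *\<^sub>C R (of_real m * \<gamma> t) - inverse (\<gamma> t) *\<^sub>C id_blinfun)"
      unfolding J_def
      by (subst path_integral_diff) (auto intro!: continuous_intros cinv continuous_on_dilate_resolvent[OF m1])
    also have "norm \<dots> \<le> L * (inverse g * (norm T * (I / (m * g - norm T))))"
    proof (rule norm_path_integral_le)
      fix t :: real assume t: "t \<in> {0..1}"
      define z where "z = of_real m * \<gamma> t"
      have z: "z \<notin> spectrum T" using dilate_spectrum[OF t m1] by (simp add: z_def)
      have mg: "m * g \<le> cmod z" using g(2)[OF t] m1 by (simp add: z_def norm_mult)
      have "of_real m *\<^sub>C R z - inverse (\<gamma> t) *\<^sub>C id_blinfun = inverse (\<gamma> t) *\<^sub>C (z *\<^sub>C R z - id_blinfun)"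
        using nonzero[OF t] by (simp add: z_def scaleC_simps field_simps)
      also have "\<dots> = inverse (\<gamma> t) *\<^sub>C (T o\<^sub>L R z)" by (simp add: resolvent_right[OF z])
      also have "norm \<dots> = inverse (cmod (\<gamma> t)) * norm (T o\<^sub>L R z)"
        by (simp add: norm_scaleC norm_inverse)
      also have "\<dots> \<le> inverse g * (norm T * (I / (m * g - norm T)))"
      proof (rule mult_mono)
        show "inverse (cmod (\<gamma> t)) \<le> inverse g" using g t by (simp add: le_imp_inverse_le)
        have "norm (R z) \<le> I / (cmod z - norm T)"
          unfolding I_def using z mg m by (intro norm_resolvent_le) auto
        also have "\<dots> \<le> I / (m * g - norm T)"
          using mg m by (intro divide_left_mono) (auto simp: I_def)
        finally show "norm (T o\<^sub>L R z) \<le> norm T * (I / (m * g - norm T))"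
          by (intro order_trans[OF norm_blinfun_compose] mult_left_mono) auto
      qed (use g in auto)
      finally show "norm (of_real m *\<^sub>C R (of_real m * \<gamma> t) - inverse (\<gamma> t) *\<^sub>C id_blinfun)
         \<le> inverse g * (norm T * (I / (m * g - norm T)))" by (simp add: z_def)
    qed (auto intro!: continuous_intros cinv continuous_on_dilate_resolvent[OF m1])
    finally show ?thesis using J_constant[OF l m(1)] by simp
  qed
  have "filterlim (\<lambda>m. m * g - norm T) at_top at_top"
    using g(1) by real_asymp
  then have "((\<lambda>m. L * (inverse g * (norm T * (I / (m * g - norm T))))) \<longlongrightarrow> L * (inverse g * (norm T * 0))) at_top"
    by (intro tendsto_intros real_tendsto_divide_at_top[of "\<lambda>_. I" I]) auto
  moreover have "\<forall>\<^sub>F m in at_top. norm (J l - (2 * of_real pi * \<i>) *\<^sub>C id_blinfun)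
      \<le> L * (inverse g * (norm T * (I / (m * g - norm T))))"
    using eventually_gt_at_top[of "norm T / g"] eventually_ge_at_top[of l]
    by eventually_elim (use bound g in \<open>auto simp: field_simps\<close>)
  ultimately have "norm (J l - (2 * of_real pi * \<i>) *\<^sub>C id_blinfun) \<le> L * (inverse g * (norm T * 0))"
    by (intro tendsto_lowerbound) auto
  then show ?thesis by simp
qed

end

subsection \<open>The geometry of \<open>E_dom\<close>\<close>

text \<open>Let \<open>e\<close> be the given point of \<open>C\<close> on the segment. The mass
  \<beta> at \<open>y\<close> is traded for mass \<open>\<beta> / \<theta>\<close> at
  \<open>e\<close>, which uses up the mass \<open>\<beta> / \<theta> * (1 - \<theta>)\<close> at
  \<open>x\<close>; the last hypothesis says that \<open>x\<close> carries that much.\<close>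

lemma convex_combination_across_segment:
  assumes C: "convex C" and x: "0 \<le> \<alpha>" "0 \<le> \<beta>" "0 \<le> \<gamma>" "\<alpha> + \<beta> + \<gamma> = 1" "c \<in> C"
    and t: "0 \<le> \<theta>" "\<theta> \<le> 1" "(1 - \<theta>) *\<^sub>R x + \<theta> *\<^sub>R y \<in> C" "\<beta> * (1 - \<theta>) \<le> \<alpha> * \<theta>"
  shows "\<alpha> *\<^sub>R x + \<beta> *\<^sub>R y + \<gamma> *\<^sub>R c \<in> convex hull (insert x C)"
proof (cases "\<theta> = 0")
  case True
  then have "\<beta> = 0" using t x by auto
  then have "\<alpha> *\<^sub>R x + \<beta> *\<^sub>R y + \<gamma> *\<^sub>R c = \<alpha> *\<^sub>R x + \<gamma> *\<^sub>R c" by simp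
  also have "\<dots> \<in> convex hull (insert x C)"
    by (rule convexD[OF convex_convex_hull]) (use x \<open>\<beta> = 0\<close> in \<open>auto simp: hull_inc\<close>)
  finally show ?thesis .
next
  case False
  define e where "e = (1 - \<theta>) *\<^sub>R x + \<theta> *\<^sub>R y"
  have pos: "\<theta> > 0" using False t by simp
  define m where "m = \<beta> / \<theta>"
  have m: "0 \<le> m" "0 \<le> \<alpha> - m * (1 - \<theta>)" "m * \<theta> = \<beta>" using pos t x by (auto simp: m_def field_simps)
  have sum: "(\<alpha> - m * (1 - \<theta>)) + (m + \<gamma>) = 1" using m(3) x(4) by (simp add: algebra_simps)
  have "\<alpha> *\<^sub>R x + \<beta> *\<^sub>R y + \<gamma> *\<^sub>R c = (\<alpha> - m * (1 - \<theta>)) *\<^sub>R x + m *\<^sub>R e + \<gamma> *\<^sub>R c"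
    using m(3) by (simp add: e_def algebra_simps flip: m(3))
  also have "\<dots> \<in> convex hull (insert x C)"
  proof (cases "m + \<gamma> = 0")
    case True
    then have "m = 0" "\<gamma> = 0" using m(1) x(3) by auto
    then show ?thesis using sum by (simp add: hull_inc)
  next
    case False
    then have mg: "m + \<gamma> > 0" using m x by simp
    have p: "(m / (m + \<gamma>)) *\<^sub>R e + (\<gamma> / (m + \<gamma>)) *\<^sub>R c \<in> C"
      by (rule convexD[OF C]) (use t x m mg in \<open>auto simp: e_def simp flip: add_divide_distrib\<close>)
    have "(\<alpha> - m * (1 - \<theta>)) *\<^sub>R x + (m + \<gamma>) *\<^sub>R ((m / (m + \<gamma>)) *\<^sub>R e + (\<gamma> / (m + \<gamma>)) *\<^sub>R c)
        \<in> convex hull (insert x C)"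
      by (rule convexD[OF convex_convex_hull]) (use p m sum mg in \<open>auto intro: hull_inc\<close>)
    then show ?thesis using mg by (simp add: scaleR_add_right add.assoc)
  qed
  finally show ?thesis .
qed

text \<open>One of the two vertices can always be eliminated in favour of the point of the segment
  in \<open>C\<close>. Which one is decided by an inequality between their weights, whose negation
  implies its mirror image with \<open>x\<close> and \<open>y\<close> exchanged.\<close>

lemma convex_hull_insert2_across_segment:
  assumes C: "convex C" "C \<noteq> {}" and xy: "closed_segment x y \<inter> C \<noteq> {}"
  shows "convex hull (insert x (insert y C)) \<subseteq> convex hull (insert x C) \<union> convex hull (insert y C)"
proof
  fix z assume "z \<in> convex hull (insert x (insert y C))"
  then obtain a b w where ab: "a \<ge> 0" "b \<ge> 0" "a + b = 1" "w \<in> convex hull (insert y C)" "z = a *\<^sub>R x + b *\<^sub>R w"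
    by (auto simp: convex_hull_insert)
  moreover from ab(4) C obtain a' b' c where ab': "a' \<ge> 0" "b' \<ge> 0" "a' + b' = 1" "c \<in> C" "w = a' *\<^sub>R y + b' *\<^sub>R c"
    by (auto simp: convex_hull_insert[OF C(2)] hull_same)
  ultimately have z: "z = a *\<^sub>R x + (b * a') *\<^sub>R y + (b * b') *\<^sub>R c"
    by (simp add: algebra_simps)
  have sum: "a + b * a' + b * b' = 1" using ab(3) ab'(3) by (metis add.assoc distrib_left mult.right_neutral)
  obtain \<theta> where \<theta>: "0 \<le> \<theta>" "\<theta> \<le> 1" "(1 - \<theta>) *\<^sub>R x + \<theta> *\<^sub>R y \<in> C"
    using xy by (auto simp: closed_segment_def)
  show "z \<in> convex hull (insert x C) \<union> convex hull (insert y C)"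
  proof (cases "b * a' * (1 - \<theta>) \<le> a * \<theta>")
    case True
    then show ?thesis
      using convex_combination_across_segment[OF C(1) _ _ _ sum ab'(4) \<theta>] ab ab' z by auto
  next
    case False
    then show ?thesis
      using convex_combination_across_segment[OF C(1) _ _ _ _ ab'(4), of "b * a'" a "b * b'" "1 - \<theta>" y x]
        ab(1,2) ab'(1,2) z \<theta> sum by (auto simp: algebra_simps)
  qed
qed

text \<open>Reduces a hull with many vertices to hulls with one vertex. In the induction the new
  vertex is joined to a point of a single such hull, so that only two vertices have to be handled at
  a time.\<close>

lemma convex_hull_Un_star:
  assumes C: "convex C" "C \<noteq> {}" and A: "finite A" "A \<noteq> {}"
    and seg: "\<And>a b. a \<in> A \<Longrightarrow> b \<in> A \<Longrightarrow> a \<noteq> b \<Longrightarrow> closed_segment a b \<inter> C \<noteq> {}"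
  shows "convex hull (A \<union> C) \<subseteq> (\<Union>a\<in>A. convex hull (insert a C))"
  using A seg
proof (induction A rule: finite_ne_induct)
  case (singleton x)
  then show ?case by simp
next
  case (insert x A)
  show ?case
  proof
    fix z assume "z \<in> convex hull (insert x A \<union> C)"
    then obtain a b w where ab: "a \<ge> 0" "b \<ge> 0" "a + b = 1" "w \<in> convex hull (A \<union> C)" "z = a *\<^sub>R x + b *\<^sub>R w"
      using insert(2) by (auto simp: convex_hull_insert)
    then obtain y where y: "y \<in> A" "w \<in> convex hull (insert y C)"
      using insert by blast
    have "w \<in> convex hull (insert x (insert y C))"
      using y hull_mono[of "insert y C" "insert x (insert y C)" convex] by auto
    then have "z \<in> convex hull (insert x (insert y C))"
      unfolding ab(5) using ab by (intro convexD[OF convex_convex_hull]) (auto simp: hull_inc)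
    moreover have "closed_segment x y \<inter> C \<noteq> {}"
      using insert y by auto
    ultimately have "z \<in> convex hull (insert x C) \<union> convex hull (insert y C)"
      using convex_hull_insert2_across_segment[OF C] by blast
    then show "z \<in> (\<Union>a\<in>insert x A. convex hull (insert a C))" using y by blast
  qed
qed

text \<open>
  For \<open>\<bar>w\<bar> = 1\<close>, \<open>drop_radius u w\<close> is the length of the part in direction \<open>w\<close> of the convex hull of
  \<open>1\<close> and the disc of radius \<open>u\<close>: the two tangents from \<open>1\<close> touch the disc in the points with
  \<open>Re w = u\<close>.
\<close>

definition drop_radius :: "real \<Rightarrow> complex \<Rightarrow> real"
  where "drop_radius u w = (if u \<le> Re w then 1 / (Re w + sqrt (1 - u\<^sup>2) / u * \<bar>Im w\<bar>) else u)"

lemma unit_re_im: "cmod w = 1 \<Longrightarrow> (Re w)\<^sup>2 + (Im w)\<^sup>2 = 1"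
  by (metis cmod_power2 power_one)

text \<open>With \<open>k = sqrt (1 - u\<^sup>2)\<close>: the unit vectors \<open>(u, k)\<close> and
  \<open>(Re w, \<bar>Im w\<bar>)\<close> have scalar product at most 1.\<close>

lemma drop_radius_denominator_le:
  assumes "0 < u" "u < 1" "cmod w = 1"
  shows "Re w + sqrt (1 - u\<^sup>2) / u * \<bar>Im w\<bar> \<le> 1 / u"
proof -
  define k where "k = sqrt (1 - u\<^sup>2)"
  have k: "k\<^sup>2 = 1 - u\<^sup>2" using assms by (simp add: k_def abs_square_le_1)
  have w: "(Re w)\<^sup>2 + \<bar>Im w\<bar>\<^sup>2 = 1" using unit_re_im[OF assms(3)] by simp
  have "0 \<le> (u - Re w)\<^sup>2 + (k - \<bar>Im w\<bar>)\<^sup>2" by simp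
  also have "\<dots> = 2 - 2 * (u * Re w + k * \<bar>Im w\<bar>)"
    using k w unfolding power2_diff by (simp add: algebra_simps)
  finally have "u * Re w + k * \<bar>Im w\<bar> \<le> 1" by simp
  then have "(u * Re w + k * \<bar>Im w\<bar>) / u \<le> 1 / u" using assms(1) by (intro divide_right_mono) auto
  then show ?thesis using assms(1) by (simp add: k_def add_divide_distrib)
qed

lemma drop_radius_ge:
  assumes "0 < u" "u < 1" "cmod w = 1"
  shows "u \<le> drop_radius u w"
proof (cases "u \<le> Re w")
  case True
  have "0 \<le> sqrt (1 - u\<^sup>2)" using assms by (simp add: abs_square_le_1)
  then have "0 < Re w + sqrt (1 - u\<^sup>2) / u * \<bar>Im w\<bar>"
    using True assms by (intro add_pos_nonneg) auto
  then show ?thesis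
    using drop_radius_denominator_le[OF assms] True assms by (simp add: drop_radius_def field_simps)
qed (simp add: drop_radius_def)

text \<open>In the sector \<open>u \<le> Re w\<close> the bound is the tangent: points
  \<open>x + \<i> * y\<close> of the drop satisfy \<open>u * x + k * \<bar>y\<bar> \<le> u\<close>.
  Outside it, putting weight on the tip never carries the ray beyond \<open>u\<close>, as completing
  a square shows.\<close>

lemma drop_radius_upper:
  assumes u: "0 < u" "u < 1" and w: "cmod w = 1" and p: "of_real p * w = of_real (1 - a) * b + of_real a"
    and a: "0 \<le> a" "a \<le> 1" and b: "cmod b \<le> u" and p0: "0 \<le> p"
  shows "p \<le> drop_radius u w"
proof (cases "u \<le> Re w")
  case False
  have "p \<le> u"
  proof -
    have "of_real p * w - of_real a = of_real (1 - a) * b" using p by simp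
    then have "(cmod (of_real p * w - of_real a))\<^sup>2 = ((1 - a) * cmod b)\<^sup>2"
      using a by (simp only: norm_mult norm_of_real abs_of_nonneg diff_ge_0_iff_ge)
    also have "\<dots> \<le> ((1 - a) * u)\<^sup>2" using a b by (intro power_mono mult_left_mono) auto
    also have "(cmod (of_real p * w - of_real a))\<^sup>2 = p\<^sup>2 * ((Re w)\<^sup>2 + (Im w)\<^sup>2) - 2 * a * p * Re w + a\<^sup>2"
      unfolding cmod_power2 by (simp add: algebra_simps power2_eq_square)
    also have "\<dots> = p\<^sup>2 - 2 * a * p * Re w + a\<^sup>2" using unit_re_im[OF w] by simp
    finally have 1: "p\<^sup>2 - 2 * a * p * Re w + a\<^sup>2 \<le> ((1 - a) * u)\<^sup>2" .
    have "a * p * Re w \<le> a * p * u" using False a p0 by (intro mult_left_mono) auto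
    then have "p\<^sup>2 - 2 * a * p * u + a\<^sup>2 \<le> ((1 - a) * u)\<^sup>2" using 1 by simp
    then have "(p - a * u)\<^sup>2 \<le> ((1 - a) * u)\<^sup>2 - a\<^sup>2 * (1 - u\<^sup>2)"
      by (simp add: power2_eq_square algebra_simps)
    also have "\<dots> \<le> ((1 - a) * u)\<^sup>2" using u by (simp add: abs_square_le_1)
    finally have "(p - a * u)\<^sup>2 \<le> ((1 - a) * u)\<^sup>2" .
    moreover have "0 \<le> (1 - a) * u" using a u by (intro mult_nonneg_nonneg) auto
    ultimately have "p - a * u \<le> (1 - a) * u" by (rule power2_le_imp_le)
    then show ?thesis by (simp add: algebra_simps)
  qed
  then show ?thesis using False by (simp add: drop_radius_def)
next
  case True
  define k where "k = sqrt (1 - u\<^sup>2)"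
  have k: "k\<^sup>2 = 1 - u\<^sup>2" "0 \<le> k" using u by (simp_all add: k_def abs_square_le_1)
  have pw: "p * Re w = (1 - a) * Re b + a" "p * Im w = (1 - a) * Im b"
    using arg_cong[OF p, of Re] arg_cong[OF p, of Im] by simp_all
  \<comment> \<open>Cauchy-Schwarz with \<open>u\<^sup>2 + k\<^sup>2 = 1\<close>: the disc lies
    below both tangents.\<close>
  have X: "u * Re b + k * \<bar>Im b\<bar> \<le> u"
  proof (rule power2_le_imp_le)
    have "0 \<le> (u * \<bar>Im b\<bar> - k * Re b)\<^sup>2" by simp
    then have "(u * Re b + k * \<bar>Im b\<bar>)\<^sup>2 \<le> (u\<^sup>2 + k\<^sup>2) * ((Re b)\<^sup>2 + \<bar>Im b\<bar>\<^sup>2)"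
      by (simp add: power2_eq_square algebra_simps)
    also have "\<dots> \<le> u\<^sup>2" using b u k(1) by (simp add: cmod_power2[symmetric] power_mono)
    finally show "(u * Re b + k * \<bar>Im b\<bar>)\<^sup>2 \<le> u\<^sup>2" .
  qed (use u in simp)
  have a1: "\<bar>1 - a\<bar> = 1 - a" using a by simp
  have "u * (p * Re w) + k * (p * \<bar>Im w\<bar>) = u * (p * Re w) + k * \<bar>p * Im w\<bar>"
    using p0 by (simp add: abs_mult)
  also have "\<dots> = (1 - a) * (u * Re b + k * \<bar>Im b\<bar>) + a * u"
    unfolding pw abs_mult a1 by algebra
  also have "\<dots> \<le> (1 - a) * u + a * u" using X a by (intro add_right_mono mult_left_mono) auto
  also have "\<dots> = u" by (simp add: algebra_simps)
  finally have "(u * (p * Re w) + k * (p * \<bar>Im w\<bar>)) / u \<le> u / u" using u by (intro divide_right_mono) auto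
  then have "p * (Re w + k / u * \<bar>Im w\<bar>) \<le> 1" using u by (simp add: add_divide_distrib distrib_left mult_ac)
  moreover have "0 < Re w + k / u * \<bar>Im w\<bar>" using True u k(2) by (intro add_pos_nonneg) auto
  ultimately show ?thesis using True by (simp add: drop_radius_def k_def[symmetric] pos_le_divide_eq)
qed

lemma drop_radius_attained:
  assumes u: "0 < u" "u < 1" and w: "cmod w = 1"
  obtains a b where "of_real (drop_radius u w) * w = of_real (1 - a) * b + of_real a"
    "0 \<le> a" "a \<le> 1" "cmod b \<le> u"
proof (cases "u \<le> Re w")
  case False
  then show ?thesis using that[of 0 "of_real u * w"] w u by (simp add: drop_radius_def norm_mult)
next
  case True
  define k where "k = sqrt (1 - u\<^sup>2)"
  have "u\<^sup>2 < 1" using u power_strict_mono[of u 1 2] by simp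
  then have k: "k\<^sup>2 = 1 - u\<^sup>2" "0 < k" by (simp_all add: k_def)
  define q where "q = u * Re w + k * \<bar>Im w\<bar>"
  have q: "0 < q" unfolding q_def using True u k by (intro add_pos_nonneg) auto
  have rad: "drop_radius u w = u / q"
    using True u q by (simp add: drop_radius_def k_def[symmetric] q_def field_simps)
  \<comment> \<open>The ray leaves the drop on the segment from the point of tangency to 1.
    Comparing imaginary parts gives this weight of the point of tangency, the \<open>b\<close>
    defined below.\<close>
  define \<tau> where "\<tau> = \<bar>Im w\<bar> / (k * q)"
  have \<tau>0: "0 \<le> \<tau>" using k q by (simp add: \<tau>_def)
  have "\<bar>Im w\<bar> \<le> k"
  proof (rule power2_le_imp_le)
    have "u\<^sup>2 \<le> (Re w)\<^sup>2" using True u by (intro power_mono) auto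
    then show "\<bar>Im w\<bar>\<^sup>2 \<le> k\<^sup>2" using unit_re_im[OF w] k by simp
  qed (use k in simp)
  then have "\<bar>Im w\<bar> * (1 - k\<^sup>2) \<le> k * (u * Re w)"
    using True u k mult_mono[of "\<bar>Im w\<bar>" k "u * u" "u * Re w"] by (simp add: power2_eq_square)
  then have "\<bar>Im w\<bar> \<le> k * q" by (simp add: q_def algebra_simps power2_eq_square)
  then have \<tau>1: "\<tau> \<le> 1" using k q by (simp add: \<tau>_def)
  define b where "b = Complex (u * u) (u * k * sgn (Im w))"
  have "of_real (u / q) * w = of_real (1 - (1 - \<tau>)) * b + of_real (1 - \<tau>)"
  proof (rule complex_eqI)
    have "(1 - \<tau>) + \<tau> * (u * u) = 1 - \<tau> * k\<^sup>2"
      unfolding k(1) by (simp add: algebra_simps power2_eq_square)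
    also have "\<dots> = 1 - k * \<bar>Im w\<bar> / q" using k q by (simp add: \<tau>_def field_simps power2_eq_square)
    also have "\<dots> = u * Re w / q" using q by (simp add: q_def field_simps)
    finally show "Re (of_real (u / q) * w) = Re (of_real (1 - (1 - \<tau>)) * b + of_real (1 - \<tau>))"
      by (simp add: b_def)
    have "Im w = \<bar>Im w\<bar> * sgn (Im w)" by (simp add: abs_mult_sgn)
    then show "Im (of_real (u / q) * w) = Im (of_real (1 - (1 - \<tau>)) * b + of_real (1 - \<tau>))"
      using k q by (simp add: b_def \<tau>_def field_simps)
  qed
  moreover have "cmod b \<le> u"
  proof (rule power2_le_imp_le)
    have "(sgn (Im w))\<^sup>2 \<le> 1" by (simp add: sgn_if)
    then have "(u * k)\<^sup>2 * (sgn (Im w))\<^sup>2 \<le> (u * k)\<^sup>2" by (simp add: mult_left_le)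
    then have "(cmod b)\<^sup>2 \<le> (u * u)\<^sup>2 + (u * k)\<^sup>2"
      unfolding cmod_power2 by (simp add: b_def power_mult_distrib)
    also have "\<dots> = u\<^sup>2 * (u\<^sup>2 + k\<^sup>2)" by (simp add: power2_eq_square algebra_simps)
    finally show "(cmod b)\<^sup>2 \<le> u\<^sup>2" by (simp add: k(1))
  qed (use u in simp)
  ultimately show ?thesis using that[of "1 - \<tau>" b] \<tau>0 \<tau>1 rad by simp
qed

section \<open>The domain as a union of drops\<close>

locale E_geometry =
  fixes \<xi> :: "nat \<Rightarrow> complex" and N :: nat and r :: real
  assumes N: "N \<ge> 1" and unit: "j \<in> {1..N} \<Longrightarrow> cmod (\<xi> j) = 1"
    and r: "0 < r" "r < 1" and large: "E_large_enough \<xi> N r"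
begin

abbreviation E :: "real \<Rightarrow> complex set"
  where "E \<equiv> E_dom \<xi> N"

lemma cnj_unit [simp]: "j \<in> {1..N} \<Longrightarrow> cnj (\<xi> j) * \<xi> j = 1" "j \<in> {1..N} \<Longrightarrow> \<xi> j * cnj (\<xi> j) = 1"
  using unit by (simp_all add: complex_norm_square[symmetric] mult.commute)

text \<open>The normal form on which the geometry below rests: a point lies in the drop of one \<xi>
  j, with weight \<open>a\<close> at the tip.\<close>

lemma hullE:
  assumes u: "r \<le> u" and z: "z \<in> convex hull (\<xi> ` {1..N} \<union> ball 0 u)"
  obtains j a b where "j \<in> {1..N}" "0 \<le> a" "a \<le> 1" "cmod b < u" "z = of_real (1 - a) * b + of_real a * \<xi> j"
proof -
  have "z \<in> (\<Union>x\<in>\<xi> ` {1..N}. convex hull (insert x (ball 0 u)))"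
    using z
  proof (rule subsetD[OF convex_hull_Un_star, rotated -1])
    fix a b assume ab: "a \<in> \<xi> ` {1..N}" "b \<in> \<xi> ` {1..N}" "a \<noteq> b"
    then have "closed_segment a b \<inter> ball 0 r \<noteq> {}"
      using large by (auto simp: E_large_enough_def)
    then show "closed_segment a b \<inter> ball 0 u \<noteq> {}" using u by auto
  qed (use N r u in auto)
  then obtain j where j: "j \<in> {1..N}" "z \<in> convex hull (insert (\<xi> j) (ball 0 u))" by blast
  have "ball 0 u \<noteq> ({}::complex set)" using r u by auto
  then obtain a a' b where "0 \<le> a" "0 \<le> a'" "a + a' = 1" "b \<in> ball 0 u" "z = a *\<^sub>R \<xi> j + a' *\<^sub>R b"
    using j(2) by (auto simp: convex_hull_insert hull_same)
  moreover from this have "a' = 1 - a" by simp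
  ultimately show ?thesis using that[of j a b] j by (simp add: scaleR_conv_of_real add.commute)
qed

lemma E_dom_hull: "z \<in> E u \<Longrightarrow> z \<in> convex hull (\<xi> ` {1..N} \<union> ball 0 u)"
  unfolding E_dom_def using interior_subset by blast

text \<open>A perturbation of the point can be absorbed by \<open>b\<close>, magnified by
  \<open>1 / (1 - a)\<close>. Hence a ball of radius \<open>(1 - a) * (u - cmod b)\<close> fits into
  the hull.\<close>

lemma E_domI:
  assumes "j \<in> {1..N}" "0 \<le> a" "a < 1" "cmod b < u"
  shows "of_real (1 - a) * b + of_real a * \<xi> j \<in> E u"
  unfolding E_dom_def
proof (rule interiorI[OF open_ball centre_in_ball[THEN iffD2]])
  define z where "z = of_real (1 - a) * b + of_real a * \<xi> j"
  show "0 < (1 - a) * (u - cmod b)" using assms by simp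
  show "ball (of_real (1 - a) * b + of_real a * \<xi> j) ((1 - a) * (u - cmod b)) \<subseteq> convex hull (\<xi> ` {1..N} \<union> ball 0 u)"
  proof
    fix y assume "y \<in> ball (of_real (1 - a) * b + of_real a * \<xi> j) ((1 - a) * (u - cmod b))"
    then have y: "cmod (y - z) < (1 - a) * (u - cmod b)" by (simp add: z_def dist_norm norm_minus_commute)
    define b' where "b' = b + (y - z) / of_real (1 - a)"
    have "cmod b' \<le> cmod b + cmod (y - z) / (1 - a)"
      unfolding b'_def using assms by (intro order_trans[OF norm_triangle_ineq]) (simp add: norm_divide del: of_real_diff)
    also have "\<dots> < u" using y assms by (simp add: field_simps)
    finally have b': "cmod b' < u" .
    have "y = (1 - a) *\<^sub>R b' + a *\<^sub>R \<xi> j"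
      using assms by (simp add: b'_def z_def scaleR_conv_of_real field_simps)
    also have "\<dots> \<in> convex hull (\<xi> ` {1..N} \<union> ball 0 u)"
      using assms b' by (intro convexD[OF convex_convex_hull]) (auto simp: hull_inc)
    finally show "y \<in> convex hull (\<xi> ` {1..N} \<union> ball 0 u)" .
  qed
qed

text \<open>Contraction lowers the weight of the tip to \<open>c * a\<close>. What remains, divided
  by \<open>1 - c * a\<close>, has modulus strictly below \<open>u\<close>, even if
  \<open>a = 1\<close> or \<open>cmod b = u\<close>.\<close>

lemma E_dom_dilate:
  assumes "j \<in> {1..N}" "0 \<le> a" "a \<le> 1" "cmod b \<le> u" "0 \<le> c" "c < 1" "0 < u"
  shows "of_real c * (of_real (1 - a) * b + of_real a * \<xi> j) \<in> E u"
proof -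
  have "c * a \<le> c" using assms by (simp add: mult_left_le)
  then have ca: "0 \<le> c * a" "c * a < 1" using assms by auto
  define b' where "b' = of_real (c * (1 - a)) * b / of_real (1 - c * a)"
  have "cmod b' = c * (1 - a) * cmod b / (1 - c * a)"
    using assms ca by (simp add: b'_def norm_mult norm_divide del: of_real_mult of_real_diff)
  also have "\<dots> \<le> c * (1 - a) * u / (1 - c * a)"
    using assms ca by (intro divide_right_mono mult_left_mono) auto
  also have "\<dots> < u" using assms ca by (simp add: field_simps)
  finally have "of_real (1 - c * a) * b' + of_real (c * a) * \<xi> j \<in> E u"
    using E_domI assms(1) ca by blast
  moreover have "of_real (1 - c * a) * b' = of_real (c * (1 - a)) * b"
    using ca by (simp add: b'_def del: of_real_mult of_real_diff)
  ultimately have "of_real (c * (1 - a)) * b + of_real (c * a) * \<xi> j \<in> E u"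
    by (simp only:)
  then show ?thesis by (simp add: algebra_simps)
qed

text \<open>The drops over the closed disc are compact, and so is their finite union, which
  therefore contains the closure.\<close>

lemma closure_E_domE:
  assumes u: "r \<le> u" and z: "z \<in> closure (E u)"
  obtains j a b where "j \<in> {1..N}" "0 \<le> a" "a \<le> 1" "cmod b \<le> u" "z = of_real (1 - a) * b + of_real a * \<xi> j"
proof -
  define K where "K = (\<Union>j\<in>{1..N}. (\<lambda>(a, b). of_real (1 - a) * b + of_real a * \<xi> j) ` ({0..1} \<times> cball 0 u))"
  have "compact K"
    unfolding K_def case_prod_unfold
    by (intro compact_UN compact_continuous_image compact_Times continuous_intros) auto
  moreover have "E u \<subseteq> K"
  proof
    fix z assume "z \<in> E u"
    from hullE[OF u E_dom_hull[OF this]] obtain j a b where "j \<in> {1..N}" "0 \<le> a" "a \<le> 1" "cmod b < u"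
      "z = of_real (1 - a) * b + of_real a * \<xi> j" .
    then show "z \<in> K" by (force simp: K_def)
  qed
  ultimately have "z \<in> K" using z closure_minimal compact_imp_closed by blast
  then show ?thesis using that by (auto simp: K_def)
qed

text \<open>Only the tips, with \<open>a = 1\<close>, fail to be interior to the larger domain.
  Hence the boundary of the larger domain can meet the spectrum only in the points \<xi> j.\<close>

lemma closure_E_dom_subset:
  assumes "r \<le> v" "v < u"
  shows "closure (E v) \<subseteq> E u \<union> \<xi> ` {1..N}"
proof
  fix z assume "z \<in> closure (E v)"
  from closure_E_domE[OF assms(1) this] obtain j a b
    where *: "j \<in> {1..N}" "0 \<le> a" "a \<le> 1" "cmod b \<le> v" "z = of_real (1 - a) * b + of_real a * \<xi> j" .
  then show "z \<in> E u \<union> \<xi> ` {1..N}"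
    using E_domI[of j a b u] assms by (cases "a = 1") auto
qed

lemma E_dom_subset_ball:
  assumes "r \<le> u" "u < 1"
  shows "E u \<subseteq> ball 0 1"
proof -
  have "E u \<subseteq> cball 0 1"
  proof
    fix z assume "z \<in> E u"
    from hullE[OF assms(1) E_dom_hull[OF this]] obtain j a b where *: "j \<in> {1..N}" "0 \<le> a" "a \<le> 1" "cmod b < u"
      "z = of_real (1 - a) * b + of_real a * \<xi> j" .
    have "cmod z \<le> (1 - a) * cmod b + a"
      unfolding *(5) using * unit[OF *(1)]
      by (intro order_trans[OF norm_triangle_ineq]) (simp add: norm_mult del: of_real_diff)
    also have "\<dots> \<le> (1 - a) * 1 + a" using * assms by (intro add_right_mono mult_left_mono) auto
    finally show "z \<in> cball 0 1" by simp
  qed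
  then show ?thesis
    unfolding E_dom_def using interior_mono[of "interior _" "cball 0 (1::real)"] by (metis interior_cball interior_interior)
qed

lemma open_E_dom: "open (E u)"
  by (simp add: E_dom_def)

text \<open>In the normal form both sides are comparable to \<open>1 - a\<close>: the distance to
  \<xi> j is at most \<open>(1 - a) * 2\<close>, and \<open>1 - cmod z\<close> is at least
  \<open>(1 - a) * (1 - s)\<close>.\<close>

lemma stolz_bound:
  assumes s: "r \<le> s" "s < 1" and z: "z \<in> E s"
  obtains j where "j \<in> {1..N}" "cmod (\<xi> j - z) \<le> 2 / (1 - s) * (1 - cmod z)"
proof -
  from hullE[OF s(1) E_dom_hull[OF z]] obtain j a b where *: "j \<in> {1..N}" "0 \<le> a" "a \<le> 1" "cmod b < s"
      "z = of_real (1 - a) * b + of_real a * \<xi> j" .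
  have "cmod z \<le> (1 - a) * cmod b + a"
    unfolding *(5) using * unit[OF *(1)]
    by (intro order_trans[OF norm_triangle_ineq]) (simp add: norm_mult del: of_real_diff)
  also have "\<dots> \<le> (1 - a) * s + a" using * by (intro add_right_mono mult_left_mono) auto
  finally have 1: "(1 - a) * (1 - s) \<le> 1 - cmod z" by (simp add: algebra_simps)
  have "\<xi> j - z = of_real (1 - a) * (\<xi> j - b)" by (simp add: *(5) algebra_simps)
  then have "cmod (\<xi> j - z) = (1 - a) * cmod (\<xi> j - b)" using * by (simp add: norm_mult del: of_real_diff)
  also have "\<dots> \<le> (1 - a) * 2"
    using norm_triangle_ineq4[of "\<xi> j" b] * unit[OF *(1)] s by (intro mult_left_mono) auto
  also have "\<dots> \<le> 2 / (1 - s) * (1 - cmod z)" using 1 s by (simp add: field_simps)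
  finally show ?thesis using that *(1) by blast
qed

end

subsection \<open>The boundary path\<close>

text \<open>A line meets the circle at most twice, so the path will have finitely many corners. The
  parameter 1 is set apart because it gives the same point as 0.\<close>

lemma finite_circle_meets_line:
  assumes c: "cmod c = 1"
  shows "finite {t \<in> {0..1}. Re (cis (2 * pi * t) * c) = u}" (is "finite ?A")
proof -
  define F where "F = {Complex u (sqrt (1 - u\<^sup>2)), Complex u (- sqrt (1 - u\<^sup>2))}"
  have inj: "inj_on (\<lambda>t. cis (2 * pi * t) * c) {0..<1}"
  proof (rule inj_onI)
    fix x y :: real assume xy: "x \<in> {0..<1}" "y \<in> {0..<1}" "cis (2 * pi * x) * c = cis (2 * pi * y) * c"
    then have "exp (\<i> * of_real (2 * pi * x)) = exp (\<i> * of_real (2 * pi * y))"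
      using c by (auto simp: cis_conv_exp)
    moreover have "\<bar>Im (\<i> * of_real (2 * pi * x)) - Im (\<i> * of_real (2 * pi * y))\<bar> < 2 * pi"
      using xy by (simp flip: right_diff_distrib add: abs_mult abs_less_iff)
    ultimately have "\<i> * of_real (2 * pi * x) = \<i> * of_real (2 * pi * y)"
      by (rule exp_complex_eqI[rotated])
    then show "x = y" by simp
  qed
  have sub: "?A \<subseteq> insert 1 ((\<lambda>t. cis (2 * pi * t) * c) -` F \<inter> {0..<1})"
  proof
    fix t assume t: "t \<in> ?A"
    define w where "w = cis (2 * pi * t) * c"
    have "(Im w)\<^sup>2 = 1 - u\<^sup>2"
      using unit_re_im[of w] t c unfolding w_def by (auto simp: norm_mult simp del: times_complex.sel)
    then have "\<bar>Im w\<bar> = sqrt (1 - u\<^sup>2)" by (metis real_sqrt_abs)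
    then have "Im w = sqrt (1 - u\<^sup>2) \<or> Im w = - sqrt (1 - u\<^sup>2)" by linarith
    moreover have "Re w = u" using t by (simp add: w_def)
    ultimately have "w \<in> F" unfolding F_def complex_eq_iff insert_iff by simp
    then show "t \<in> insert 1 ((\<lambda>t. cis (2 * pi * t) * c) -` F \<inter> {0..<1})" using t by (auto simp: w_def)
  qed
  have "finite F" by (simp add: F_def)
  from finite_vimage_IntI[OF this inj]
  have "finite (insert 1 ((\<lambda>t. cis (2 * pi * t) * c) -` F \<inter> {0..<1}))" by (rule finite.insertI)
  then show ?thesis by (rule finite_subset[OF sub])
qed

lemma continuous_on_Max_image:
  fixes f :: "'i \<Rightarrow> 'a::topological_space \<Rightarrow> real"
  assumes "finite I" "I \<noteq> {}" "\<And>i. i \<in> I \<Longrightarrow> continuous_on S (f i)"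
  shows "continuous_on S (\<lambda>x. Max ((\<lambda>i. f i x) ` I))"
  using assms by (induction I rule: finite_ne_induct) (auto intro!: continuous_on_max)

lemma continuous_on_drop_radius:
  assumes u: "0 < u" "u < 1"
  shows "continuous_on (sphere 0 1) (drop_radius u)"
proof -
  have pos: "0 \<le> sqrt (1 - u\<^sup>2)" using u by (simp add: abs_square_le_1)
  have "continuous_on (sphere 0 1) (\<lambda>w. if - Re w \<le> - u then 1 / (Re w + sqrt (1 - u\<^sup>2) / u * \<bar>Im w\<bar>) else u)"
  proof (rule continuous_on_cases_le)
    show "continuous_on {w \<in> sphere 0 1. - Re w \<le> - u} (\<lambda>w. 1 / (Re w + sqrt (1 - u\<^sup>2) / u * \<bar>Im w\<bar>))"
    proof (intro continuous_intros ballI)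
      fix w :: complex assume "w \<in> {w \<in> sphere 0 1. - Re w \<le> - u}"
      then have "0 < Re w + sqrt (1 - u\<^sup>2) / u * \<bar>Im w\<bar>" using u pos by (intro add_pos_nonneg) auto
      then show "Re w + sqrt (1 - u\<^sup>2) / u * \<bar>Im w\<bar> \<noteq> 0" by simp
    qed
    \<comment> \<open>At the points of tangency the two branches agree, because
      \<open>u + (1 - u\<^sup>2) / u = 1 / u\<close>.\<close>
    fix w :: complex assume w: "w \<in> sphere 0 1" "- Re w = - u"
    then have "(Im w)\<^sup>2 = 1 - u\<^sup>2" using unit_re_im[of w] by simp
    then have "\<bar>Im w\<bar> = sqrt (1 - u\<^sup>2)" by (metis real_sqrt_abs)
    moreover have "(sqrt (1 - u\<^sup>2))\<^sup>2 = 1 - u\<^sup>2" using u by (simp add: abs_square_le_1)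
    ultimately have "Re w + sqrt (1 - u\<^sup>2) / u * \<bar>Im w\<bar> = 1 / u"
      using w u by (simp add: field_simps power2_eq_square)
    then show "1 / (Re w + sqrt (1 - u\<^sup>2) / u * \<bar>Im w\<bar>) = u" using u by simp
  qed (auto intro!: continuous_intros)
  then show ?thesis by (simp add: drop_radius_def[abs_def])
qed

lemma cis_vector_derivative:
  "((\<lambda>t. cis (2 * pi * t)) has_vector_derivative 2 * of_real pi * \<i> * cis (2 * pi * t)) (at t)"
proof -
  have "((\<lambda>t. \<i> * of_real (2 * pi * t)) has_vector_derivative \<i> * of_real (2 * pi)) (at t)"
    by (intro has_vector_derivative_mult_right has_vector_derivative_of_real) (auto intro!: derivative_eq_intros)
  from field_vector_diff_chain_at[OF this DERIV_exp]
  show ?thesis by (simp add: cis_conv_exp o_def mult_ac)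
qed

text \<open>The curve is the line \<open>Re (z * \<omega>) = 1\<close> in polar coordinates.
  Differentiating the numerator contributes at most \<open>2 * pi / u\<close>, the denominator at
  most \<open>2 * pi / u ^ 3\<close>, and \<open>u \<le> 1\<close> merges the two.\<close>

lemma line_in_polar_coordinates_vector_derivative:
  assumes pos: "0 < u" and re: "u \<le> Re (cis (2 * pi * t) * \<omega>)" and om: "cmod \<omega> \<le> 1 / u" and u1: "u \<le> 1"
  obtains D where "((\<lambda>t. cis (2 * pi * t) / of_real (Re (cis (2 * pi * t) * \<omega>))) has_vector_derivative D) (at t)"
    "cmod D \<le> 4 * pi / u ^ 3"
proof -
  define f where "f = (\<lambda>t. cis (2 * pi * t))"
  define f' where "f' = 2 * of_real pi * \<i> * f t"
  define q where "q = (\<lambda>x. Re (f x * \<omega>))"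
  have f: "(f has_vector_derivative f') (at t)"
    unfolding f_def f'_def by (rule cis_vector_derivative)
  have q: "(q has_field_derivative Re (f' * \<omega>)) (at t)"
    unfolding q_def has_real_derivative_iff_has_vector_derivative
    by (rule bounded_linear.has_vector_derivative[OF bounded_linear_Re has_vector_derivative_mult_left[OF f]])
  have qt: "u \<le> q t" using re by (simp add: q_def f_def)
  have "((\<lambda>x. inverse (q x) *\<^sub>R f x) has_vector_derivative
      inverse (q t) *\<^sub>R f' + - (inverse (q t) * Re (f' * \<omega>) * inverse (q t)) *\<^sub>R f t) (at t)"
    using qt pos by (intro has_vector_derivative_scaleR DERIV_inverse' f q) auto
  moreover have "inverse (q x) *\<^sub>R f x = cis (2 * pi * x) / of_real (Re (cis (2 * pi * x) * \<omega>))" for x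
    by (simp add: q_def f_def scaleR_conv_of_real divide_inverse mult_ac)
  moreover have "cmod (inverse (q t) *\<^sub>R f' + - (inverse (q t) * Re (f' * \<omega>) * inverse (q t)) *\<^sub>R f t) \<le> 4 * pi / u ^ 3"
  proof -
    have iq: "0 \<le> inverse (q t)" "inverse (q t) \<le> 1 / u"
      using qt pos by (auto simp: divide_inverse intro: le_imp_inverse_le)
    have f': "cmod f' = 2 * pi" by (simp add: f'_def f_def norm_mult)
    have "\<bar>Re (f' * \<omega>)\<bar> \<le> 2 * pi * (1 / u)"
      using mult_left_mono[OF om, of "2 * pi"] f' by (intro order_trans[OF abs_Re_le_cmod]) (simp add: norm_mult)
    then have "inverse (q t) * \<bar>Re (f' * \<omega>)\<bar> * inverse (q t) \<le> (1 / u) * (2 * pi * (1 / u)) * (1 / u)"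
      using iq pos by (intro mult_mono) auto
    moreover have "inverse (q t) * (2 * pi) \<le> (1 / u) * (2 * pi)" using iq by (intro mult_right_mono) auto
    moreover have "1 / u \<le> 1 / u ^ 3"
      using pos u1 by (intro divide_left_mono) (auto simp: power3_eq_cube mult_le_one intro: mult_left_le)
    then have "(1 / u) * (2 * pi) \<le> (1 / u ^ 3) * (2 * pi)" by (intro mult_right_mono) auto
    moreover have "cmod (inverse (q t) *\<^sub>R f' + - (inverse (q t) * Re (f' * \<omega>) * inverse (q t)) *\<^sub>R f t)
      \<le> inverse (q t) * (2 * pi) + inverse (q t) * \<bar>Re (f' * \<omega>)\<bar> * inverse (q t)"
      using iq(1) f' by (intro order_trans[OF norm_triangle_ineq]) (simp add: f_def abs_mult)
    ultimately show ?thesis by (simp add: power3_eq_cube)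
  qed
  ultimately show ?thesis using that by auto
qed

section \<open>Radial function of the domain, smoothness and winding of its boundary path\<close>

context E_geometry
begin

text \<open>The drop at \<xi> j is the one at 1 rotated, and the radial function of a union of drops
  is the largest of theirs.\<close>

definition polar_radius :: "real \<Rightarrow> complex \<Rightarrow> real"
  where "polar_radius u v = Max ((\<lambda>j. drop_radius u (v * cnj (\<xi> j))) ` {1..N})"

lemma nonempty: "finite {1..N}" "{1..N} \<noteq> {}"
  using N by auto

lemma polar_radius_ge: "j \<in> {1..N} \<Longrightarrow> drop_radius u (v * cnj (\<xi> j)) \<le> polar_radius u v"
  unfolding polar_radius_def by (rule Max_ge) auto

lemma polar_radius_attained: obtains j where "j \<in> {1..N}" "polar_radius u v = drop_radius u (v * cnj (\<xi> j))"
proof -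
  have "polar_radius u v \<in> (\<lambda>j. drop_radius u (v * cnj (\<xi> j))) ` {1..N}"
    unfolding polar_radius_def by (rule Max_in) (use nonempty in auto)
  then show ?thesis using that by blast
qed

context
  fixes u :: real
  assumes u: "r \<le> u" "u < 1"
begin

lemma u_pos: "0 < u" using u r by simp

lemma polar_radius_pos: "cmod v = 1 \<Longrightarrow> u \<le> polar_radius u v"
  using polar_radius_attained[of u v] drop_radius_ge[OF u_pos u(2)] unit by (metis norm_mult complex_mod_cnj mult_1)

lemma ray_in_E_dom_le:
  assumes v: "cmod v = 1" and p: "0 \<le> p" "of_real p * v \<in> E u"
  shows "p \<le> polar_radius u v"
proof -
  from hullE[OF u(1) E_dom_hull[OF p(2)]] obtain j a b where *: "j \<in> {1..N}" "0 \<le> a" "a \<le> 1" "cmod b < u"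
      "of_real p * v = of_real (1 - a) * b + of_real a * \<xi> j" .
  have "of_real p * (v * cnj (\<xi> j)) = (of_real (1 - a) * b + of_real a * \<xi> j) * cnj (\<xi> j)"
    using *(5) by (metis mult.assoc)
  also have "\<dots> = of_real (1 - a) * (b * cnj (\<xi> j)) + of_real a"
    using *(1) by (simp add: distrib_right mult.assoc)
  finally have "p \<le> drop_radius u (v * cnj (\<xi> j))"
    using * unit[OF *(1)] v p u_pos u by (intro drop_radius_upper) (auto simp: norm_mult)
  then show ?thesis using polar_radius_ge[OF *(1)] by (rule order_trans)
qed

text \<open>The end point of the ray lies in a closed drop, and each shorter multiple is a proper
  contraction of it.\<close>

lemma ray_in_E_dom:
  assumes v: "cmod v = 1" and p: "0 \<le> p" "p < polar_radius u v"
  shows "of_real p * v \<in> E u"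
proof -
  define \<rho> where "\<rho> = polar_radius u v"
  have \<rho>: "0 < \<rho>" using p by (simp add: \<rho>_def)
  obtain j where j: "j \<in> {1..N}" "\<rho> = drop_radius u (v * cnj (\<xi> j))"
    using polar_radius_attained unfolding \<rho>_def .
  obtain a b where ab: "of_real \<rho> * (v * cnj (\<xi> j)) = of_real (1 - a) * b + of_real a" "0 \<le> a" "a \<le> 1" "cmod b \<le> u"
    unfolding j(2) by (rule drop_radius_attained[OF u_pos u(2), of "v * cnj (\<xi> j)"])
      (use v unit[OF j(1)] in \<open>auto simp: norm_mult\<close>)
  have "of_real \<rho> * v = of_real \<rho> * (v * cnj (\<xi> j)) * \<xi> j" using j(1) by (simp add: mult.assoc)
  also have "\<dots> = of_real (1 - a) * (b * \<xi> j) + of_real a * \<xi> j"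
    unfolding ab(1) by (simp add: algebra_simps)
  finally have "of_real (p / \<rho>) * (of_real \<rho> * v) \<in> E u"
    using E_dom_dilate[OF j(1) ab(2,3), of "b * \<xi> j" u "p / \<rho>"] ab(4) unit[OF j(1)] p \<rho> u_pos
    by (simp add: norm_mult \<rho>_def)
  then show ?thesis using \<rho> by simp
qed

lemma boundary_path_eq:
  "boundary_path (E u) t = of_real (polar_radius u (cis (2 * pi * t))) * cis (2 * pi * t)"
proof -
  define v where "v = cis (2 * pi * t)"
  have v: "cmod v = 1" by (simp add: v_def)
  have pos: "0 < polar_radius u v" using polar_radius_pos[OF v] u_pos by simp
  have "Sup {\<rho>. \<rho> \<ge> 0 \<and> of_real \<rho> * v \<in> E u} = polar_radius u v"
  proof (rule cSup_eq_non_empty)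
    show "{\<rho>. \<rho> \<ge> 0 \<and> of_real \<rho> * v \<in> E u} \<noteq> {}"
      using ray_in_E_dom[OF v, of 0] pos by auto
    fix y assume y: "\<And>x. x \<in> {\<rho>. \<rho> \<ge> 0 \<and> of_real \<rho> * v \<in> E u} \<Longrightarrow> x \<le> y"
    show "polar_radius u v \<le> y"
    proof (rule dense_le_bounded[OF pos])
      fix w assume "0 < w" "w < polar_radius u v"
      then show "w \<le> y" using y ray_in_E_dom[OF v, of w] by auto
    qed
  qed (use ray_in_E_dom_le[OF v] in auto)
  then show ?thesis by (simp add: boundary_path_def v_def)
qed

text \<open>If such a point lay in the open domain, the ray could be prolonged inside the domain
  beyond \<open>polar_radius\<close>.\<close>

lemma boundary_path_dilate_notin_E_dom:
  assumes "1 \<le> l"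
  shows "of_real l * boundary_path (E u) t \<notin> E u"
proof
  define v where "v = cis (2 * pi * t)"
  define p where "p = l * polar_radius u v"
  have v: "cmod v = 1" by (simp add: v_def)
  have pos: "0 < polar_radius u v" using polar_radius_pos[OF v] u_pos by simp
  assume "of_real l * boundary_path (E u) t \<in> E u"
  then have "of_real p * v \<in> E u" by (simp add: boundary_path_eq p_def v_def mult.assoc)
  then obtain e where e: "e > 0" "ball (of_real p * v) e \<subseteq> E u"
    using open_E_dom open_contains_ball by metis
  have "dist (of_real p * v) (of_real (p + e / 2) * v) < e"
    using e v by (simp add: dist_norm norm_mult algebra_simps flip: left_diff_distrib)
  then have "p + e / 2 \<le> polar_radius u v"
    using e assms pos by (intro ray_in_E_dom_le[OF v]) (auto simp: p_def)
  moreover have "polar_radius u v \<le> p" using assms pos by (simp add: p_def)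
  ultimately show False using e by simp
qed

lemma boundary_path_dilate_notin_closure:
  assumes "r \<le> s" "s < u" "1 < l"
  shows "of_real l * boundary_path (E u) t \<notin> closure (E s)"
proof
  define z where "z = boundary_path (E u) t"
  assume "of_real l * boundary_path (E u) t \<in> closure (E s)"
  then have "of_real l * z \<in> \<xi> ` {1..N}"
    using closure_E_dom_subset[OF assms(1,2)] boundary_path_dilate_notin_E_dom[of l t] assms by (auto simp: z_def)
  then obtain j where j: "j \<in> {1..N}" "of_real l * z = \<xi> j" by auto
  \<comment> \<open>The boundary point would be a tip contracted by \<open>1 / l\<close>, hence an
    interior point.\<close>
  then have "z = of_real (1 / l) * (of_real (1 - 1) * 0 + of_real 1 * \<xi> j)"
    using assms by (simp add: field_simps)
  also have "\<dots> \<in> E u"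
    using assms u_pos by (intro E_dom_dilate j) auto
  finally show False using boundary_path_dilate_notin_E_dom[of 1 t] by (simp add: z_def)
qed

lemma norm_boundary_path_le: "cmod (boundary_path (E u) t) \<le> 1"
proof -
  define v where "v = cis (2 * pi * t)"
  have v: "cmod v = 1" by (simp add: v_def)
  have pos: "0 < polar_radius u v" using polar_radius_pos[OF v] u_pos by simp
  have "polar_radius u v \<le> 1"
  proof (rule dense_le_bounded[OF pos])
    fix w assume "0 < w" "w < polar_radius u v"
    then have "of_real w * v \<in> ball 0 1" using ray_in_E_dom[OF v, of w] E_dom_subset_ball[OF u] by auto
    then show "w \<le> 1" using v \<open>0 < w\<close> by (simp add: norm_mult)
  qed
  then show ?thesis using pos by (simp add: boundary_path_eq v_def norm_mult)
qed

lemma boundary_path_nonzero: "boundary_path (E u) t \<noteq> 0"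
  using polar_radius_pos[of "cis (2 * pi * t)"] u_pos by (auto simp: boundary_path_eq)

lemma continuous_on_polar_radius: "continuous_on {0..1} (\<lambda>t. polar_radius u (cis (2 * pi * t)))"
  unfolding polar_radius_def
proof (rule continuous_on_Max_image[OF nonempty])
  fix j assume "j \<in> {1..N}"
  then show "continuous_on {0..1} (\<lambda>t. drop_radius u (cis (2 * pi * t) * cnj (\<xi> j)))"
    using unit by (intro continuous_on_compose2[OF continuous_on_drop_radius[OF u_pos u(2)]])
      (auto intro!: continuous_intros simp: norm_mult)
qed

lemma continuous_on_boundary_path: "continuous_on {0..1} (boundary_path (E u))"
  unfolding boundary_path_eq[abs_def] by (intro continuous_intros continuous_on_polar_radius)

text \<open>By the assumption on the segments, the drops protruding from the disc do not overlap.\<close>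

lemma drop_sectors_disjoint:
  assumes ij: "i \<in> {1..N}" "j \<in> {1..N}" "i \<noteq> j" and v: "cmod v = 1"
    and "u \<le> Re (v * cnj (\<xi> i))"
  shows "Re (v * cnj (\<xi> j)) < u"
proof (rule ccontr)
  assume "\<not> Re (v * cnj (\<xi> j)) < u"
  moreover obtain t where t: "0 \<le> t" "t \<le> 1" "(1 - t) *\<^sub>R \<xi> i + t *\<^sub>R \<xi> j \<in> ball 0 r"
    using large ij unfolding E_large_enough_def closed_segment_def by fast
  ultimately have "(1 - t) * u + t * u \<le> (1 - t) * Re (v * cnj (\<xi> i)) + t * Re (v * cnj (\<xi> j))"
    using assms by (intro add_mono mult_left_mono) auto
  also have "\<dots> = Re (v * cnj ((1 - t) *\<^sub>R \<xi> i + t *\<^sub>R \<xi> j))" by (simp add: algebra_simps)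
  also have "\<dots> \<le> cmod (v * cnj ((1 - t) *\<^sub>R \<xi> i + t *\<^sub>R \<xi> j))" by (rule complex_Re_le_cmod)
  also have "\<dots> = cmod ((1 - t) *\<^sub>R \<xi> i + t *\<^sub>R \<xi> j)" unfolding norm_mult v complex_mod_cnj by simp
  also have "\<dots> < r" using t by simp
  finally show False using u by (simp add: algebra_simps)
qed

text \<open>Besides the end points: the junctions of arcs and tangents, and, since
  \<open>Re (\<i> * w) = - Im w\<close>, the directions of the \<xi> j, where the tips are, and
  their opposites.\<close>

definition corner_times :: "real set"
  where "corner_times = {0, 1} \<union> (\<Union>j\<in>{1..N}. {t \<in> {0..1}. Re (cis (2 * pi * t) * cnj (\<xi> j)) = u} \<union>
     {t \<in> {0..1}. Re (cis (2 * pi * t) * (\<i> * cnj (\<xi> j))) = 0})"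

lemma finite_corner_times: "finite corner_times"
proof -
  have fin: "finite ({t \<in> {0..1}. Re (cis (2 * pi * t) * cnj (\<xi> j)) = u} \<union>
      {t \<in> {0..1}. Re (cis (2 * pi * t) * (\<i> * cnj (\<xi> j))) = 0})" if "j \<in> {1..N}" for j
  proof (rule finite_UnI)
    show "finite {t \<in> {0..1}. Re (cis (2 * pi * t) * cnj (\<xi> j)) = u}"
      by (rule finite_circle_meets_line) (simp add: unit[OF that])
    show "finite {t \<in> {0..1}. Re (cis (2 * pi * t) * (\<i> * cnj (\<xi> j))) = 0}"
      by (rule finite_circle_meets_line) (simp add: unit[OF that] norm_mult)
  qed
  show ?thesis
    unfolding corner_times_def by (intro finite_UnI[OF _ finite_UN_I] fin finite.intros finite_atLeastAtMost)
qed

text \<open>Off the corners the maximum over the drops stays in one branch near \<open>t\<close>: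
  the sectors of different drops are disjoint, so at most one drop protrudes there and the others
  contribute \<open>u\<close>.\<close>

lemma boundary_path_arc_or_line:
  assumes t: "t \<in> {0<..<1} - corner_times"
  obtains \<omega> S where "open S" "t \<in> S" "\<And>x. x \<in> S \<Longrightarrow> boundary_path (E u) x = cis (2 * pi * x) / of_real (Re (cis (2 * pi * x) * \<omega>))"
      "cmod \<omega> \<le> 1 / u" "u \<le> Re (cis (2 * pi * t) * \<omega>)"
  | S where "open S" "t \<in> S" "\<And>x. x \<in> S \<Longrightarrow> boundary_path (E u) x = of_real u * cis (2 * pi * x)"
proof (cases "\<exists>j\<in>{1..N}. u \<le> Re (cis (2 * pi * t) * cnj (\<xi> j))")
  case True
  then obtain j where j: "j \<in> {1..N}" "u \<le> Re (cis (2 * pi * t) * cnj (\<xi> j))" by blast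
  define w where "w = (\<lambda>x. cis (2 * pi * x) * cnj (\<xi> j))"
  have cw [continuous_intros]: "continuous_on UNIV w" unfolding w_def by (intro continuous_intros)
  have wunit: "cmod (w x) = 1" for x using unit[OF j(1)] by (simp add: w_def norm_mult)
  have "Re (cis (2 * pi * t) * cnj (\<xi> j)) \<noteq> u" "Re (cis (2 * pi * t) * (\<i> * cnj (\<xi> j))) \<noteq> 0"
    using t j(1) unfolding corner_times_def by auto
  moreover have "Re (cis (2 * pi * t) * (\<i> * cnj (\<xi> j))) = - Im (w t)" by (simp add: w_def algebra_simps)
  ultimately have wt: "u < Re (w t)" "Im (w t) \<noteq> 0"
    using j(2) by (auto simp: w_def simp del: times_complex.sel cis.sel)
  define \<sigma> where "\<sigma> = sgn (Im (w t))"
  have \<sigma>: "\<bar>\<sigma>\<bar> = 1" using wt by (simp add: \<sigma>_def abs_sgn_eq)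
  define k where "k = sqrt (1 - u\<^sup>2) / u"
  have k: "0 \<le> k" "1 + k\<^sup>2 = (1 / u)\<^sup>2"
    using u_pos u by (simp_all add: k_def abs_square_le_1 power_divide divide_simps)
  \<comment> \<open>Removes the absolute value: \<sigma> is the sign of \<open>Im (w t)\<close>, so
    that near \<open>t\<close> the denominator \<open>Re w + k * \<bar>Im w\<bar>\<close> is the
    real part of a product with \<omega>. The modulus of \<omega> is \<open>1 / u\<close> because
    \<open>1 + k\<^sup>2 = (1 / u)\<^sup>2\<close>.\<close>
  define \<omega> where "\<omega> = cnj (\<xi> j) * Complex 1 (- \<sigma> * k)"
  have om: "Re (cis (2 * pi * x) * \<omega>) = Re (w x) + k * (\<sigma> * Im (w x))" for x
    unfolding \<omega>_def w_def mult.assoc[symmetric] by (simp add: algebra_simps)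
  define S where "S = {x. u < Re (w x)} \<inter> {x. 0 < \<sigma> * Im (w x)}"
  show ?thesis
  proof (rule that(1)[of S \<omega>])
    show "open S" unfolding S_def by (intro open_Int open_Collect_less continuous_intros)
    show "t \<in> S" using wt by (simp add: S_def \<sigma>_def sgn_if)
    show "cmod \<omega> \<le> 1 / u"
    proof -
      have "\<sigma>\<^sup>2 = 1" using \<sigma> by (metis power2_abs power_one)
      then have "(cmod (Complex 1 (- \<sigma> * k)))\<^sup>2 = (1 / u)\<^sup>2"
        unfolding cmod_power2 k(2)[symmetric] by (simp add: power_mult_distrib)
      then have "cmod (Complex 1 (- \<sigma> * k)) = 1 / u"
        using u_pos by (metis norm_ge_zero power2_eq_imp_eq divide_nonneg_nonneg less_imp_le zero_le_one)
      then show ?thesis using unit[OF j(1)] by (simp add: \<omega>_def norm_mult)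
    qed
    show "u \<le> Re (cis (2 * pi * t) * \<omega>)"
      unfolding om using wt k by (intro order_trans[OF less_imp_le[OF wt(1)]]) (simp add: \<sigma>_def sgn_if)
    fix x assume x: "x \<in> S"
    have "\<bar>Im (w x)\<bar> = \<sigma> * Im (w x)" using x \<sigma> by (auto simp: S_def abs_if zero_less_mult_iff split: if_splits)
    then have dj: "drop_radius u (w x) = 1 / Re (cis (2 * pi * x) * \<omega>)"
      unfolding om drop_radius_def using x by (simp add: S_def k_def)
    have "polar_radius u (cis (2 * pi * x)) = drop_radius u (w x)"
    proof (rule antisym)
      obtain i where i: "i \<in> {1..N}" "polar_radius u (cis (2 * pi * x)) = drop_radius u (cis (2 * pi * x) * cnj (\<xi> i))"
        by (rule polar_radius_attained[of u "cis (2 * pi * x)"])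
      show "polar_radius u (cis (2 * pi * x)) \<le> drop_radius u (w x)"
      proof (cases "i = j")
        case False
        have "Re (cis (2 * pi * x) * cnj (\<xi> i)) < u"
          using x False i j by (intro drop_sectors_disjoint[of j]) (auto simp: S_def w_def simp del: times_complex.sel)
        then show ?thesis
          using i(2) drop_radius_ge[OF u_pos u(2) wunit] by (simp add: drop_radius_def[of u "_ * cnj (\<xi> i)"] del: times_complex.sel)
      qed (use i in \<open>simp add: w_def\<close>)
      show "drop_radius u (w x) \<le> polar_radius u (cis (2 * pi * x))"
        unfolding w_def by (rule polar_radius_ge[OF j(1)])
    qed
    then show "boundary_path (E u) x = cis (2 * pi * x) / of_real (Re (cis (2 * pi * x) * \<omega>))"
      unfolding boundary_path_eq dj by simp
  qed
next
  case False
  define S where "S = (\<Inter>j\<in>{1..N}. {x. Re (cis (2 * pi * x) * cnj (\<xi> j)) < u})"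
  show ?thesis
  proof (rule that(2)[of S])
    show "open S" unfolding S_def
      by (intro open_INT ballI open_Collect_less continuous_intros) auto
    show "t \<in> S" using False by (auto simp: S_def not_le)
    fix x assume x: "x \<in> S"
    obtain i where i: "i \<in> {1..N}" "polar_radius u (cis (2 * pi * x)) = drop_radius u (cis (2 * pi * x) * cnj (\<xi> i))"
      by (rule polar_radius_attained[of u "cis (2 * pi * x)"])
    have "Re (cis (2 * pi * x) * cnj (\<xi> i)) < u" using x i(1) unfolding S_def by blast
    then show "boundary_path (E u) x = of_real u * cis (2 * pi * x)"
      unfolding boundary_path_eq i(2) drop_radius_def by simp
  qed
qed

lemma boundary_path_has_vector_derivative:
  assumes t: "t \<in> {0<..<1} - corner_times"
  obtains D where "(boundary_path (E u) has_vector_derivative D) (at t)" "cmod D \<le> 4 * pi / u ^ 3"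
  using t
proof (cases rule: boundary_path_arc_or_line)
  case (1 \<omega> S)
  obtain D where D: "((\<lambda>t. cis (2 * pi * t) / of_real (Re (cis (2 * pi * t) * \<omega>))) has_vector_derivative D) (at t)"
      "cmod D \<le> 4 * pi / u ^ 3"
    using line_in_polar_coordinates_vector_derivative[OF u_pos 1(5,4)] u by auto
  show ?thesis
    by (rule that[OF has_vector_derivative_transform_within_open[OF D(1) 1(1,2)] D(2)]) (simp only: 1(3))
next
  case (2 S)
  have "((\<lambda>x. of_real u * cis (2 * pi * x)) has_vector_derivative of_real u * (2 * of_real pi * \<i> * cis (2 * pi * t))) (at t)"
    by (rule has_vector_derivative_mult_right[OF cis_vector_derivative])
  then have D: "(boundary_path (E u) has_vector_derivative of_real u * (2 * of_real pi * \<i> * cis (2 * pi * t))) (at t)"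
    by (rule has_vector_derivative_transform_within_open[OF _ 2(1,2)]) (simp only: 2(3))
  have "u ^ 4 \<le> 1" using u u_pos by (intro power_le_one) auto
  then have "u * (2 * pi) \<le> 4 * pi / u ^ 3"
    using u_pos by (simp add: pos_le_divide_eq mult_ac power_numeral_reduce)
  then show ?thesis using that[OF D] u_pos by (simp add: norm_mult)
qed

lemma boundary_path_loop:
  obtains L where "bounded_velocity_loop (boundary_path (E u))
    (\<lambda>t. vector_derivative (boundary_path (E u)) (at t within {0..1})) corner_times L"
proof -
  define \<gamma> where "\<gamma> = boundary_path (E u)"
  define \<gamma>' where "\<gamma>' = (\<lambda>t. vector_derivative \<gamma> (at t within {0..1}))"
  \<comment> \<open>The sum covers the unspecified values of \<open>vector_derivative\<close> at the
    corners.\<close>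
  define L where "L = 4 * pi / u ^ 3 + (\<Sum>t\<in>corner_times. cmod (\<gamma>' t))"
  have *: "(\<gamma> has_vector_derivative \<gamma>' t) (at t) \<and> cmod (\<gamma>' t) \<le> 4 * pi / u ^ 3"
    if t: "t \<in> {0<..<1} - corner_times" for t
  proof -
    obtain D where D: "(\<gamma> has_vector_derivative D) (at t)" "cmod D \<le> 4 * pi / u ^ 3"
      using boundary_path_has_vector_derivative[OF t] unfolding \<gamma>_def .
    moreover have "\<gamma>' t = D"
      unfolding \<gamma>'_def by (rule vector_derivative_at_within_ivl[OF D(1)]) (use t in auto)
    ultimately show ?thesis by simp
  qed
  have sum: "0 \<le> (\<Sum>t\<in>corner_times. cmod (\<gamma>' t))" by (rule sum_nonneg) simp
  have "bounded_velocity_loop \<gamma> \<gamma>' corner_times L"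
  proof
    show "continuous_on {0..1} \<gamma>" unfolding \<gamma>_def by (rule continuous_on_boundary_path)
    show "\<gamma> 0 = \<gamma> 1" unfolding \<gamma>_def boundary_path_eq by simp
    show "finite corner_times" by (rule finite_corner_times)
    show "(\<gamma> has_vector_derivative \<gamma>' t) (at t)" if "t \<in> {0<..<1} - corner_times" for t
      using *[OF that] by simp
    show "cmod (\<gamma>' t) \<le> L" if t: "t \<in> {0..1}" for t
    proof (cases "t \<in> corner_times")
      case True
      have "cmod (\<gamma>' t) \<le> (\<Sum>t\<in>corner_times. cmod (\<gamma>' t))"
        by (rule member_le_sum[OF True]) (use finite_corner_times in auto)
      then show ?thesis using u_pos by (simp add: L_def add_increasing)
    next
      case False
      then have "t \<in> {0<..<1} - corner_times" using t by (auto simp: corner_times_def less_le)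
      then show ?thesis using * sum by (fastforce simp: L_def)
    qed
  qed
  then show ?thesis using that unfolding \<gamma>_def \<gamma>'_def by blast
qed

text \<open>In polar form a logarithm of the path is \<open>ln\<close> of the radius plus
  \<open>2 * pi * \<i> * t\<close>. This primitive has no branch cut and increases by
  \<open>2 * pi * \<i>\<close> over the period.\<close>

lemma boundary_path_winding:
  "((\<lambda>t. vector_derivative (boundary_path (E u)) (at t within {0..1}) * inverse (boundary_path (E u) t))
    has_integral 2 * of_real pi * \<i>) {0..1}"
proof -
  define \<gamma> where "\<gamma> = boundary_path (E u)"
  define \<gamma>' where "\<gamma>' = (\<lambda>t. vector_derivative \<gamma> (at t within {0..1}))"
  obtain L where "bounded_velocity_loop \<gamma> \<gamma>' corner_times L"
    using boundary_path_loop unfolding \<gamma>_def \<gamma>'_def by blast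
  then interpret bounded_velocity_loop \<gamma> \<gamma>' corner_times L .
  define f where "f = (\<lambda>t. cis (2 * pi * t))"
  \<comment> \<open>The radius is expressed through \<gamma>, so that its differentiability follows
    from that of \<gamma>.\<close>
  define g where "g = (\<lambda>t. Re (\<gamma> t * cnj (f t)))"
  have ff: "f t * cnj (f t) = 1" "cnj (f t) * f t = 1" for t by (simp_all add: f_def cis_cnj cis_mult)
  have \<gamma>f: "\<gamma> t = of_real (polar_radius u (f t)) * f t" for t
    by (simp add: \<gamma>_def f_def boundary_path_eq)
  have g: "g = (\<lambda>t. polar_radius u (f t))"
    by (simp add: g_def \<gamma>f mult.assoc ff)
  have gpos: "0 < g t" for t using polar_radius_pos[of "f t"] u_pos by (simp add: g f_def)
  have \<gamma>g: "\<gamma> t = g t *\<^sub>R f t" for t by (simp add: \<gamma>f g scaleR_conv_of_real)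
  have "((\<lambda>t. \<gamma>' t * inverse (\<gamma> t)) has_integral
      (of_real (ln (g 1)) + 2 * of_real pi * \<i> * of_real 1) - (of_real (ln (g 0)) + 2 * of_real pi * \<i> * of_real 0)) {0..1}"
  proof (rule fundamental_theorem_of_calculus_interior_strong[OF finite_corner_times])
    have "continuous_on {0..1} g" unfolding g f_def by (rule continuous_on_polar_radius)
    then show "continuous_on {0..1} (\<lambda>t. of_real (ln (g t)) + 2 * of_real pi * \<i> * of_real t)"
      using gpos by (intro continuous_intros) (auto simp: less_imp_neq[symmetric])
    fix t assume t: "t \<in> {0<..<1} - corner_times"
    define f' where "f' = 2 * of_real pi * \<i> * f t"
    have f: "(f has_vector_derivative f') (at t)" unfolding f_def f'_def by (rule cis_vector_derivative)
    define g' where "g' = Re (\<gamma> t * cnj f' + \<gamma>' t * cnj (f t))"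
    have g': "(g has_field_derivative g') (at t)"
      unfolding g_def g'_def has_real_derivative_iff_has_vector_derivative
      by (intro bounded_linear.has_vector_derivative[OF bounded_linear_Re] has_vector_derivative_mult
          bounded_linear.has_vector_derivative[OF bounded_linear_cnj] f deriv t)
    have "((\<lambda>t. g t *\<^sub>R f t) has_vector_derivative g t *\<^sub>R f' + g' *\<^sub>R f t) (at t)"
      by (rule has_vector_derivative_scaleR[OF g' f])
    then have "\<gamma>' t = g t *\<^sub>R f' + g' *\<^sub>R f t"
      using deriv[OF t] unfolding \<gamma>g[symmetric] by (rule vector_derivative_unique_at[rotated])
    then have "\<gamma>' t * inverse (\<gamma> t) = of_real (inverse (g t) * g') + 2 * of_real pi * \<i>"
      using gpos[of t] by (simp add: \<gamma>g f'_def f_def scaleR_conv_of_real field_simps)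
    moreover have "((\<lambda>t. of_real (ln (g t)) + 2 * of_real pi * \<i> * of_real t) has_vector_derivative
        of_real (inverse (g t) * g') + 2 * of_real pi * \<i> * of_real 1) (at t)"
      by (intro has_vector_derivative_add has_vector_derivative_of_real has_vector_derivative_mult_right
          DERIV_chain2[OF DERIV_ln g'] DERIV_ident gpos)
    ultimately show "((\<lambda>t. of_real (ln (g t)) + 2 * of_real pi * \<i> * of_real t) has_vector_derivative
        \<gamma>' t * inverse (\<gamma> t)) (at t)" by simp
  qed simp
  moreover have "g 1 = g 0" by (simp add: g f_def)
  ultimately show ?thesis by (simp add: \<gamma>_def \<gamma>'_def)
qed

end

end

subsection \<open>Rational functional calculus\<close>

text \<open>
  \<open>\<Phi>\<close> is the value \<open>\<phi>(T)\<close> when \<open>\<phi>(z) - \<Phi>\<close> is divisible by \<open>z - T\<close>, with a quotient that is a finite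
  combination of operators with scalar holomorphic coefficients; the quotient then has vanishing
  integrals along loops by the scalar Cauchy theorem.
\<close>

inductive holomorphic_combination :: "complex set \<Rightarrow> (complex \<Rightarrow> 'a::complex_banach) \<Rightarrow> bool" for S where
  single: "\<psi> holomorphic_on S \<Longrightarrow> holomorphic_combination S (\<lambda>z. \<psi> z *\<^sub>C A)"
| plus: "holomorphic_combination S F \<Longrightarrow> holomorphic_combination S G \<Longrightarrow> holomorphic_combination S (\<lambda>z. F z + G z)"

lemma holomorphic_combination_mono:
  "holomorphic_combination S F \<Longrightarrow> S' \<subseteq> S \<Longrightarrow> holomorphic_combination S' F"
  by (induction rule: holomorphic_combination.induct)
    (auto intro: holomorphic_combination.intros holomorphic_on_subset)

lemma holomorphic_combination_mult:
  assumes "holomorphic_combination S F" "\<phi> holomorphic_on S"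
  shows "holomorphic_combination S (\<lambda>z. \<phi> z *\<^sub>C F z)"
  using assms
proof (induction rule: holomorphic_combination.induct)
  case (single \<psi> A)
  then show ?case
    using holomorphic_combination.single[of "\<lambda>z. \<phi> z * \<psi> z" S A] by (simp add: scaleC_scaleC holomorphic_on_mult)
next
  case (plus F G)
  then show ?case
    using holomorphic_combination.plus by (simp add: scaleC_add_right)
qed

lemma holomorphic_combination_compose:
  assumes "holomorphic_combination S F" "\<Phi> \<in> BX"
  shows "holomorphic_combination S (\<lambda>z. \<Phi> o\<^sub>L F z)"
  using assms
proof (induction rule: holomorphic_combination.induct)
  case (single \<psi> A)
  then show ?case
    using holomorphic_combination.single[of \<psi> S "\<Phi> o\<^sub>L A"] by (simp add: scaleC_compose_right)
next
  case (plus F G)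
  then show ?case
    using holomorphic_combination.plus by (simp add: blinfun_compose.add_right)
qed

lemma continuous_on_holomorphic_combination:
  "holomorphic_combination S F \<Longrightarrow> continuous_on S F"
  by (induction rule: holomorphic_combination.induct)
    (auto intro!: continuous_intros holomorphic_on_imp_continuous_on)

lemma (in bounded_velocity_loop) path_integral_holomorphic_combination:
  fixes F :: "complex \<Rightarrow> 'b::complex_banach"
  assumes "holomorphic_combination S F" and S: "open S" "convex S"
    and g: "\<And>t. t \<in> {0..1} \<Longrightarrow> of_real l * \<gamma> t \<in> S"
  shows "path_integral (\<lambda>t. of_real l *\<^sub>C F (of_real l * \<gamma> t)) = 0"
  using assms(1)
proof (induction rule: holomorphic_combination.induct)
  case (single \<psi> A)
  have c: "continuous_on {0..1} (\<lambda>t. of_real l * \<psi> (of_real l * \<gamma> t))"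
    by (intro continuous_on_mult_left continuous_on_compose2[OF holomorphic_on_imp_continuous_on[OF single]] cont)
      (use g in auto)
  have "path_integral (\<lambda>t. (of_real l * \<psi> (of_real l * \<gamma> t)) *\<^sub>C A)
      = path_integral (\<lambda>t. of_real l * \<psi> (of_real l * \<gamma> t)) *\<^sub>C A"
    by (rule path_integral_linear[OF c bounded_bilinear.bounded_linear_left[OF bounded_bilinear_scaleC]])
      (simp add: scaleC_scaleC scaleC_complex_def)
  then show ?case
    using path_integral_holomorphic[OF single S g] by (simp add: scaleC_scaleC)
next
  case (plus F G)
  have c: "continuous_on {0..1} (\<lambda>t. of_real l *\<^sub>C H (of_real l * \<gamma> t))"
    if "holomorphic_combination S H" for H :: "complex \<Rightarrow> 'b"
    by (intro continuous_on_scaleC continuous_on_const continuous_on_mult_left cont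
        continuous_on_compose2[OF continuous_on_holomorphic_combination[OF that]])
      (use g in auto)
  show ?case
    using path_integral_add[OF c[OF plus(1)] c[OF plus(2)]] plus by (simp add: scaleC_add_right)
qed

section \<open>Algebra of the pairs formed by a symbol and its value at the operator\<close>

context operator
begin

text \<open>A relation, so that \<Phi> can be built step by step along with \<phi>. The factor
  \<open>z - T\<close> stands on the right, where composition with \<open>R z\<close> cancels
  it.\<close>

definition calculus :: "complex set \<Rightarrow> (complex \<Rightarrow> complex) \<Rightarrow> ('a \<Rightarrow>\<^sub>L 'a) \<Rightarrow> bool"
  where "calculus S \<phi> \<Phi> \<longleftrightarrow> \<phi> holomorphic_on S \<and> \<Phi> \<in> BX \<and>
    (\<exists>\<Psi>. holomorphic_combination S \<Psi> \<and> (\<forall>z\<in>S. \<phi> z *\<^sub>C id_blinfun - \<Phi> = \<Psi> z o\<^sub>L (z *\<^sub>C id_blinfun - T)))"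

lemma calculus_holomorphic: "calculus S \<phi> \<Phi> \<Longrightarrow> \<phi> holomorphic_on S"
  and calculus_BX: "calculus S \<phi> \<Phi> \<Longrightarrow> \<Phi> \<in> BX"
  by (simp_all add: calculus_def)

lemma calculus_mono: "calculus S \<phi> \<Phi> \<Longrightarrow> S' \<subseteq> S \<Longrightarrow> calculus S' \<phi> \<Phi>"
  unfolding calculus_def by (meson holomorphic_combination_mono holomorphic_on_subset subsetD)

lemma calculus_const: "calculus S (\<lambda>_. c) (c *\<^sub>C id_blinfun)"
  unfolding calculus_def
  by (intro conjI exI[of _ "\<lambda>z. 0 *\<^sub>C 0"] holomorphic_combination.single) (auto intro: BX_scaleC)

lemma calculus_id: "calculus S (\<lambda>z. z) T"
  unfolding calculus_def
  by (intro conjI exI[of _ "\<lambda>z. 1 *\<^sub>C id_blinfun"] holomorphic_combination.single) (auto simp: T_BX)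

lemma calculus_add:
  assumes "calculus S \<phi> \<Phi>" "calculus S \<psi> \<Psi>"
  shows "calculus S (\<lambda>z. \<phi> z + \<psi> z) (\<Phi> + \<Psi>)"
proof -
  obtain F where F: "holomorphic_combination S F" "\<And>z. z \<in> S \<Longrightarrow> \<phi> z *\<^sub>C id_blinfun - \<Phi> = F z o\<^sub>L (z *\<^sub>C id_blinfun - T)"
    using assms(1) by (auto simp: calculus_def)
  obtain G where G: "holomorphic_combination S G" "\<And>z. z \<in> S \<Longrightarrow> \<psi> z *\<^sub>C id_blinfun - \<Psi> = G z o\<^sub>L (z *\<^sub>C id_blinfun - T)"
    using assms(2) by (auto simp: calculus_def)
  have "(\<phi> z + \<psi> z) *\<^sub>C id_blinfun - (\<Phi> + \<Psi>) = (F z + G z) o\<^sub>L (z *\<^sub>C id_blinfun - T)" if "z \<in> S" for z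
    unfolding blinfun_compose.add_left F(2)[OF that, symmetric] G(2)[OF that, symmetric]
    by (simp add: scaleC_add_left)
  then show ?thesis
    using assms holomorphic_combination.plus[OF F(1) G(1)]
    unfolding calculus_def by (blast intro: holomorphic_on_add BX_add)
qed

text \<open>The product rule for divided differences: \<open>\<phi> \<psi> - \<Phi> \<Psi> = \<psi>
  (\<phi> - \<Phi>) + \<Phi> (\<psi> - \<Psi>)\<close>.\<close>

lemma calculus_mult:
  assumes "calculus S \<phi> \<Phi>" "calculus S \<psi> \<Psi>"
  shows "calculus S (\<lambda>z. \<phi> z * \<psi> z) (\<Phi> o\<^sub>L \<Psi>)"
proof -
  obtain F where F: "holomorphic_combination S F" "\<And>z. z \<in> S \<Longrightarrow> \<phi> z *\<^sub>C id_blinfun - \<Phi> = F z o\<^sub>L (z *\<^sub>C id_blinfun - T)"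
    using assms(1) by (auto simp: calculus_def)
  obtain G where G: "holomorphic_combination S G" "\<And>z. z \<in> S \<Longrightarrow> \<psi> z *\<^sub>C id_blinfun - \<Psi> = G z o\<^sub>L (z *\<^sub>C id_blinfun - T)"
    using assms(2) by (auto simp: calculus_def)
  have \<Phi>: "\<Phi> \<in> BX" using assms(1) by (rule calculus_BX)
  have "(\<phi> z * \<psi> z) *\<^sub>C id_blinfun - (\<Phi> o\<^sub>L \<Psi>)
      = (\<psi> z *\<^sub>C F z + (\<Phi> o\<^sub>L G z)) o\<^sub>L (z *\<^sub>C id_blinfun - T)" if "z \<in> S" for z
    unfolding blinfun_compose.add_left scaleC_compose_left compose_assoc
      F(2)[OF that, symmetric] G(2)[OF that, symmetric]
    unfolding blinfun_compose.diff_right scaleC_compose_right[OF \<Phi>]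
    by (simp add: scaleC_diff_right scaleC_scaleC mult.commute)
  then show ?thesis
    using assms holomorphic_combination.plus[OF holomorphic_combination_mult[OF F(1)] holomorphic_combination_compose[OF G(1) \<Phi>]]
    unfolding calculus_def by (blast intro: holomorphic_on_mult BX_compose)
qed

lemma calculus_resolvent:
  assumes "m \<notin> S" "m \<notin> spectrum T"
  shows "calculus S (\<lambda>z. 1 / (m - z)) (R m)"
proof -
  have h: "(\<lambda>z. 1 / (m - z)) holomorphic_on S"
    using assms(1) by (intro holomorphic_intros) auto
  have "(1 / (m - z)) *\<^sub>C id_blinfun - R m = ((1 / (m - z)) *\<^sub>C R m) o\<^sub>L (z *\<^sub>C id_blinfun - T)" if "z \<in> S" for z
  proof -
    have mz: "m - z \<noteq> 0" using that assms(1) by auto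
    have "R m o\<^sub>L (z *\<^sub>C id_blinfun - T) = id_blinfun - (m - z) *\<^sub>C R m"
      using resolvent_left[OF assms(2)]
      by (simp add: blinfun_compose.diff_right scaleC_compose_right[OF resolvent_BX[OF assms(2)]] scaleC_diff_left)
    then show ?thesis using mz by (simp add: scaleC_diff_right scaleC_scaleC)
  qed
  then show ?thesis
    unfolding calculus_def using h resolvent_BX[OF assms(2)] holomorphic_combination.single[OF h] by blast
qed

lemma calculus_scale: "calculus S \<phi> \<Phi> \<Longrightarrow> calculus S (\<lambda>z. c * \<phi> z) (c *\<^sub>C \<Phi>)"
  using calculus_mult[OF calculus_const[of S c], of \<phi> \<Phi>] by simp

lemma calculus_sum:
  "finite I \<Longrightarrow> (\<And>i. i \<in> I \<Longrightarrow> calculus S (\<phi> i) (\<Phi> i)) \<Longrightarrow> calculus S (\<lambda>z. \<Sum>i\<in>I. \<phi> i z) (\<Sum>i\<in>I. \<Phi> i)"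
proof (induction rule: finite_induct)
  case empty
  then show ?case using calculus_const[of S 0] by simp
qed (simp add: calculus_add)

lemma calculus_op_power: "calculus S \<phi> \<Phi> \<Longrightarrow> calculus S (\<lambda>z. \<phi> z ^ n) (op_power \<Phi> n)"
proof (induction n)
  case 0
  then show ?case using calculus_const[of S 1] by simp
qed (simp add: calculus_mult)

lemma calculus_op_prod:
  "(\<And>j. j \<in> {1..n} \<Longrightarrow> calculus S (\<phi> j) (\<Phi> j)) \<Longrightarrow> calculus S (\<lambda>z. \<Prod>j=1..n. \<phi> j z) (op_prod \<Phi> n)"
proof (induction n)
  case 0
  then show ?case using calculus_const[of S 1] by simp
next
  case (Suc n)
  then have "calculus S (\<lambda>z. (\<Prod>j=1..n. \<phi> j z) * \<phi> (Suc n) z) (op_prod \<Phi> n o\<^sub>L \<Phi> (Suc n))"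
    by (intro calculus_mult) auto
  then show ?case by (simp add: prod.nat_ivl_Suc')
qed

end

section \<open>Agreement of the algebraic value with the contour integral\<close>

locale Ritt_type = E_geometry \<xi> N r + operator T
  for \<xi> :: "nat \<Rightarrow> complex" and N r and T :: "'a::complex_banach \<Rightarrow>\<^sub>L 'a" +
  assumes type: "Ritt_E_type \<xi> N r T"
begin

lemma spectrum_closure: "spectrum T \<subseteq> closure (E r)"
  using type by (simp add: Ritt_E_type_def)

lemma resolvent_loop_boundary:
  assumes u: "r < u" "u < 1"
  defines "\<gamma> \<equiv> boundary_path (E u)"
  obtains B L where "resolvent_loop \<gamma> (\<lambda>t. vector_derivative \<gamma> (at t within {0..1})) B L T (- closure (E r))"
proof -
  obtain L where "bounded_velocity_loop \<gamma> (\<lambda>t. vector_derivative \<gamma> (at t within {0..1})) (corner_times u) L"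
    using boundary_path_loop[of u] u unfolding \<gamma>_def by auto
  then interpret bounded_velocity_loop \<gamma> "\<lambda>t. vector_derivative \<gamma> (at t within {0..1})" "corner_times u" L .
  have "resolvent_loop \<gamma> (\<lambda>t. vector_derivative \<gamma> (at t within {0..1})) (corner_times u) L T (- closure (E r))"
  proof
    show "open (- closure (E r))" by auto
    show "- closure (E r) \<inter> spectrum T = {}" using spectrum_closure by auto
    show "of_real l * \<gamma> t \<in> - closure (E r)" if "1 < l" for l t
      using boundary_path_dilate_notin_closure[of u r l t] u that by (simp add: \<gamma>_def)
    show "\<gamma> t \<noteq> 0" for t using boundary_path_nonzero[of u t] u by (simp add: \<gamma>_def)
    show "path_integral (\<lambda>t. inverse (\<gamma> t)) = 2 * of_real pi * \<i>"
      using boundary_path_winding[of u] u by (simp add: \<gamma>_def scaleC_complex_def integral_unique)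
  qed
  then show ?thesis by (rule that)
qed

text \<open>Of the two zeros at \<xi> j, one is spent on bounding the resolvent by the type
  condition and the other drives the product to 0. The value at \<xi> j is 0 as well, whatever
  \<open>R\<close> denotes there, because \<phi> vanishes.\<close>

lemma continuous_on_vanishing_mult_resolvent:
  assumes u: "r < u" "u < 1" and b: "1 < b" "b \<le> 2"
    and g: "g holomorphic_on ball 0 b" and \<phi>: "\<And>z. z \<in> ball 0 b \<Longrightarrow> \<phi> z = (\<Prod>j=1..N. \<xi> j - z)\<^sup>2 * g z"
  shows "continuous_on (ball 0 b - E u) (\<lambda>z. \<phi> z *\<^sub>C R z)"
proof -
  define p where "p = (\<lambda>z. \<Prod>j=1..N. \<xi> j - z)"
  \<comment> \<open>Strictly between \<open>r\<close> and \<open>u\<close>: the type condition gives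
    a bound outside \<open>closure (E s)\<close>, and that closure leaves \<open>E u\<close> only at
    the points \<xi> j.\<close>
  define s where "s = (r + u) / 2"
  have s: "r < s" "s < u" "s < 1" using u by (auto simp: s_def)
  have cg: "continuous_on (ball 0 b) g" using g by (rule holomorphic_on_imp_continuous_on)
  have cp: "isCont p z" for z unfolding p_def by (intro continuous_intros)
  obtain C where C: "\<And>z. z \<in> ball 0 2 - closure (E s) \<Longrightarrow> norm (p z *\<^sub>C R z) \<le> C"
    using type s unfolding Ritt_E_type_def bounded_iff p_def by fastforce
  have \<phi>p: "\<phi> z = (p z)\<^sup>2 * g z" if "z \<in> ball 0 b" for z
    unfolding p_def by (rule \<phi>[OF that])
  show ?thesis
    unfolding continuous_on_def
  proof
    fix z assume z: "z \<in> ball 0 b - E u"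
    define K where "K = ball 0 b - E u"
    have zb: "z \<in> ball 0 b" using z by simp
    have gz: "(g \<longlongrightarrow> g z) (at z)"
      using cg zb by (simp add: continuous_on_eq_continuous_at isCont_def)
    have \<phi>z: "((\<lambda>z. (p z)\<^sup>2 * g z) \<longlongrightarrow> (p z)\<^sup>2 * g z) (at z)"
      using cp[of z] gz unfolding isCont_def by (intro tendsto_intros)
    show "((\<lambda>z. \<phi> z *\<^sub>C R z) \<longlongrightarrow> \<phi> z *\<^sub>C R z) (at z within ball 0 b - E u)"
    proof (cases "z \<in> \<xi> ` {1..N}")
      case False
      then have zc: "z \<in> - closure (E r)"
        using z closure_E_dom_subset[of r u] u by auto
      have "isCont R z"
        by (rule isCont_resolvent[of "- closure (E r)"]) (use zc spectrum_closure in auto)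
      then have "((\<lambda>z. ((p z)\<^sup>2 * g z) *\<^sub>C R z) \<longlongrightarrow> ((p z)\<^sup>2 * g z) *\<^sub>C R z) (at z)"
        unfolding isCont_def by (intro tendsto_scaleC \<phi>z)
      then have "((\<lambda>z. ((p z)\<^sup>2 * g z) *\<^sub>C R z) \<longlongrightarrow> ((p z)\<^sup>2 * g z) *\<^sub>C R z) (at z within K)"
        by (rule tendsto_within_subset) simp
      moreover have "\<forall>\<^sub>F x in at z within K. ((p x)\<^sup>2 * g x) *\<^sub>C R x = \<phi> x *\<^sub>C R x"
        by (simp add: eventually_at_filter \<phi>p K_def)
      ultimately show ?thesis
        using Lim_transform_eventually \<phi>p[OF zb] unfolding K_def by fastforce
    next
      case True
      then have p0: "p z = 0" by (auto simp: p_def)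
      have "((\<lambda>x. cmod (p x * g x) * C) \<longlongrightarrow> cmod (p z * g z) * C) (at z)"
        using cp[of z] gz unfolding isCont_def by (intro tendsto_intros)
      then have lim: "((\<lambda>x. cmod (p x * g x) * C) \<longlongrightarrow> 0) (at z within K)"
        using p0 by (auto intro: tendsto_within_subset)
      have "\<forall>\<^sub>F x in at z within K. norm (\<phi> x *\<^sub>C R x) \<le> cmod (p x * g x) * C"
        unfolding eventually_at_filter
      proof (intro always_eventually allI impI)
        fix x assume x: "x \<noteq> z" "x \<in> K"
        show "norm (\<phi> x *\<^sub>C R x) \<le> cmod (p x * g x) * C"
        proof (cases "x \<in> \<xi> ` {1..N}")
          case True
          then have "p x = 0" by (auto simp: p_def)
          then show ?thesis using \<phi>p[of x] x by (simp add: K_def)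
        next
          case False
          then have "x \<in> ball 0 2 - closure (E s)"
            using x closure_E_dom_subset[of s u] s b by (auto simp: K_def)
          then have "norm (p x *\<^sub>C R x) \<le> C" by (rule C)
          moreover have "\<phi> x *\<^sub>C R x = (p x * g x) *\<^sub>C (p x *\<^sub>C R x)"
            using \<phi>p[of x] x by (simp add: K_def scaleC_scaleC power2_eq_square mult_ac)
          ultimately show ?thesis by (simp add: norm_scaleC mult_left_mono del: norm_mult)
        qed
      qed
      from Lim_null_comparison[OF this lim] show ?thesis
        using \<phi>p[OF zb] p0 by (simp add: K_def)
    qed
  qed
qed

lemma path_integral_calculus:
  assumes u: "r < u" "u < 1" and b: "1 < b" "b \<le> 2"
    and cal: "calculus (ball 0 b) \<phi> \<Phi>"
    and g: "g holomorphic_on ball 0 b" and \<phi>: "\<And>z. z \<in> ball 0 b \<Longrightarrow> \<phi> z = (\<Prod>j=1..N. \<xi> j - z)\<^sup>2 * g z"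
  shows "vec_contour_integral (boundary_path (E u)) (\<lambda>z. \<phi> z *\<^sub>C R z) = (2 * of_real pi * \<i>) *\<^sub>C \<Phi>"
proof -
  define \<gamma> where "\<gamma> = boundary_path (E u)"
  define F where "F = (\<lambda>z. \<phi> z *\<^sub>C R z)"
  obtain B L where "resolvent_loop \<gamma> (\<lambda>t. vector_derivative \<gamma> (at t within {0..1})) B L T (- closure (E r))"
    using resolvent_loop_boundary[OF u] unfolding \<gamma>_def by blast
  then interpret resolvent_loop \<gamma> "\<lambda>t. vector_derivative \<gamma> (at t within {0..1})" B L T "- closure (E r)" .
  obtain \<Psi> where \<Psi>: "holomorphic_combination (ball 0 b) \<Psi>"
      "\<And>z. z \<in> ball 0 b \<Longrightarrow> \<phi> z *\<^sub>C id_blinfun - \<Phi> = \<Psi> z o\<^sub>L (z *\<^sub>C id_blinfun - T)"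
    using cal by (auto simp: calculus_def)
  have BX: "\<Phi> \<in> BX" using cal by (rule calculus_BX)
  \<comment> \<open>The path lies in the closed unit disc, so dilations by factors up to
    \<open>c\<close> keep it in the ball of radius \<open>b\<close>.\<close>
  define c where "c = (1 + b) / 2"
  have c: "1 < c" "c < b" using b by (auto simp: c_def)
  have in_ball: "of_real l * \<gamma> t \<in> ball 0 b" if "l \<in> {1..c}" for l t
  proof -
    have "cmod (of_real l * \<gamma> t) \<le> c * 1"
      using that norm_boundary_path_le[of u t] u c
      unfolding norm_mult by (intro mult_mono) (auto simp: \<gamma>_def)
    then show ?thesis using c by simp
  qed
  have "continuous_on (ball 0 b - E u) F"
    unfolding F_def by (rule continuous_on_vanishing_mult_resolvent[OF u b g \<phi>])
  moreover have csnd: "continuous_on ({1..c} \<times> {0..1}) (\<lambda>x. \<gamma> (snd x))"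
    by (rule continuous_on_compose2[OF cont]) (auto intro!: continuous_intros)
  \<comment> \<open>Continuity jointly in the dilation factor and the time, with the factor 1
    included. On the compact rectangle it is uniform, which later lets the factor tend to 1 under
    the integral.\<close>
  ultimately have cF: "continuous_on ({1..c} \<times> {0..1}) (\<lambda>x. of_real (fst x) *\<^sub>C F (of_real (fst x) * \<gamma> (snd x)))"
  proof (intro continuous_on_scaleC, goal_cases)
    case 2
    show ?case
      by (rule continuous_on_compose2[OF 2(1)])
        (use in_ball boundary_path_dilate_notin_E_dom[of u] u in
         \<open>auto intro!: continuous_on_mult continuous_on_of_real continuous_on_fst continuous_on_id csnd simp flip: \<gamma>_def\<close>)
  qed (intro continuous_intros)
  have cFl: "continuous_on {0..1} (\<lambda>t. of_real l *\<^sub>C F (of_real l * \<gamma> t))" if "l \<in> {1..c}" for l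
  proof -
    have "continuous_on {0..1} (\<lambda>t::real. (l, t))" by (intro continuous_intros)
    from continuous_on_compose2[OF cF this] that show ?thesis by (simp add: image_subset_iff)
  qed
  have val: "path_integral (\<lambda>t. of_real l *\<^sub>C F (of_real l * \<gamma> t)) = (2 * of_real pi * \<i>) *\<^sub>C \<Phi>"
    if l: "1 < l" "l \<le> c" for l
  proof -
    have eq: "of_real l *\<^sub>C F (of_real l * \<gamma> t) = (\<Phi> o\<^sub>L (of_real l *\<^sub>C R (of_real l * \<gamma> t))) + of_real l *\<^sub>C \<Psi> (of_real l * \<gamma> t)"
      if t: "t \<in> {0..1}" for t
    proof -
      define z where "z = of_real l * \<gamma> t"
      have z: "z \<in> ball 0 b" "z \<notin> spectrum T" using in_ball l dilate_spectrum t by (auto simp: z_def)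
      have "F z = (\<Phi> + (\<phi> z *\<^sub>C id_blinfun - \<Phi>)) o\<^sub>L R z" by (simp add: F_def)
      also have "\<dots> = (\<Phi> o\<^sub>L R z) + (\<Psi> z o\<^sub>L ((z *\<^sub>C id_blinfun - T) o\<^sub>L R z))"
        unfolding \<Psi>(2)[OF z(1)] by (simp only: blinfun_compose.add_left compose_assoc)
      also have "\<dots> = (\<Phi> o\<^sub>L R z) + \<Psi> z" by (simp only: resolvent_cancel[OF z(2)] compose_id)
      finally show ?thesis by (simp only: z_def scaleC_compose_right[OF BX] scaleC_add_right)
    qed
    have c1: "continuous_on {0..1} (\<lambda>t. of_real l *\<^sub>C R (of_real l * \<gamma> t))"
      by (intro continuous_on_scaleC continuous_on_const continuous_on_dilate_resolvent l)
    have c1': "continuous_on {0..1} (\<lambda>t. \<Phi> o\<^sub>L (of_real l *\<^sub>C R (of_real l * \<gamma> t)))"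
      by (intro bounded_bilinear.continuous_on[OF bounded_bilinear_blinfun_compose] continuous_on_const c1)
    have c2: "continuous_on {0..1} (\<lambda>t. of_real l *\<^sub>C \<Psi> (of_real l * \<gamma> t))"
      by (intro continuous_on_scaleC continuous_on_const continuous_on_mult_left cont
          continuous_on_compose2[OF continuous_on_holomorphic_combination[OF \<Psi>(1)]])
        (use in_ball l in auto)
    have "path_integral (\<lambda>t. of_real l *\<^sub>C F (of_real l * \<gamma> t))
      = path_integral (\<lambda>t. (\<Phi> o\<^sub>L (of_real l *\<^sub>C R (of_real l * \<gamma> t))) + of_real l *\<^sub>C \<Psi> (of_real l * \<gamma> t))"
      by (rule integral_cong) (simp only: eq)
    also have "\<dots> = path_integral (\<lambda>t. \<Phi> o\<^sub>L (of_real l *\<^sub>C R (of_real l * \<gamma> t))) + path_integral (\<lambda>t. of_real l *\<^sub>C \<Psi> (of_real l * \<gamma> t))"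
      by (rule path_integral_add[OF c1' c2])
    also have "path_integral (\<lambda>t. of_real l *\<^sub>C \<Psi> (of_real l * \<gamma> t)) = 0"
      by (rule path_integral_holomorphic_combination[OF \<Psi>(1)]) (use in_ball l in auto)
    also have "path_integral (\<lambda>t. \<Phi> o\<^sub>L (of_real l *\<^sub>C R (of_real l * \<gamma> t))) = \<Phi> o\<^sub>L J l"
      unfolding J_def
      by (rule path_integral_linear[OF c1 bounded_bilinear.bounded_linear_right[OF bounded_bilinear_blinfun_compose]])
        (rule scaleC_compose_right[OF BX])
    finally show ?thesis by (simp add: J_eq[OF l(1)] scaleC_compose_right[OF BX])
  qed
  have "norm (path_integral (\<lambda>t. F (\<gamma> t)) - (2 * of_real pi * \<i>) *\<^sub>C \<Phi>) \<le> L * e" if e: "e > 0" for e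
  proof -
    have "uniformly_continuous_on ({1..c} \<times> {0..1}) (\<lambda>x. of_real (fst x) *\<^sub>C F (of_real (fst x) * \<gamma> (snd x)))"
      by (rule compact_uniformly_continuous[OF cF]) (intro compact_Times compact_Icc)
    then obtain d where d: "d > 0" "\<And>x y. x \<in> {1..c} \<times> {0..1} \<Longrightarrow> y \<in> {1..c} \<times> {0..1} \<Longrightarrow> dist x y < d \<Longrightarrow>
        dist (of_real (fst x) *\<^sub>C F (of_real (fst x) * \<gamma> (snd x))) (of_real (fst y) *\<^sub>C F (of_real (fst y) * \<gamma> (snd y))) < e"
      unfolding uniformly_continuous_on_def using e by blast
    define l where "l = min c (1 + d / 2)"
    have l: "1 < l" "l \<le> c" "\<bar>1 - l\<bar> < d" using c d(1) by (auto simp: l_def)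
    have "path_integral (\<lambda>t. F (\<gamma> t)) - (2 * of_real pi * \<i>) *\<^sub>C \<Phi>
      = path_integral (\<lambda>t. of_real 1 *\<^sub>C F (of_real 1 * \<gamma> t) - of_real l *\<^sub>C F (of_real l * \<gamma> t))"
      using path_integral_diff[OF cFl[of 1] cFl[of l]] val[OF l(1,2)] l c by simp
    also have "norm \<dots> \<le> L * e"
    proof (rule norm_path_integral_le)
      show "continuous_on {0..1} (\<lambda>t. of_real 1 *\<^sub>C F (of_real 1 * \<gamma> t) - of_real l *\<^sub>C F (of_real l * \<gamma> t))"
        using c l by (intro continuous_on_diff cFl) auto
      fix t :: real assume t: "t \<in> {0..1}"
      have "dist (1, t) (l, t) < d" using l by (simp add: dist_Pair_Pair dist_real_def)
      from d(2)[OF _ _ this] show "norm (of_real 1 *\<^sub>C F (of_real 1 * \<gamma> t) - of_real l *\<^sub>C F (of_real l * \<gamma> t)) \<le> e"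
        using t l c by (auto simp: dist_norm)
    qed
    finally show ?thesis .
  qed
  note bound = this
  have "norm (path_integral (\<lambda>t. F (\<gamma> t)) - (2 * of_real pi * \<i>) *\<^sub>C \<Phi>) \<le> 0 + e" if "e > 0" for e
  proof -
    have "L * (e / (L + 1)) \<le> e" using that L_nonneg by (simp add: field_simps)
    moreover have "e / (L + 1) > 0" using that L_nonneg by simp
    ultimately show ?thesis using bound[of "e / (L + 1)"] by linarith
  qed
  then have "norm (path_integral (\<lambda>t. F (\<gamma> t)) - (2 * of_real pi * \<i>) *\<^sub>C \<Phi>) \<le> 0"
    by (rule field_le_epsilon)
  then show ?thesis by (simp add: vec_contour_integral_def \<gamma>_def F_def)
qed

text \<open>Every \<open>u\<close> between \<open>r\<close> and \<open>s\<close> gives the same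
  value, so it does not matter which one \<open>SOME\<close> picks.\<close>

lemma H0_calc_eq:
  assumes s: "r < s" "s < 1" and "1 < b" "b \<le> 2" "calculus (ball 0 b) \<phi> \<Phi>" "g holomorphic_on ball 0 b"
    and "\<And>z. z \<in> ball 0 b \<Longrightarrow> \<phi> z = (\<Prod>j=1..N. \<xi> j - z)\<^sup>2 * g z"
  shows "H0_calc \<xi> N r s \<phi> T = \<Phi>"
proof -
  define u where "u = (SOME u. r < u \<and> u < s)"
  have "\<exists>u. r < u \<and> u < s" using s dense by blast
  then have u: "r < u \<and> u < s" unfolding u_def by (rule someI_ex)
  then have "vec_contour_integral (boundary_path (E u)) (\<lambda>z. \<phi> z *\<^sub>C R z) = (2 * of_real pi * \<i>) *\<^sub>C \<Phi>"
    using s by (intro path_integral_calculus[OF _ _ assms(3-7)]) auto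
  then show ?thesis
    by (simp add: H0_calc_def u_def[symmetric] Let_def scaleC_scaleC)
qed

end

subsection \<open>Rational approximation of fractional powers\<close>

text \<open>Right end points are taken because the sums of a decreasing function then stay below its
  integral; \<open>balakrishnan_sum_bound\<close> becomes uniform in the mesh that way.\<close>

lemma right_Riemann_sum_approx:
  fixes f :: "real \<Rightarrow> 'b::banach"
  assumes f: "continuous_on {a..b} f" and ab: "a < b" and e: "e > 0"
  obtains p :: nat where "p \<ge> 1"
    "norm ((\<Sum>i=1..p. ((b - a) / p) *\<^sub>R f (a + real i * ((b - a) / p))) - integral {a..b} f) \<le> e"
proof -
  define e' where "e' = e / (b - a)"
  have e': "e' > 0" using e ab by (simp add: e'_def)
  obtain \<delta> where \<delta>: "\<delta> > 0" "\<And>x y. x \<in> {a..b} \<Longrightarrow> y \<in> {a..b} \<Longrightarrow> dist y x < \<delta> \<Longrightarrow> dist (f y) (f x) < e'"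
    using compact_uniformly_continuous[OF f compact_Icc] e' unfolding uniformly_continuous_on_def by blast
  obtain p :: nat where p: "(b - a) / \<delta> < p" using reals_Archimedean2 by blast
  have "0 < (b - a) / \<delta>" using ab \<delta> by simp
  then have p0: "0 < p" using p by (metis of_nat_0_less_iff order_less_trans)
  define d where "d = (b - a) / p"
  have d: "0 < d" "d < \<delta>" "p * d = b - a" using ab p p0 \<delta> by (auto simp: d_def field_simps)
  have "norm ((\<Sum>i=1..k. d *\<^sub>R f (a + real i * d)) - integral {a..a + k * d} f) \<le> k * (e' * d)" if "k \<le> p" for k
    using that
  proof (induction k)
    case (Suc k)
    have "real (Suc k) * d \<le> p * d" using Suc(2) d by (intro mult_right_mono) auto
    then have le: "a \<le> a + k * d" "a + k * d \<le> a + Suc k * d" "a + Suc k * d \<le> b"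
      using d by (auto simp: distrib_right)
    have int: "f integrable_on {x..y}" if "a \<le> x" "y \<le> b" for x y
      by (rule integrable_continuous_interval[OF continuous_on_subset[OF f]]) (use that in auto)
    have split: "integral {a..a + k * d} f + integral {a + k * d..a + Suc k * d} f = integral {a..a + Suc k * d} f"
      by (rule Henstock_Kurzweil_Integration.integral_combine) (use le int in auto)
    have "((\<lambda>x. f x - f (a + Suc k * d)) has_integral
        integral {a + k * d..a + Suc k * d} f - d *\<^sub>R f (a + Suc k * d)) {a + k * d..a + Suc k * d}"
      using has_integral_diff[OF integrable_integral[OF int] has_integral_const_real[of "f (a + Suc k * d)"], of "a + k * d" "a + Suc k * d"]
        le d by (simp add: distrib_right)
    note int_step = this
    have "norm (integral {a + k * d..a + Suc k * d} f - d *\<^sub>R f (a + Suc k * d))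
        \<le> e' * measure lborel {a + k * d..a + Suc k * d}"
    proof (rule has_integral_bound_real[OF _ finite.emptyI int_step])
      fix x assume x: "x \<in> {a + k * d..a + Suc k * d} - {}"
      then have "dist x (a + Suc k * d) < \<delta>" using d by (auto simp: dist_real_def distrib_right)
      then show "norm (f x - f (a + Suc k * d)) \<le> e'"
        using \<delta>(2)[of "a + Suc k * d" x] x le by (auto simp: dist_norm)
    qed (use e' in simp)
    then have step: "norm (d *\<^sub>R f (a + Suc k * d) - integral {a + k * d..a + Suc k * d} f) \<le> e' * d"
      using d by (simp add: norm_minus_commute distrib_right)
    have "(\<Sum>i=1..Suc k. d *\<^sub>R f (a + real i * d)) - integral {a..a + Suc k * d} f
      = ((\<Sum>i=1..k. d *\<^sub>R f (a + real i * d)) - integral {a..a + k * d} f)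
        + (d *\<^sub>R f (a + Suc k * d) - integral {a + k * d..a + Suc k * d} f)"
      unfolding split[symmetric] by simp
    also have "norm \<dots> \<le> k * (e' * d) + e' * d"
      using Suc step by (intro norm_triangle_mono) auto
    finally show ?case by (simp add: distrib_right)
  qed simp
  from this[of p] have "norm ((\<Sum>i=1..p. d *\<^sub>R f (a + real i * d)) - integral {a..b} f) \<le> p * (e' * d)"
    using d by simp
  also have "p * (e' * d) = e' * (p * d)" by simp
  also have "\<dots> = e" using d ab by (simp add: e'_def)
  finally show ?thesis using that[of p] p0 by (simp add: d_def)
qed

text \<open>The large cut-off comes from the definition of the integral over an unbounded set, the
  small one from continuity at 0 of the indefinite integral of the extension by 0.\<close>

lemma integral_half_line_approx:
  fixes f :: "real \<Rightarrow> 'b::banach"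
  assumes f: "f integrable_on {0<..}" and e: "e > 0"
  obtains a b where "0 < a" "a < b" "norm (integral {a..b} f - integral {0<..} f) < e"
proof -
  define g where "g = (\<lambda>x. if x \<in> {0<..} then f x else 0)"
  define I where "I = integral {0<..} f"
  have "(f has_integral I) {0<..}" unfolding I_def using f by (rule integrable_integral)
  then obtain B where B: "B > 0" "\<And>a b. ball 0 B \<subseteq> cbox a b \<Longrightarrow> \<exists>z. (g has_integral z) (cbox a b) \<and> norm (z - I) < e / 2"
    unfolding has_integral'[of f] g_def using e by (metis half_gt_zero)
  have "ball 0 B \<subseteq> cbox (-B) B" by (auto simp: dist_real_def)
  then obtain z where z: "(g has_integral z) {-B..B}" "norm (z - I) < e / 2" using B(2)[of "-B" B] by auto
  have gint: "g integrable_on {-B..B}" using z(1) by blast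
  have cont: "continuous_on {-B..B} (\<lambda>x. integral {x..B} g)"
    by (rule indefinite_integral_continuous_1'[OF gint])
  have "integral {-B..0} g = integral {-B..0} (\<lambda>x. 0)"
    by (rule integral_cong) (simp add: g_def)
  then have z0: "integral {0..B} g = z"
    using Henstock_Kurzweil_Integration.integral_combine[OF _ _ gint, of 0] z(1) B(1) by (auto dest: integral_unique)
  obtain \<delta> where \<delta>: "\<delta> > 0" "\<And>x. x \<in> {-B..B} \<Longrightarrow> dist x 0 < \<delta> \<Longrightarrow> dist (integral {x..B} g) (integral {0..B} g) < e / 2"
    using cont[unfolded continuous_on_iff, rule_format, of 0 "e / 2"] e B(1) by auto
  define a where "a = min (\<delta> / 2) (B / 2)"
  have a: "0 < a" "a < B" "a < \<delta>" using \<delta> B by (auto simp: a_def)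
  have "integral {a..B} f = integral {a..B} g"
    by (rule integral_cong) (use a in \<open>auto simp: g_def\<close>)
  then have "norm (integral {a..B} f - z) < e / 2"
    using \<delta>(2)[of a] a B z0 by (simp add: dist_norm)
  then have "norm ((integral {a..B} f - z) + (z - I)) < e / 2 + e / 2"
    using z(2) by (intro norm_triangle_lt add_strict_mono)
  then show ?thesis using that[OF a(1,2)] by (simp add: I_def)
qed

text \<open>The mean value theorem for a decreasing integrand. The exponents in use are \<beta> and
  \<open>\<beta> - 1\<close>, so both signs of \<open>p\<close> occur.\<close>

lemma powr_increment_ge:
  fixes x y p :: real
  assumes "0 < x" "x \<le> y" "p \<le> 1" "p \<noteq> 0"
  shows "(y - x) * y powr (p - 1) \<le> (y powr p - x powr p) / p"
proof (cases "x = y")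
  case False
  then have "x < y" using assms by simp
  moreover have "((\<lambda>t. t powr p) has_real_derivative p * t powr (p - 1)) (at t)" if "x \<le> t" for t
    using assms that by (intro has_real_derivative_powr) auto
  ultimately obtain c where c: "x < c" "c < y" "y powr p - x powr p = (y - x) * (p * c powr (p - 1))"
    using MVT2[of x y "\<lambda>t. t powr p" "\<lambda>t. p * t powr (p - 1)"] by auto
  have "y powr (p - 1) \<le> c powr (p - 1)" using c assms by (intro powr_mono2') auto
  then show ?thesis using c assms by (simp add: mult_left_mono)
qed simp

text \<open>The right side is the integral of \<open>t powr (\<beta> - 1) * min 1 (a / t)\<close>
  over the half-line, split at \<open>a\<close>. The integrand decreases and \<open>H\<close> is its
  primitive vanishing at 0, so the sum is dominated by a telescoping one.\<close>

lemma balakrishnan_sum_bound: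
  fixes \<beta> a \<delta> d :: real
  assumes \<beta>: "0 < \<beta>" "\<beta> < 1" and a: "0 \<le> a" and \<delta>: "0 < \<delta>" and d: "0 < d"
  shows "(\<Sum>i=1..p. d * (\<delta> + real i * d) powr (\<beta> - 1) * min 1 (a / (\<delta> + real i * d))) \<le> (1 / \<beta> + 1 / (1 - \<beta>)) * a powr \<beta>"
proof (cases "a = 0")
  case True
  then show ?thesis using \<delta> d by (simp add: min_def)
next
  case False
  with a have a: "0 < a" by simp
  define h where "h = (\<lambda>t. t powr (\<beta> - 1) * min 1 (a / t))"
  define H where "H = (\<lambda>t. if t \<le> a then t powr \<beta> / \<beta> else a powr \<beta> / \<beta> + a * ((a powr (\<beta> - 1) - t powr (\<beta> - 1)) / (1 - \<beta>)))"
  have low: "(y - x) * h y \<le> H y - H x" if "0 < x" "x \<le> y" "y \<le> a" for x y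
  proof -
    have "h y = y powr (\<beta> - 1)" using that by (simp add: h_def min_def)
    then show ?thesis
      using powr_increment_ge[of x y \<beta>] that \<beta> by (simp add: H_def diff_divide_distrib)
  qed
  have Ha: "H y = a powr \<beta> / \<beta> + a * ((a powr (\<beta> - 1) - y powr (\<beta> - 1)) / (1 - \<beta>))" if "a \<le> y" for y
    using that by (auto simp: H_def)
  have hhigh: "h y = a * y powr (\<beta> - 1 - 1)" if "a \<le> y" for y
    using that a by (auto simp: h_def min_def powr_diff power2_eq_square)
  have high: "(y - x) * h y \<le> H y - H x" if "a \<le> x" "x \<le> y" for x y
  proof -
    have "(y - x) * y powr (\<beta> - 1 - 1) \<le> (y powr (\<beta> - 1) - x powr (\<beta> - 1)) / (\<beta> - 1)"
      using that a \<beta> by (intro powr_increment_ge) auto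
    also have "\<dots> = (x powr (\<beta> - 1) - y powr (\<beta> - 1)) / (1 - \<beta>)"
      by (metis minus_diff_eq minus_divide_divide)
    finally have "a * ((y - x) * y powr (\<beta> - 1 - 1)) \<le> a * ((x powr (\<beta> - 1) - y powr (\<beta> - 1)) / (1 - \<beta>))"
      using a by (intro mult_left_mono) auto
    also have "\<dots> = H y - H x" using that by (simp add: Ha diff_divide_distrib algebra_simps)
    finally show ?thesis using that by (simp add: hhigh mult_ac)
  qed
  have incr: "(y - x) * h y \<le> H y - H x" if xy: "0 < x" "x \<le> y" for x y
  proof (cases "y \<le> a \<or> a \<le> x")
    case True
    then show ?thesis using low high xy by auto
  next
    case False
    then have m: "x \<le> a" "a \<le> y" by auto
    \<comment> \<open>The interval is cut at \<open>a\<close>; on its left part the value at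
      \<open>y\<close> is replaced by the larger value at \<open>a\<close>.\<close>
    have "h y \<le> h a"
      unfolding hhigh[OF m(2)] hhigh[OF order.refl] using a m \<beta> by (intro mult_left_mono powr_mono2') auto
    then have "(a - x) * h y \<le> (a - x) * h a" using m by (intro mult_left_mono) auto
    then show ?thesis using low[OF xy(1) m(1)] high[OF order.refl m(2)] by (simp add: algebra_simps)
  qed
  have H0: "0 \<le> H t" if "0 < t" for t
    using low[of t t] that a \<beta> powr_mono2'[of "\<beta> - 1" a t] by (auto simp: H_def)
  have Hle: "H t \<le> (1 / \<beta> + 1 / (1 - \<beta>)) * a powr \<beta>" if "0 < t" for t
  proof (cases "t \<le> a")
    case True
    then have "t powr \<beta> \<le> a powr \<beta>" using that \<beta> by (intro powr_mono2) auto
    then have "H t \<le> a powr \<beta> / \<beta>" using True \<beta> by (simp add: H_def divide_right_mono)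
    then show ?thesis using \<beta> by (simp add: distrib_right add_increasing2)
  next
    case False
    have "a * ((a powr (\<beta> - 1) - t powr (\<beta> - 1)) / (1 - \<beta>)) \<le> a * (a powr (\<beta> - 1) / (1 - \<beta>))"
      using a \<beta> by (intro mult_left_mono divide_right_mono) auto
    also have "\<dots> = a powr \<beta> / (1 - \<beta>)" using a by (simp add: powr_diff)
    finally show ?thesis using False by (simp add: H_def distrib_right)
  qed
  have tele: "(\<Sum>i=1..p. d * h (\<delta> + real i * d)) \<le> H (\<delta> + p * d) - H \<delta>" for p :: nat
  proof (induction p)
    case (Suc p)
    have "d * h (\<delta> + Suc p * d) \<le> H (\<delta> + Suc p * d) - H (\<delta> + p * d)"
      using incr[of "\<delta> + p * d" "\<delta> + Suc p * d"] \<delta> d by (simp add: distrib_right add_pos_nonneg)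
    then show ?case using Suc by simp
  qed simp
  have "H (\<delta> + p * d) - H \<delta> \<le> (1 / \<beta> + 1 / (1 - \<beta>)) * a powr \<beta>"
    using H0[of \<delta>] Hle[of "\<delta> + p * d"] \<delta> d by (simp add: add_pos_nonneg)
  with tele[of p] show ?thesis by (simp add: h_def mult.assoc)
qed

section \<open>Rational approximants of a single fractional power\<close>

context Ritt_type
begin

lemma Ritt: "Ritt_E \<xi> N T"
  using type by (simp add: Ritt_E_type_def)

lemma outside_disc: "1 < cmod z \<Longrightarrow> z \<notin> spectrum T"
  using Ritt by (auto simp: Ritt_E_def)

context
  fixes j :: nat and A :: "'a \<Rightarrow>\<^sub>L 'a" and a :: "complex \<Rightarrow> complex" and V :: "real \<Rightarrow> 'a \<Rightarrow>\<^sub>L 'a"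
  assumes inj: "inj_on \<xi> {1..N}" and j: "j \<in> {1..N}"
  defines "A \<equiv> id_blinfun - cnj (\<xi> j) *\<^sub>C T"
    and "a \<equiv> \<lambda>z. 1 - cnj (\<xi> j) * z"
    and "V \<equiv> \<lambda>t. op_inv (t *\<^sub>R id_blinfun + A)"
begin

text \<open>\<open>t + A\<close> is \<open>cnj (\<xi> j)\<close> times
  \<open>(1 + t) * \<xi> j - T\<close>, and \<open>(1 + t) * \<xi> j\<close> lies outside the closed
  unit disc, which contains the spectrum.\<close>

lemma is_op_inv_shift:
  assumes t: "0 < t"
  shows "is_op_inv (t *\<^sub>R id_blinfun + A) (\<xi> j *\<^sub>C R (of_real (1 + t) * \<xi> j))"
proof -
  have "1 < cmod (of_real (1 + t) * \<xi> j)" using t unit[OF j] by (simp add: norm_mult del: of_real_add)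
  then have "is_op_inv (cnj (\<xi> j) *\<^sub>C ((of_real (1 + t) * \<xi> j) *\<^sub>C id_blinfun - T))
      (inverse (cnj (\<xi> j)) *\<^sub>C R (of_real (1 + t) * \<xi> j))"
    using unit[OF j] by (intro is_op_inv_scaleC resolvent_is_op_inv outside_disc BX_diff BX_scaleC BX_id T_BX) auto
  moreover have "inverse (cnj (\<xi> j)) = \<xi> j"
    using cnj_unit[OF j] by (metis inverse_unique)
  moreover have "cnj (\<xi> j) *\<^sub>C ((of_real (1 + t) * \<xi> j) *\<^sub>C id_blinfun - T)
      = (cnj (\<xi> j) * \<xi> j * of_real (1 + t)) *\<^sub>C id_blinfun - cnj (\<xi> j) *\<^sub>C T"
    by (simp add: scaleC_diff_right scaleC_scaleC mult_ac)
  moreover have "\<dots> = t *\<^sub>R id_blinfun + A"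
    using j by (simp add: A_def scaleC_add_left scaleC_of_real)
  ultimately show ?thesis by simp
qed

lemma V_eq: "0 < t \<Longrightarrow> V t = \<xi> j *\<^sub>C R (of_real (1 + t) * \<xi> j)"
  unfolding V_def by (rule op_inv_eqI[OF is_op_inv_shift])

lemma V_right: "0 < t \<Longrightarrow> A o\<^sub>L V t = id_blinfun - t *\<^sub>R V t"
  using is_op_inv_shift[of t] V_eq[of t]
  by (simp add: is_op_inv_def blinfun_compose.add_left blinfun_compose.scaleR_left eq_diff_eq add.commute)

lemma calculus_A: "calculus S a A"
  using calculus_add[OF calculus_const[of S 1] calculus_scale[OF calculus_id, of S "- cnj (\<xi> j)"]]
  by (simp add: a_def A_def scaleC_minus_left)

text \<open>The only pole is \<open>(1 + t) * \<xi> j\<close>, of modulus \<open>1 + t\<close>; this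
  limits the radius of the ball.\<close>

lemma calculus_V:
  assumes "0 < t" "b \<le> 1 + t"
  shows "calculus (ball 0 b) (\<lambda>z. 1 / (of_real t + a z)) (V t)"
proof -
  define m where "m = of_real (1 + t) * \<xi> j"
  have m: "cmod m = 1 + t" using assms unit[OF j] by (simp add: m_def norm_mult del: of_real_add)
  have "calculus (ball 0 b) (\<lambda>z. \<xi> j * (1 / (m - z))) (\<xi> j *\<^sub>C R m)"
    using m assms by (intro calculus_scale calculus_resolvent outside_disc) auto
  moreover have "\<xi> j * (1 / (m - z)) = 1 / (of_real t + a z)" for z
  proof -
    have "of_real t + a z = cnj (\<xi> j) * (m - z)"
      using j cnj_unit(1)[OF j] by (simp add: a_def m_def algebra_simps)
    moreover have "\<xi> j = 1 / cnj (\<xi> j)" using cnj_unit[OF j] by (metis divide_eq_eq mult_zero_left zero_neq_one)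
    ultimately show ?thesis by (metis divide_divide_eq_left times_divide_times_eq mult.commute mult_1)
  qed
  ultimately show ?thesis using V_eq[OF assms(1)] by (simp add: m_def)
qed

lemma continuous_on_V: "continuous_on {0<..} V"
proof -
  have "continuous_on {0<..} (\<lambda>t. \<xi> j *\<^sub>C R (of_real (1 + t) * \<xi> j))"
  proof (intro continuous_on_scaleC continuous_on_const)
    show "continuous_on {0<..} (\<lambda>t. R (of_real (1 + t) * \<xi> j))"
    proof (rule continuous_on_compose2[OF continuous_on_resolvent[of "- cball 0 1"]])
      show "(\<lambda>t. of_real (1 + t) * \<xi> j) ` {0<..} \<subseteq> - cball 0 1"
        using unit[OF j] by (auto simp: norm_mult simp del: of_real_add)
    qed (use outside_disc in \<open>auto intro!: continuous_intros simp: not_le\<close>)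
  qed
  then show ?thesis by (rule continuous_on_eq) (simp add: V_eq)
qed

text \<open>At \<open>z = (1 + t) * \<xi> j\<close> the factor of index \<open>j\<close> has modulus
  \<open>t\<close>, and moving radially outwards from the circle does not decrease the distances to
  the other points. The product \<open>c\<close> of their distances to \<xi> j is positive since the
  points are distinct. The restriction \<open>t < 1\<close> keeps \<open>z\<close> in the annulus of
  outer radius 2.\<close>

lemma sectorial_bound: obtains C where "0 \<le> C" "\<And>t. 0 < t \<Longrightarrow> t < 1 \<Longrightarrow> norm (t *\<^sub>R V t) \<le> C"
proof -
  define P where "P = (\<lambda>z. \<Prod>i=1..N. 1 - cnj (\<xi> i) * z)"
  obtain C where C: "\<And>z. 1 < cmod z \<Longrightarrow> cmod z < 2 \<Longrightarrow> norm (P z *\<^sub>C R z) \<le> C"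
  proof -
    have "\<forall>C>1. bounded ((\<lambda>z. P z *\<^sub>C R z) ` {z. 1 < cmod z \<and> cmod z < C})"
      using Ritt unfolding Ritt_E_def P_def by blast
    then have "bounded ((\<lambda>z. P z *\<^sub>C R z) ` {z. 1 < cmod z \<and> cmod z < 2})" by simp
    then show ?thesis using that by (auto simp: bounded_iff)
  qed
  define c where "c = (\<Prod>i\<in>{1..N} - {j}. cmod (\<xi> i - \<xi> j))"
  have c: "0 < c"
    unfolding c_def using inj j by (intro prod_pos) (auto dest: inj_onD)
  have bound: "norm (t *\<^sub>R V t) \<le> C / c" if t: "0 < t" "t < 1" for t
  proof -
    define z where "z = of_real (1 + t) * \<xi> j"
    have cz: "cmod z = 1 + t" using t unit[OF j] by (simp add: z_def norm_mult del: of_real_add)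
    have factor: "cmod (1 - cnj (\<xi> i) * z) = cmod (\<xi> i - z)" if i: "i \<in> {1..N}" for i
    proof -
      have "1 - cnj (\<xi> i) * z = cnj (\<xi> i) * (\<xi> i - z)" using cnj_unit(1)[OF i] by (simp add: right_diff_distrib)
      then show ?thesis using unit[OF i] by (simp add: norm_mult)
    qed
    have far: "cmod (\<xi> i - \<xi> j) \<le> cmod (\<xi> i - z)" if i: "i \<in> {1..N}" for i
    proof (rule power2_le_imp_le)
      define q where "q = Re (\<xi> i) * Re (\<xi> j) + Im (\<xi> i) * Im (\<xi> j)"
      note sq = unit_re_im[OF unit[OF i]] unit_re_im[OF unit[OF j]]
      have eq: "(cmod (\<xi> i - of_real l * \<xi> j))\<^sup>2 = 1 + l\<^sup>2 - 2 * l * q" for l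
      proof -
        have "(cmod (\<xi> i - of_real l * \<xi> j))\<^sup>2 = ((Re (\<xi> i))\<^sup>2 + (Im (\<xi> i))\<^sup>2)
            + l\<^sup>2 * ((Re (\<xi> j))\<^sup>2 + (Im (\<xi> j))\<^sup>2) - 2 * l * q"
          unfolding cmod_power2 by (simp add: q_def power2_eq_square algebra_simps)
        then show ?thesis unfolding sq by simp
      qed
      have "0 \<le> (cmod (\<xi> i - of_real 1 * \<xi> j))\<^sup>2" by simp
      then have "q \<le> 1" unfolding eq by simp
      then have "0 \<le> t * (2 + t - 2 * q)" using t by simp
      also have "\<dots> = (cmod (\<xi> i - of_real (1 + t) * \<xi> j))\<^sup>2 - (cmod (\<xi> i - of_real 1 * \<xi> j))\<^sup>2"
        unfolding eq by (simp add: power2_eq_square algebra_simps)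
      finally show "(cmod (\<xi> i - \<xi> j))\<^sup>2 \<le> (cmod (\<xi> i - z))\<^sup>2" by (simp add: z_def)
    qed simp
    have "\<xi> j - z = - of_real t * \<xi> j" by (simp add: z_def algebra_simps)
    then have near: "cmod (\<xi> j - z) = t" using t unit[OF j] by (simp add: norm_mult)
    have "t * c \<le> cmod (\<xi> j - z) * (\<Prod>i\<in>{1..N} - {j}. cmod (\<xi> i - z))"
      unfolding near c_def using t far by (intro mult_left_mono prod_mono) auto
    also have "\<dots> = (\<Prod>i=1..N. cmod (\<xi> i - z))"
      using prod.remove[of "{1..N}" j "\<lambda>i. cmod (\<xi> i - z)"] j by simp
    also have "\<dots> = cmod (P z)"
      unfolding P_def prod_norm[symmetric] by (rule prod.cong) (simp_all only: factor)
    finally have "t * c * norm (R z) \<le> cmod (P z) * norm (R z)" by (intro mult_right_mono) auto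
    also have "\<dots> \<le> C" using C[of z] cz t by (simp add: norm_scaleC)
    finally have "t * norm (R z) \<le> C / c" using c by (simp add: pos_le_divide_eq mult_ac)
    moreover have "norm (V t) = norm (R z)"
      using unit[OF j] by (simp add: V_eq[OF t(1)] z_def norm_scaleC)
    ultimately show ?thesis using t by simp
  qed
  have "0 \<le> C / c" using order_trans[OF norm_ge_zero bound[of "1/2"]] by simp
  then show ?thesis using that bound by blast
qed

text \<open>On the closed disc \<open>a z\<close> has nonnegative real part, so the modulus of
  \<open>t + a z\<close> is at least that of each summand.\<close>

lemma a_bounds:
  assumes z: "cmod z \<le> 1" and t: "0 < t"
  shows "cmod (a z / (of_real t + a z)) \<le> min 1 (cmod (a z) / t)"
proof -
  have "Re (cnj (\<xi> j) * z) \<le> cmod (cnj (\<xi> j) * z)" by (rule complex_Re_le_cmod)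
  also have "\<dots> \<le> 1" unfolding norm_mult using z unit[OF j] by simp
  finally have re: "0 \<le> Re (a z)" by (simp add: a_def)
  have 1: "cmod (a z) \<le> cmod (of_real t + a z)"
  proof (rule power2_le_imp_le)
    have "(Re (a z))\<^sup>2 \<le> (t + Re (a z))\<^sup>2" using re t by (intro power_mono) auto
    then show "(cmod (a z))\<^sup>2 \<le> (cmod (of_real t + a z))\<^sup>2" unfolding cmod_power2 by simp
  qed simp
  have "t \<le> Re (of_real t + a z)" using re by simp
  also have "\<dots> \<le> cmod (of_real t + a z)" by (rule complex_Re_le_cmod)
  finally have 2: "t \<le> cmod (of_real t + a z)" .
  with t have pos: "0 < cmod (of_real t + a z)" by linarith
  have "cmod (a z) / cmod (of_real t + a z) \<le> 1" using 1 pos by (simp add: divide_le_eq_1)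
  moreover have "cmod (a z) / cmod (of_real t + a z) \<le> cmod (a z) / t"
    using 2 t pos by (intro divide_left_mono) auto
  ultimately show ?thesis by (simp add: norm_divide)
qed

lemma cmod_a: "cmod (a z) = cmod (\<xi> j - z)"
proof -
  have "a z = cnj (\<xi> j) * (\<xi> j - z)" using cnj_unit(1)[OF j] by (simp add: a_def right_diff_distrib)
  then show ?thesis using unit[OF j] by (simp add: norm_mult)
qed

text \<open>The factor \<open>a / (\<eta> + a)\<close> produces a double zero at \<open>\<xi> j\<close>, and tends to 1 with \<open>\<eta>\<close>.\<close>

lemma double_zero_approx:
  assumes b: "1 < b" and s: "calculus (ball 0 b) s S" and e: "0 < e"
  obtains b' q Q g where "1 < b'" "b' \<le> 2" "calculus (ball 0 b') q Q" "norm (Q - (S o\<^sub>L A)) < e"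
    "\<forall>z. cmod z \<le> 1 \<longrightarrow> cmod (q z) \<le> cmod (s z * a z)"
    "g holomorphic_on ball 0 b'" "\<forall>z. q z = (\<xi> j - z)\<^sup>2 * g z"
proof -
  obtain C where C: "0 \<le> C" "\<And>t. 0 < t \<Longrightarrow> t < 1 \<Longrightarrow> norm (t *\<^sub>R V t) \<le> C"
    using sectorial_bound by blast
  define I where "I = norm (id_blinfun :: 'a \<Rightarrow>\<^sub>L 'a)"
  define D where "D = norm S * (I + C) + 1"
  have D: "0 < D" using C by (simp add: D_def I_def add_nonneg_pos)
  \<comment> \<open>Chosen against the error
    \<open>\<eta> * norm (S o\<^sub>L (A o\<^sub>L V \<eta>))\<close>, in which
    \<open>A o\<^sub>L V \<eta>\<close> is bounded independently of \<eta> by sectoriality.\<close>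
  define \<eta> where "\<eta> = min (1/2) (e / (2 * D))"
  have \<eta>: "0 < \<eta>" "\<eta> < 1" "\<eta> * D < e"
  proof -
    show "0 < \<eta>" "\<eta> < 1" using e D by (auto simp: \<eta>_def)
    have "\<eta> * D \<le> e / (2 * D) * D" using D by (intro mult_right_mono) (auto simp: \<eta>_def)
    also have "\<dots> < e" using e D by simp
    finally show "\<eta> * D < e" .
  qed
  \<comment> \<open>The bound \<open>1 + \<eta>\<close> keeps the new pole
    \<open>(1 + \<eta>) * \<xi> j\<close> out of the ball.\<close>
  define b' where "b' = min (min b 2) (1 + \<eta>)"
  have b': "1 < b'" "b' \<le> 2" "b' \<le> b" "b' \<le> 1 + \<eta>" using b \<eta> by (auto simp: b'_def)
  have cs: "calculus (ball 0 b') s S" by (rule calculus_mono[OF s]) (use b' in auto)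
  have cV: "calculus (ball 0 b') (\<lambda>z. 1 / (of_real \<eta> + a z)) (V \<eta>)" using \<eta> b' by (intro calculus_V) auto
  define q where "q = (\<lambda>z. (s z * a z) * (a z * (1 / (of_real \<eta> + a z))))"
  define Q where "Q = (S o\<^sub>L A) o\<^sub>L (A o\<^sub>L V \<eta>)"
  have cq: "calculus (ball 0 b') q Q"
    unfolding q_def Q_def by (intro calculus_mult cs calculus_A cV)
  define g where "g = (\<lambda>z. (cnj (\<xi> j))\<^sup>2 * s z * (1 / (of_real \<eta> + a z)))"
  have hg: "g holomorphic_on ball 0 b'"
    unfolding g_def by (intro holomorphic_intros calculus_holomorphic[OF cs] calculus_holomorphic[OF cV])
  have qg: "q z = (\<xi> j - z)\<^sup>2 * g z" for z
  proof -
    have az: "a z = cnj (\<xi> j) * (\<xi> j - z)" using cnj_unit(1)[OF j] by (simp add: a_def right_diff_distrib)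
    show ?thesis
      unfolding q_def g_def by (subst (1 2) az) (simp only: power2_eq_square mult_ac)
  qed
  have qle: "cmod (q z) \<le> cmod (s z * a z)" if "cmod z \<le> 1" for z
  proof -
    have "cmod (q z) = cmod (s z * a z) * cmod (a z / (of_real \<eta> + a z))"
      by (simp add: q_def norm_mult norm_divide)
    also have "\<dots> \<le> cmod (s z * a z) * 1"
      using a_bounds[OF that \<eta>(1)] by (intro mult_left_mono) auto
    finally show ?thesis by simp
  qed
  have "Q - (S o\<^sub>L A) = - ((S o\<^sub>L A) o\<^sub>L (\<eta> *\<^sub>R V \<eta>))"
    unfolding Q_def V_right[OF \<eta>(1)] by (simp add: blinfun_compose.diff_right)
  also have "\<dots> = - (\<eta> *\<^sub>R (S o\<^sub>L (A o\<^sub>L V \<eta>)))"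
    by (simp add: blinfun_compose.scaleR_right compose_assoc)
  finally have "norm (Q - (S o\<^sub>L A)) = \<eta> * norm (S o\<^sub>L (A o\<^sub>L V \<eta>))" using \<eta> by simp
  also have "\<dots> \<le> \<eta> * (norm S * (I + C))"
  proof (rule mult_left_mono[OF order_trans[OF norm_blinfun_compose mult_left_mono]])
    have "norm (A o\<^sub>L V \<eta>) \<le> norm (id_blinfun :: 'a \<Rightarrow>\<^sub>L 'a) + norm (\<eta> *\<^sub>R V \<eta>)"
      unfolding V_right[OF \<eta>(1)] by (rule norm_triangle_ineq4)
    also have "\<dots> \<le> I + C" using C(2)[OF \<eta>(1,2)] by (simp add: I_def)
    finally show "norm (A o\<^sub>L V \<eta>) \<le> I + C" .
  qed (use \<eta> in auto)
  also have "\<dots> \<le> \<eta> * D" using \<eta> by (intro mult_left_mono) (auto simp: D_def)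
  also have "\<dots> < e" by (rule \<eta>)
  finally show ?thesis by (intro that[OF b'(1,2) cq]) (use qle hg qg in auto)
qed

text \<open>The factor \<open>A\<close> is kept apart from the sum \<open>S\<close>: on the scalar
  side it is a first zero at \<xi> j, to which \<open>double_zero_approx\<close> adds the second.
  The constant in the last line depends on \<beta> alone, not on the accuracy
  \<open>e\<close>.\<close>

lemma balakrishnan_sum_approx:
  fixes \<beta> :: real
  defines "f \<equiv> \<lambda>t::real. t powr (\<beta> - 1) *\<^sub>R (V t o\<^sub>L A)"
  assumes \<beta>: "0 < \<beta>" "\<beta> < 1" and f: "f integrable_on {0<..}" and e: "0 < e"
  obtains b s S where "1 < b" "calculus (ball 0 b) s S" "norm ((S o\<^sub>L A) - integral {0<..} f) < e"
    "\<And>z. cmod z \<le> 1 \<Longrightarrow> cmod (s z * a z) \<le> (1 / \<beta> + 1 / (1 - \<beta>)) * cmod (a z) powr \<beta>"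
proof -
  obtain l m where lm: "0 < l" "l < m" "norm (integral {l..m} f - integral {0<..} f) < e / 2"
    using integral_half_line_approx[OF f, of "e / 2"] e by auto
  have "continuous_on {l..m} f"
    unfolding f_def using lm
    by (intro continuous_intros bounded_bilinear.continuous_on[OF bounded_bilinear_blinfun_compose]
        continuous_on_subset[OF continuous_on_V]) auto
  then obtain p :: nat where p: "p \<ge> 1"
    "norm ((\<Sum>i=1..p. ((m - l) / p) *\<^sub>R f (l + real i * ((m - l) / p))) - integral {l..m} f) \<le> e / 4"
    using right_Riemann_sum_approx[of l m f "e / 4"] lm e by auto
  define d where "d = (m - l) / p"
  define t where "t = (\<lambda>i::nat. l + i * d)"
  have d: "0 < d" using p lm by (simp add: d_def)
  have t: "l \<le> t i" "0 < t i" for i using d lm by (auto simp: t_def add_pos_nonneg)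
  define c where "c = (\<lambda>i. d * t i powr (\<beta> - 1))"
  define s where "s = (\<lambda>z. \<Sum>i=1..p. of_real (c i) * (1 / (of_real (t i) + a z)))"
  define S where "S = (\<Sum>i=1..p. of_real (c i) *\<^sub>C V (t i))"
  \<comment> \<open>All nodes are at least \<open>l\<close>, so no pole enters the ball of radius
    \<open>1 + l\<close>.\<close>
  have cs: "calculus (ball 0 (1 + l)) s S"
    unfolding s_def S_def using t by (intro calculus_sum calculus_scale calculus_V) auto
  have "S o\<^sub>L A = (\<Sum>i=1..p. d *\<^sub>R f (t i))"
    by (simp add: S_def f_def c_def blinfun_compose.sum_left scaleC_of_real
        blinfun_compose.scaleR_left del: of_real_mult)
  then have "norm ((S o\<^sub>L A) - integral {l..m} f) \<le> e / 4"
    using p(2) by (simp add: d_def t_def)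
  then have "norm (((S o\<^sub>L A) - integral {l..m} f) + (integral {l..m} f - integral {0<..} f)) < e"
    using lm(3) e by (intro le_less_trans[OF norm_triangle_ineq]) auto
  then have "norm ((S o\<^sub>L A) - integral {0<..} f) < e" by simp
  moreover have "cmod (s z * a z) \<le> (1 / \<beta> + 1 / (1 - \<beta>)) * cmod (a z) powr \<beta>" if z: "cmod z \<le> 1" for z
  proof -
    have "cmod (s z * a z) = cmod (\<Sum>i=1..p. of_real (c i) * (a z / (of_real (t i) + a z)))"
      by (simp add: s_def sum_distrib_right)
    also have "\<dots> \<le> (\<Sum>i=1..p. c i * min 1 (cmod (a z) / t i))"
    proof (rule sum_norm_le)
      fix i
      have "0 \<le> c i" using d by (simp add: c_def)
      then show "cmod (of_real (c i) * (a z / (of_real (t i) + a z))) \<le> c i * min 1 (cmod (a z) / t i)"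
        unfolding norm_mult using a_bounds[OF z t(2)] by (intro mult_mono) auto
    qed
    also have "\<dots> \<le> (1 / \<beta> + 1 / (1 - \<beta>)) * cmod (a z) powr \<beta>"
      unfolding c_def t_def using \<beta> lm d by (intro balakrishnan_sum_bound) auto
    finally show ?thesis .
  qed
  ultimately show ?thesis using that[of "1 + l" s S] cs lm by auto
qed

text \<open>
  When the Balakrishnan integral diverges (it does not, but its convergence is not needed), the
  library's \<open>integral\<close> is 0, and so is \<open>frac_power A \<alpha>\<close>.
\<close>

lemma frac_power_approx:
  assumes \<alpha>: "0 < \<alpha>" and nz: "frac_power A \<alpha> \<noteq> 0"
  shows "\<exists>C\<ge>0. \<forall>e>0. \<exists>b q Q g. 1 < b \<and> b \<le> 2 \<and> calculus (ball 0 b) q Q \<and>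
      norm (Q - frac_power A \<alpha>) < e \<and> (\<forall>z. cmod z \<le> 1 \<longrightarrow> cmod (q z) \<le> C * cmod (\<xi> j - z) powr \<alpha>) \<and>
      g holomorphic_on ball 0 b \<and> (\<forall>z. q z = (\<xi> j - z)\<^sup>2 * g z)"
proof -
  define n where "n = nat \<lfloor>\<alpha>\<rfloor>"
  define \<beta> where "\<beta> = frac \<alpha>"
  have n: "real n = of_int \<lfloor>\<alpha>\<rfloor>" using \<alpha> by (simp add: n_def)
  have \<alpha>n: "\<alpha> = n + \<beta>" by (simp add: n \<beta>_def frac_def)
  \<comment> \<open>An intermediate form with one zero, supplied by the factor \<open>A\<close>
    split off on the right. \<open>C\<close> is chosen before \<open>e\<close>.\<close>
  have "\<exists>C\<ge>0. \<forall>e>0. \<exists>b s S. 1 < b \<and> calculus (ball 0 b) s S \<and> norm ((S o\<^sub>L A) - frac_power A \<alpha>) < e \<and>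
      (\<forall>z. cmod z \<le> 1 \<longrightarrow> cmod (s z * a z) \<le> C * cmod (a z) powr \<alpha>)"
  proof (cases "\<beta> = 0")
    case True
    \<comment> \<open>An integer exponent is at least 1, so one factor \<open>A\<close> can be split
      off, and the approximation is exact.\<close>
    then have n0: "n \<noteq> 0" using \<alpha> \<alpha>n by auto
    have comm: "op_power A k o\<^sub>L A = A o\<^sub>L op_power A k" for k
      by (induction k) (simp_all add: compose_assoc)
    obtain k where k: "n = Suc k" using n0 not0_implies_Suc by blast
    have "calculus (ball 0 2) (\<lambda>z. a z ^ k) (op_power A k)" by (intro calculus_op_power calculus_A)
    moreover have "op_power A k o\<^sub>L A = frac_power A \<alpha>"
      using True comm[of k] by (simp add: frac_power_def n_def[symmetric] \<beta>_def k)
    moreover have "cmod (a z ^ k * a z) \<le> 1 * cmod (a z) powr \<alpha>" for z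
      using True \<alpha>n k powr_realpow[of "cmod (a z)" "Suc k"]
      by (cases "a z = 0") (auto simp: norm_mult norm_power mult.commute)
    ultimately show ?thesis
      by (intro exI[of _ 1] conjI allI impI exI[of _ 2] exI[of _ "\<lambda>z. a z ^ k"] exI[of _ "op_power A k"]) auto
  next
    case False
    then have \<beta>: "0 < \<beta>" "\<beta> < 1" by (auto simp: \<beta>_def frac_lt_1 frac_gt_0_iff frac_eq_0_iff)
    define f where "f = (\<lambda>t::real. t powr (\<beta> - 1) *\<^sub>R (V t o\<^sub>L A))"
    define c where "c = sin (pi * \<beta>) / pi"
    have fp: "frac_power A \<alpha> = op_power A n o\<^sub>L (c *\<^sub>R integral {0<..} f)"
      using False by (simp add: frac_power_def n_def \<beta>_def c_def f_def V_def)
    have f: "f integrable_on {0<..}"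
      using nz not_integrable_integral[of f] unfolding fp by fastforce
    define K where "K = norm (op_power A n) * \<bar>c\<bar> + 1"
    have K: "0 < K" by (simp add: K_def add_nonneg_pos)
    show ?thesis
    proof (rule exI[of _ "\<bar>c\<bar> * (1 / \<beta> + 1 / (1 - \<beta>))"], intro conjI allI impI)
      show "0 \<le> \<bar>c\<bar> * (1 / \<beta> + 1 / (1 - \<beta>))" using \<beta> by simp
      fix e :: real assume e: "0 < e"
      obtain b s S where s: "1 < b" "calculus (ball 0 b) s S" "norm ((S o\<^sub>L A) - integral {0<..} f) < e / K"
        "\<And>z. cmod z \<le> 1 \<Longrightarrow> cmod (s z * a z) \<le> (1 / \<beta> + 1 / (1 - \<beta>)) * cmod (a z) powr \<beta>"
        using balakrishnan_sum_approx[OF \<beta> f[unfolded f_def], of "e / K"] e K unfolding f_def by auto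
      define s' where "s' = (\<lambda>z. a z ^ n * (of_real c * s z))"
      define S' where "S' = op_power A n o\<^sub>L (of_real c *\<^sub>C S)"
      have "calculus (ball 0 b) s' S'"
        unfolding s'_def S'_def by (intro calculus_mult calculus_op_power calculus_A calculus_scale s)
      moreover have "norm ((S' o\<^sub>L A) - frac_power A \<alpha>) < e"
      proof -
        have "(S' o\<^sub>L A) - frac_power A \<alpha> = op_power A n o\<^sub>L (c *\<^sub>R ((S o\<^sub>L A) - integral {0<..} f))"
          unfolding fp by (simp add: S'_def compose_assoc scaleC_of_real blinfun_compose.diff_right scaleR_diff_right blinfun_compose.scaleR_left)
        also have "norm \<dots> \<le> norm (op_power A n) * (\<bar>c\<bar> * norm ((S o\<^sub>L A) - integral {0<..} f))"
          by (intro order_trans[OF norm_blinfun_compose]) simp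
        also have "\<dots> \<le> K * norm ((S o\<^sub>L A) - integral {0<..} f)"
          by (simp add: K_def distrib_right mult.assoc)
        also have "\<dots> < e" using s(3) K by (simp add: pos_less_divide_eq mult.commute)
        finally show ?thesis .
      qed
      moreover have "cmod (s' z * a z) \<le> \<bar>c\<bar> * (1 / \<beta> + 1 / (1 - \<beta>)) * cmod (a z) powr \<alpha>" if "cmod z \<le> 1" for z
      proof -
        have "cmod (s' z * a z) = cmod (a z) ^ n * \<bar>c\<bar> * cmod (s z * a z)"
          by (simp add: s'_def norm_mult norm_power)
        also have "\<dots> \<le> cmod (a z) ^ n * \<bar>c\<bar> * ((1 / \<beta> + 1 / (1 - \<beta>)) * cmod (a z) powr \<beta>)"
          by (intro mult_left_mono s that) auto
        also have "\<dots> = \<bar>c\<bar> * (1 / \<beta> + 1 / (1 - \<beta>)) * (cmod (a z) ^ n * cmod (a z) powr \<beta>)" by (simp only: mult_ac)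
        also have "cmod (a z) ^ n * cmod (a z) powr \<beta> = cmod (a z) powr \<alpha>"
          using \<beta> by (cases "a z = 0") (simp_all add: \<alpha>n powr_add powr_realpow)
        finally show ?thesis .
      qed
      ultimately show "\<exists>b s S. 1 < b \<and> calculus (ball 0 b) s S \<and> norm ((S o\<^sub>L A) - frac_power A \<alpha>) < e \<and>
         (\<forall>z. cmod z \<le> 1 \<longrightarrow> cmod (s z * a z) \<le> \<bar>c\<bar> * (1 / \<beta> + 1 / (1 - \<beta>)) * cmod (a z) powr \<alpha>)"
        using s(1) by blast
    qed
  qed
  then obtain C where C: "0 \<le> C" "\<And>e. 0 < e \<Longrightarrow> \<exists>b s S. 1 < b \<and> calculus (ball 0 b) s S \<and>
      norm ((S o\<^sub>L A) - frac_power A \<alpha>) < e \<and> (\<forall>z. cmod z \<le> 1 \<longrightarrow> cmod (s z * a z) \<le> C * cmod (a z) powr \<alpha>)"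
    by blast
  show ?thesis
  proof (rule exI[of _ C], intro conjI allI impI, rule C(1))
    fix e :: real assume e: "0 < e"
    then obtain b s S where s: "1 < b" "calculus (ball 0 b) s S" "norm ((S o\<^sub>L A) - frac_power A \<alpha>) < e / 2"
        "\<And>z. cmod z \<le> 1 \<Longrightarrow> cmod (s z * a z) \<le> C * cmod (a z) powr \<alpha>"
      using C(2)[of "e / 2"] by auto
    obtain b' q Q g where q: "1 < b'" "b' \<le> 2" "calculus (ball 0 b') q Q" "norm (Q - (S o\<^sub>L A)) < e / 2"
      "\<forall>z. cmod z \<le> 1 \<longrightarrow> cmod (q z) \<le> cmod (s z * a z)"
      "g holomorphic_on ball 0 b'" "\<forall>z. q z = (\<xi> j - z)\<^sup>2 * g z"
      by (rule double_zero_approx[OF s(1,2) half_gt_zero[OF e]])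
    have "norm ((Q - (S o\<^sub>L A)) + ((S o\<^sub>L A) - frac_power A \<alpha>)) < e"
      using q(4) s(3) by (intro norm_triangle_lt) simp
    moreover have "cmod (q z) \<le> C * cmod (\<xi> j - z) powr \<alpha>" if "cmod z \<le> 1" for z
      using order_trans[OF q(5)[rule_format, OF that] s(4)[OF that]] by (simp add: cmod_a)
    ultimately show "\<exists>b q Q g. 1 < b \<and> b \<le> 2 \<and> calculus (ball 0 b) q Q \<and>
      norm (Q - frac_power A \<alpha>) < e \<and> (\<forall>z. cmod z \<le> 1 \<longrightarrow> cmod (q z) \<le> C * cmod (\<xi> j - z) powr \<alpha>) \<and>
      g holomorphic_on ball 0 b \<and> (\<forall>z. q z = (\<xi> j - z)\<^sup>2 * g z)"
      using q(1,2,3,6,7) by (intro exI[of _ b'] exI[of _ q] exI[of _ Q] exI[of _ g]) simp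
  qed
qed

end

end

subsection \<open>Rademacher averages\<close>

locale rademacher =
  fixes M :: "'w measure" and \<epsilon> :: "nat \<Rightarrow> 'w \<Rightarrow> real"
  assumes rad: "rademacher_seq M \<epsilon>"
begin

sublocale prob_space M
  using rad by (simp add: rademacher_seq_def)

lemma indep: "indep_vars (\<lambda>_. borel) \<epsilon> {1..}"
  using rad by (simp add: rademacher_seq_def)

lemma measurable_\<epsilon>: "1 \<le> k \<Longrightarrow> \<epsilon> k \<in> borel_measurable M"
  using indep by (auto simp: indep_vars_def)

lemma prob_\<epsilon>: "1 \<le> k \<Longrightarrow> prob {u \<in> space M. \<epsilon> k u = 1} = 1/2" "1 \<le> k \<Longrightarrow> prob {u \<in> space M. \<epsilon> k u = -1} = 1/2"
  using rad by (simp_all add: rademacher_seq_def)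

lemma AE_\<epsilon>:
  assumes k: "1 \<le> k"
  shows "AE u in M. \<epsilon> k u = 1 \<or> \<epsilon> k u = -1"
proof -
  note [measurable] = measurable_\<epsilon>[OF k]
  have "prob ({u \<in> space M. \<epsilon> k u = 1} \<union> {u \<in> space M. \<epsilon> k u = -1})
      = prob {u \<in> space M. \<epsilon> k u = 1} + prob {u \<in> space M. \<epsilon> k u = -1}"
    by (rule finite_measure_Union) auto
  then have "prob ({u \<in> space M. \<epsilon> k u = 1} \<union> {u \<in> space M. \<epsilon> k u = -1}) = 1"
    using prob_\<epsilon>[OF k] by simp
  then have "AE u in M. u \<in> {u \<in> space M. \<epsilon> k u = 1} \<union> {u \<in> space M. \<epsilon> k u = -1}"
    by (intro AE_prob_1) auto
  then show ?thesis by (rule AE_mp) (rule AE_I2, auto)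
qed

text \<open>The space may be non-separable, so the sum is not treated as a sum of measurable
  vector-valued functions. Its norm is a continuous function of the sequence of signs, which takes
  values in a product of real lines. The summand \<open>y\<close> is for a term whose sign has been
  frozen.\<close>

lemma measurable_rademacher_sum:
  fixes x :: "nat \<Rightarrow> 'a::real_normed_vector"
  shows "(\<lambda>u. (norm ((\<Sum>k=1..n. \<epsilon> k u *\<^sub>R x k) + y))\<^sup>2) \<in> borel_measurable M"
proof -
  \<comment> \<open>Measurability of the variable of index 0 is not assumed, so it is replaced by
    0.\<close>
  define e where "e = (\<lambda>u k. if 1 \<le> k then \<epsilon> k u else 0)"
  have "e \<in> M \<rightarrow>\<^sub>M borel"
  proof (rule measurable_coordinatewise_then_product)
    show "(\<lambda>u. e u i) \<in> borel_measurable M" for i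
      by (cases "1 \<le> i") (simp_all add: e_def measurable_\<epsilon>)
  qed
  moreover have "(\<lambda>c :: nat \<Rightarrow> real. (norm ((\<Sum>k=1..n. c k *\<^sub>R x k) + y))\<^sup>2) \<in> borel_measurable borel"
    by (intro borel_measurable_continuous_onI continuous_intros continuous_on_product_coordinates)
  ultimately have "(\<lambda>u. (norm ((\<Sum>k=1..n. e u k *\<^sub>R x k) + y))\<^sup>2) \<in> borel_measurable M"
    by (rule measurable_compose)
  then show ?thesis by (simp add: e_def)
qed

lemma rademacher_sum_bounded:
  fixes x :: "nat \<Rightarrow> 'a::real_normed_vector"
  shows "AE u in M. (norm ((\<Sum>k=1..n. \<epsilon> k u *\<^sub>R x k) + y))\<^sup>2 \<le> ((\<Sum>k=1..n. norm (x k)) + norm y)\<^sup>2"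
proof -
  have "AE u in M. \<forall>k\<in>{1..n}. \<epsilon> k u = 1 \<or> \<epsilon> k u = -1"
    by (rule AE_finite_allI) (auto intro: AE_\<epsilon>)
  then show ?thesis
  proof (rule AE_mp, intro AE_I2 impI power_mono)
    fix u assume u: "\<forall>k\<in>{1..n}. \<epsilon> k u = 1 \<or> \<epsilon> k u = -1"
    have "norm (\<Sum>k=1..n. \<epsilon> k u *\<^sub>R x k) \<le> (\<Sum>k=1..n. norm (x k))"
    proof (rule sum_norm_le)
      fix k assume "k \<in> {1..n}"
      then have "\<epsilon> k u = 1 \<or> \<epsilon> k u = -1" using u by blast
      then have "\<bar>\<epsilon> k u\<bar> = 1" by auto
      then show "norm (\<epsilon> k u *\<^sub>R x k) \<le> norm (x k)" by simp
    qed
    then show "norm ((\<Sum>k=1..n. \<epsilon> k u *\<^sub>R x k) + y) \<le> (\<Sum>k=1..n. norm (x k)) + norm y"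
      by (intro order_trans[OF norm_triangle_ineq]) simp
  qed simp
qed

lemma integrable_rademacher_sum:
  fixes x :: "nat \<Rightarrow> 'a::real_normed_vector"
  shows "integrable M (\<lambda>u. (norm ((\<Sum>k=1..n. \<epsilon> k u *\<^sub>R x k) + y))\<^sup>2)"
  by (rule integrable_const_bound[OF _ measurable_rademacher_sum])
    (use rademacher_sum_bounded[where n = n and x = x and y = y] in simp)

text \<open>Dominated convergence: the signs are bounded almost surely, and each of the
  \<open>n\<close> convergent sequences is bounded.\<close>

lemma Rad_norm_tendsto:
  fixes x :: "nat \<Rightarrow> 'a::real_normed_vector"
  assumes X: "\<And>k. k \<in> {1..n} \<Longrightarrow> (\<lambda>m. X m k) \<longlonglongrightarrow> x k"
  shows "(\<lambda>m. Rad_norm M \<epsilon> n (X m)) \<longlonglongrightarrow> Rad_norm M \<epsilon> n x"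
proof -
  have "\<exists>B. \<forall>m. norm (X m k) \<le> B" if "k \<in> {1..n}" for k
    using convergent_imp_Bseq[OF convergentI[OF X[OF that]]] by (auto elim!: BseqE)
  then obtain B where B: "\<And>k m. k \<in> {1..n} \<Longrightarrow> norm (X m k) \<le> B k" by metis
  have "(\<lambda>m. \<integral>u. (norm (\<Sum>k=1..n. \<epsilon> k u *\<^sub>R X m k))\<^sup>2 \<partial>M) \<longlonglongrightarrow> (\<integral>u. (norm (\<Sum>k=1..n. \<epsilon> k u *\<^sub>R x k))\<^sup>2 \<partial>M)"
  proof (rule integral_dominated_convergence)
    show "integrable M (\<lambda>_. (\<Sum>k=1..n. B k)\<^sup>2)" by simp
    show "AE u in M. (\<lambda>m. (norm (\<Sum>k=1..n. \<epsilon> k u *\<^sub>R X m k))\<^sup>2) \<longlonglongrightarrow> (norm (\<Sum>k=1..n. \<epsilon> k u *\<^sub>R x k))\<^sup>2"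
      by (intro AE_I2 tendsto_intros X)
    fix m
    have "(\<Sum>k=1..n. norm (X m k)) \<le> (\<Sum>k=1..n. B k)" by (intro sum_mono B)
    then have le: "(\<Sum>k=1..n. norm (X m k))\<^sup>2 \<le> (\<Sum>k=1..n. B k)\<^sup>2" by (intro power_mono sum_nonneg) auto
    show "AE u in M. norm ((norm (\<Sum>k=1..n. \<epsilon> k u *\<^sub>R X m k))\<^sup>2) \<le> (\<Sum>k=1..n. B k)\<^sup>2"
      using rademacher_sum_bounded[where n = n and x = "X m" and y = 0] by (rule AE_mp) (rule AE_I2, use le in auto)
  qed (use measurable_rademacher_sum[where n = n and y = 0] in auto)
  then show ?thesis unfolding Rad_norm_def by (rule tendsto_real_sqrt)
qed

text \<open>Condition on the last sign and use convexity of the squared norm.\<close>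

lemma Rad_norm_mono_Suc:
  fixes x :: "nat \<Rightarrow> 'a::real_normed_vector"
  shows "Rad_norm M \<epsilon> n x \<le> Rad_norm M \<epsilon> (Suc n) x"
proof -
  define S where "S = (\<lambda>u. \<Sum>k=1..n. \<epsilon> k u *\<^sub>R x k)"
  define F where "F = (\<lambda>s u. (norm (S u + s *\<^sub>R x (Suc n)))\<^sup>2)"
  note [measurable] = measurable_\<epsilon>[of "Suc n", simplified]
  have Fm [measurable]: "F s \<in> borel_measurable M" and Fi: "integrable M (F s)" for s
    unfolding F_def S_def by (rule measurable_rademacher_sum integrable_rademacher_sum)+
  have half: "(\<integral>u. F s u * indicator {s} (\<epsilon> (Suc n) u) \<partial>M) = (\<integral>u. F s u \<partial>M) * (1/2)"
    and int: "integrable M (\<lambda>u. F s u * indicator {s} (\<epsilon> (Suc n) u))"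
    if s: "s = 1 \<or> s = -1" for s
  proof -
    \<comment> \<open>With the last sign frozen at \<open>s\<close>, the squared norm is a function
      of the first \<open>n\<close> signs, hence independent of the last one.\<close>
    define G where "G = (\<lambda>c :: nat \<Rightarrow> real. (norm ((\<Sum>k=1..n. c k *\<^sub>R x k) + s *\<^sub>R x (Suc n)))\<^sup>2)"
    have ind: "indep_var (PiM {1..n} (\<lambda>_. borel)) (\<lambda>u. restrict (\<lambda>k. \<epsilon> k u) {1..n})
       (PiM {Suc n} (\<lambda>_. borel)) (\<lambda>u. restrict (\<lambda>k. \<epsilon> k u) {Suc n})"
      by (rule indep_var_restrict[OF indep]) auto
    have Gm: "G \<in> borel_measurable (PiM {1..n} (\<lambda>_. borel))"
    proof -
      define e where "e = (\<lambda>c k. if k \<in> {1..n} then c k else 0 :: real)"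
      have "e \<in> PiM {1..n} (\<lambda>_. borel) \<rightarrow>\<^sub>M borel"
      proof (rule measurable_coordinatewise_then_product)
        show "(\<lambda>c. e c i) \<in> borel_measurable (PiM {1..n} (\<lambda>_. borel))" for i
        proof (cases "i \<in> {1..n}")
          case True
          then have "(\<lambda>c. e c i) = (\<lambda>c. c i)" by (simp add: e_def)
          then show ?thesis using measurable_component_singleton[OF True] by simp
        next
          case False
          then have "(\<lambda>c. e c i) = (\<lambda>_. 0)" by (auto simp: e_def)
          then show ?thesis by simp
        qed
      qed
      moreover have "G \<in> borel_measurable borel"
        unfolding G_def by (intro borel_measurable_continuous_onI continuous_intros continuous_on_product_coordinates)
      ultimately have "(\<lambda>c. G (e c)) \<in> borel_measurable (PiM {1..n} (\<lambda>_. borel))"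
        by (rule measurable_compose)
      moreover have "G (e c) = G c" for c by (simp add: G_def e_def)
      ultimately show ?thesis by simp
    qed
    have "indep_var borel (G \<circ> (\<lambda>u. restrict (\<lambda>k. \<epsilon> k u) {1..n}))
        borel ((\<lambda>c. indicator {s} (c (Suc n))) \<circ> (\<lambda>u. restrict (\<lambda>k. \<epsilon> k u) {Suc n}))"
      by (rule indep_var_compose[OF ind Gm]) measurable
    moreover have "G \<circ> (\<lambda>u. restrict (\<lambda>k. \<epsilon> k u) {1..n}) = F s"
      by (auto simp: G_def F_def S_def fun_eq_iff)
    moreover have "(\<lambda>c. indicator {s} (c (Suc n))) \<circ> (\<lambda>u. restrict (\<lambda>k. \<epsilon> k u) {Suc n}) = (\<lambda>u. indicator {s} (\<epsilon> (Suc n) u) :: real)"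
      by (auto simp: fun_eq_iff)
    ultimately have iv: "indep_var borel (F s) borel (\<lambda>u. indicator {s} (\<epsilon> (Suc n) u) :: real)" by simp
    have ii: "integrable M (\<lambda>u. indicator {s} (\<epsilon> (Suc n) u) :: real)"
      by (rule integrable_const_bound[of _ 1]) (auto simp: indicator_def)
    have "(\<integral>u. indicator {s} (\<epsilon> (Suc n) u) \<partial>M) = (\<integral>u. indicator {u \<in> space M. \<epsilon> (Suc n) u = s} u \<partial>M)"
      by (rule Bochner_Integration.integral_cong) (auto simp: indicator_def)
    also have "\<dots> = prob {u \<in> space M. \<epsilon> (Suc n) u = s}" by simp
    also have "\<dots> = 1/2" using prob_\<epsilon>[of "Suc n"] s by auto
    finally show "(\<integral>u. F s u * indicator {s} (\<epsilon> (Suc n) u) \<partial>M) = (\<integral>u. F s u \<partial>M) * (1/2)"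
      using indep_var_lebesgue_integral[OF iv Fi ii] by simp
    show "integrable M (\<lambda>u. F s u * indicator {s} (\<epsilon> (Suc n) u))"
      by (rule indep_var_integrable[OF iv Fi ii])
  qed
  have F0: "(\<integral>u. (norm (S u))\<^sup>2 \<partial>M) \<le> (\<integral>u. (F 1 u + F (-1) u) / 2 \<partial>M)"
  proof (rule integral_mono)
    show "integrable M (\<lambda>u. (norm (S u))\<^sup>2)" using Fi[of 0] by (simp add: F_def)
    show "integrable M (\<lambda>u. (F 1 u + F (-1) u) / 2)" using Fi by simp
    fix u
    \<comment> \<open>\<open>S u\<close> is the midpoint of \<open>S u + x (Suc n)\<close> and
      \<open>S u - x (Suc n)\<close>.\<close>
    have "norm (2 *\<^sub>R S u) \<le> norm (S u + x (Suc n)) + norm (S u - x (Suc n))"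
      using norm_triangle_ineq[of "S u + x (Suc n)" "S u - x (Suc n)"] by (simp add: scaleR_2)
    then have "2 * norm (S u) \<le> norm (S u + x (Suc n)) + norm (S u - x (Suc n))" by simp
    then have "(2 * norm (S u))\<^sup>2 \<le> (norm (S u + x (Suc n)) + norm (S u - x (Suc n)))\<^sup>2"
      by (intro power_mono) auto
    also have "\<dots> \<le> 2 * ((norm (S u + x (Suc n)))\<^sup>2 + (norm (S u - x (Suc n)))\<^sup>2)"
      using sum_squares_bound[of "norm (S u + x (Suc n))" "norm (S u - x (Suc n))"] by (simp add: power2_sum)
    finally show "(norm (S u))\<^sup>2 \<le> (F 1 u + F (-1) u) / 2"
      by (simp add: F_def power_mult_distrib)
  qed
  also have "\<dots> = (\<integral>u. F 1 u * indicator {1} (\<epsilon> (Suc n) u) \<partial>M) + (\<integral>u. F (-1) u * indicator {-1} (\<epsilon> (Suc n) u) \<partial>M)"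
    using half[of 1] half[of "-1"] Fi by simp
  also have "\<dots> = (\<integral>u. F 1 u * indicator {1} (\<epsilon> (Suc n) u) + F (-1) u * indicator {-1} (\<epsilon> (Suc n) u) \<partial>M)"
    using int by simp
  also have "\<dots> = (\<integral>u. F (\<epsilon> (Suc n) u) u \<partial>M)"
  proof (rule integral_cong_AE)
    show "AE u in M. F 1 u * indicator {1} (\<epsilon> (Suc n) u) + F (-1) u * indicator {-1} (\<epsilon> (Suc n) u) = F (\<epsilon> (Suc n) u) u"
      using AE_\<epsilon>[of "Suc n", simplified] by (rule AE_mp) (rule AE_I2, auto)
    show "(\<lambda>u. F (\<epsilon> (Suc n) u) u) \<in> borel_measurable M"
      using measurable_rademacher_sum[where n = "Suc n" and x = x and y = 0] by (simp add: F_def S_def)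
  qed measurable
  finally show ?thesis
    unfolding Rad_norm_def by (intro real_sqrt_le_mono) (simp add: F_def S_def)
qed

text \<open>\<open>lim\<close> says something only about a convergent sequence; monotonicity in
  \<open>n\<close> together with the bound provides the convergence.\<close>

lemma lim_Rad_norm_le:
  fixes x :: "nat \<Rightarrow> 'a::real_normed_vector"
  assumes "\<And>n. Rad_norm M \<epsilon> n x \<le> C"
  shows "lim (\<lambda>n. ennreal (Rad_norm M \<epsilon> n x)) \<le> ennreal C"
proof -
  have "incseq (\<lambda>n. Rad_norm M \<epsilon> n x)"
    by (rule incseq_SucI) (rule Rad_norm_mono_Suc)
  then obtain L where L: "(\<lambda>n. Rad_norm M \<epsilon> n x) \<longlonglongrightarrow> L" "\<And>n. Rad_norm M \<epsilon> n x \<le> L"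
    using incseq_convergent[of "\<lambda>n. Rad_norm M \<epsilon> n x" C] assms by blast
  have "(\<lambda>n. ennreal (Rad_norm M \<epsilon> n x)) \<longlonglongrightarrow> ennreal L"
    using L by (intro tendsto_ennrealI)
  then have "lim (\<lambda>n. ennreal (Rad_norm M \<epsilon> n x)) = ennreal L" by (rule limI)
  moreover have "L \<le> C" by (rule LIMSEQ_le_const2[OF L(1)]) (use assms in auto)
  ultimately show ?thesis by (simp add: ennreal_leI)
qed

end

subsection \<open>Square function estimates\<close>

text \<open>Up to a bounded factor, the quotient of the two sides is a term of a sequence converging
  to \<open>Gamma a\<close>, hence bounded. The right side is made of the coefficients of the
  binomial series of \<open>(1 - x) powr (- a)\<close>.\<close>

lemma powr_le_pochhammer:
  fixes a :: real
  assumes a: "0 < a"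
  obtains B where "0 \<le> B" "\<And>k. 1 \<le> k \<Longrightarrow> real k powr (a - 1) \<le> B * (pochhammer a (k - 1) / fact (k - 1))"
proof -
  have "Bseq (Gamma_series' a)"
    using Gamma_series'_LIMSEQ convergentI convergent_imp_Bseq by blast
  then obtain B where B: "0 < B" "\<And>n. norm (Gamma_series' a n) \<le> B" by (auto elim: BseqE)
  have "real k powr (a - 1) \<le> B * (a + 1) * (pochhammer a (k - 1) / fact (k - 1))" if k: "1 \<le> k" for k
  proof -
    obtain n where n: "k = Suc n" using k by (cases k) auto
    have pn: "0 < pochhammer a n" using a by (rule pochhammer_pos)
    have "Gamma_series' a k = fact n * k powr a / (pochhammer a n * (a + n))"
      using n by (simp add: Gamma_series'_def powr_def pochhammer_Suc)
    moreover have "Gamma_series' a k \<le> B" using B(2)[of k] unfolding real_norm_def by (rule order_trans[OF abs_ge_self])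
    ultimately have "fact n * k powr a / (pochhammer a n * (a + n)) \<le> B" by (simp only:)
    then have "fact n * k powr a \<le> B * (pochhammer a n * (a + n))"
      using pn a by (simp add: pos_divide_le_eq)
    \<comment> \<open>\<open>a + n \<le> (a + 1) * k\<close>, as \<open>k = n + 1\<close>.\<close>
    also have "\<dots> \<le> B * (pochhammer a n * ((a + 1) * k))"
      using pn a B n by (intro mult_left_mono) (auto simp: algebra_simps)
    finally have "fact n * (k powr a / k) \<le> B * (a + 1) * pochhammer a n"
      using k by (simp add: field_simps)
    then show ?thesis using k n by (simp add: powr_diff field_simps)
  qed
  moreover have "0 \<le> B * (a + 1)" using B a by simp
  ultimately show ?thesis using that by blast
qed

lemma powr_power_series_bound:
  fixes a :: real
  assumes a: "0 < a"
  obtains B where "0 \<le> B" "\<And>x n. 0 \<le> x \<Longrightarrow> x < 1 \<Longrightarrow> (\<Sum>k=1..n. real k powr (a - 1) * x ^ (k - 1)) \<le> B * (1 - x) powr (- a)"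
proof -
  obtain B where B: "0 \<le> B" "\<And>k. 1 \<le> k \<Longrightarrow> real k powr (a - 1) \<le> B * (pochhammer a (k - 1) / fact (k - 1))"
    using powr_le_pochhammer[OF a] by blast
  have "(\<Sum>k=1..n. real k powr (a - 1) * x ^ (k - 1)) \<le> B * (1 - x) powr (- a)" if x: "0 \<le> x" "x < 1" for x n
  proof -
    define c where "c = (\<lambda>k. pochhammer a k / fact k * x ^ k)"
    \<comment> \<open>The signs of the generalized binomial coefficient and of
      \<open>(- x) ^ k\<close> cancel, so the comparison series has nonnegative terms.\<close>
    have "(- a gchoose k) * (- x) ^ k = c k" for k
    proof -
      have "(- 1) ^ k * (- 1) ^ k = (1::real)" by (simp flip: power_mult_distrib)
      moreover have "(- x) ^ k = (- 1) ^ k * x ^ k" by (rule power_minus)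
      ultimately show ?thesis by (simp add: gbinomial_pochhammer c_def)
    qed
    then have sums: "c sums (1 - x) powr (- a)" using gen_binomial_real[of "- x" "- a"] x by simp
    have c0: "0 \<le> c k" for k using a x by (simp add: c_def pochhammer_nonneg)
    have "(\<Sum>k=1..n. real k powr (a - 1) * x ^ (k - 1)) \<le> (\<Sum>k=1..n. B * c (k - 1))"
    proof (rule sum_mono)
      fix k assume "k \<in> {1..n}"
      then show "real k powr (a - 1) * x ^ (k - 1) \<le> B * c (k - 1)"
        using mult_right_mono[OF B(2)[of k], of "x ^ (k - 1)"] x by (simp add: c_def mult.assoc)
    qed
    also have "\<dots> = B * (\<Sum>k<n. c k)"
      unfolding sum_distrib_left by (rule sum.reindex_bij_witness[of _ Suc "\<lambda>k. k - 1"]) auto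
    also have "\<dots> \<le> B * suminf c"
      using sums c0 B(1) by (intro mult_left_mono sum_le_suminf) (auto simp: sums_iff)
    finally show ?thesis using sums by (simp add: sums_iff)
  qed
  then show ?thesis using that B(1) by blast
qed

lemma op_prod_eq_0: "j \<in> {1..n} \<Longrightarrow> A j = 0 \<Longrightarrow> op_prod A n = 0"
  by (induction n) (auto simp: le_Suc_eq)

lemma tendsto_op_prod:
  "(\<And>j. j \<in> {1..n} \<Longrightarrow> (\<lambda>m. Q m j) \<longlonglongrightarrow> A j) \<Longrightarrow> (\<lambda>m. op_prod (Q m) n) \<longlonglongrightarrow> op_prod A n"
  by (induction n) (auto intro!: bounded_bilinear.tendsto[OF bounded_bilinear_blinfun_compose])

section \<open>Uniform bound of the symbols on the domain\<close>

context E_geometry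
begin

text \<open>The Stolz estimate is spent on the one point whose drop contains \<open>z\<close>; every
  other factor is at most 2.\<close>

lemma prod_distance_le:
  assumes s: "r \<le> s" "s < 1" and z: "z \<in> E s"
  shows "(\<Prod>j=1..N. cmod (\<xi> j - z)) \<le> 2 ^ N * (2 / (1 - s)) * (1 - cmod z)"
proof -
  obtain i where i: "i \<in> {1..N}" "cmod (\<xi> i - z) \<le> 2 / (1 - s) * (1 - cmod z)"
    by (rule stolz_bound[OF s z])
  have z1: "cmod z < 1" using E_dom_subset_ball[OF s] z by auto
  have two: "cmod (\<xi> j - z) \<le> 2" if "j \<in> {1..N}" for j
    using norm_triangle_ineq4[of "\<xi> j" z] unit[OF that] z1 by simp
  have "(\<Prod>j=1..N. cmod (\<xi> j - z)) = cmod (\<xi> i - z) * (\<Prod>j\<in>{1..N} - {i}. cmod (\<xi> j - z))"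
    using i(1) by (intro prod.remove) auto
  also have "(\<Prod>j\<in>{1..N} - {i}. cmod (\<xi> j - z)) \<le> (\<Prod>j\<in>{1..N} - {i}. 2)"
    using two by (intro prod_mono) auto
  also have "\<dots> = 2 ^ (N - 1)" using i(1) by simp
  also have "\<dots> \<le> (2::real) ^ N" by (intro power_increasing) auto
  finally have "(\<Prod>j=1..N. cmod (\<xi> j - z)) \<le> cmod (\<xi> i - z) * 2 ^ N" by (simp add: mult_left_mono)
  also have "\<dots> \<le> 2 / (1 - s) * (1 - cmod z) * 2 ^ N" using i(2) by (intro mult_right_mono) auto
  finally show ?thesis by (simp only: mult_ac)
qed

lemma square_function_symbol_bound:
  assumes s: "r \<le> s" "s < 1" and \<alpha>: "0 < \<alpha>"
  shows "\<exists>D\<ge>0. \<forall>z\<in>E s. \<forall>n.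
    (\<Sum>l=1..n. (real l powr (\<alpha> - 1/2) * cmod z ^ (l - 1) * (\<Prod>j=1..N. cmod (\<xi> j - z) powr \<alpha>))\<^sup>2) \<le> D"
proof -
  obtain B where B: "0 \<le> B" "\<And>x n. 0 \<le> x \<Longrightarrow> x < 1 \<Longrightarrow>
      (\<Sum>k=1..n. real k powr (2 * \<alpha> - 1) * x ^ (k - 1)) \<le> B * (1 - x) powr (- (2 * \<alpha>))"
    using powr_power_series_bound[of "2 * \<alpha>"] \<alpha> by auto
  define c where "c = 2 ^ N * (2 / (1 - s))"
  have c: "0 < c" using s by (simp add: c_def)
  have "(\<Sum>l=1..n. (real l powr (\<alpha> - 1/2) * cmod z ^ (l - 1) * (\<Prod>j=1..N. cmod (\<xi> j - z) powr \<alpha>))\<^sup>2)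
      \<le> B * c powr (2 * \<alpha>)" if z: "z \<in> E s" for z n
  proof -
    define x where "x = (cmod z)\<^sup>2"
    define p where "p = (\<Prod>j=1..N. cmod (\<xi> j - z))"
    have z1: "cmod z < 1" using E_dom_subset_ball[OF s] z by auto
    have x: "0 \<le> x" "x < 1" using z1 by (auto simp: x_def power_less_one_iff abs_square_less_1)
    have p0: "0 \<le> p" by (simp add: p_def prod_nonneg)
    \<comment> \<open>Passing from \<open>1 - cmod z\<close> to \<open>1 - x\<close> makes the two
      powers with exponents \<open>2 * \<alpha>\<close> and \<open>- (2 * \<alpha>)\<close> cancel
      exactly.\<close>
    have "x \<le> cmod z" unfolding x_def power2_eq_square using z1 by (intro mult_left_le) auto
    then have "c * (1 - cmod z) \<le> c * (1 - x)" using c by (intro mult_left_mono) auto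
    then have px: "p \<le> c * (1 - x)"
      using prod_distance_le[OF s z] by (simp add: p_def c_def)
    have prodp: "(\<Prod>j=1..N. cmod (\<xi> j - z) powr \<alpha>) = p powr \<alpha>"
      unfolding p_def by (rule prod_powr_distrib[symmetric])
    have sq: "(y powr b)\<^sup>2 = y powr (2 * b)" for y b :: real
      by (simp add: power2_eq_square powr_add[symmetric])
    have "(real l powr (\<alpha> - 1/2) * cmod z ^ (l - 1) * p powr \<alpha>)\<^sup>2
        = real l powr (2 * \<alpha> - 1) * x ^ (l - 1) * p powr (2 * \<alpha>)" for l
      by (simp add: power_mult_distrib sq x_def power_mult[symmetric] mult.commute right_diff_distrib)
    then have "(\<Sum>l=1..n. (real l powr (\<alpha> - 1/2) * cmod z ^ (l - 1) * p powr \<alpha>)\<^sup>2)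
        = (\<Sum>l=1..n. real l powr (2 * \<alpha> - 1) * x ^ (l - 1)) * p powr (2 * \<alpha>)"
      by (simp add: sum_distrib_right)
    also have "\<dots> \<le> B * (1 - x) powr (- (2 * \<alpha>)) * (c * (1 - x)) powr (2 * \<alpha>)"
      using B x px p0 \<alpha> by (intro mult_mono powr_mono2) (auto intro!: sum_nonneg)
    also have "\<dots> = B * c powr (2 * \<alpha>) * ((1 - x) powr (- (2 * \<alpha>)) * (1 - x) powr (2 * \<alpha>))"
      using c x by (simp add: powr_mult)
    also have "(1 - x) powr (- (2 * \<alpha>)) * (1 - x) powr (2 * \<alpha>) = 1"
      using x by (simp add: powr_minus)
    finally show ?thesis unfolding prodp by simp
  qed
  moreover have "0 \<le> B * c powr (2 * \<alpha>)" using B by simp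
  ultimately show ?thesis by blast
qed

end

theorem proposition6p3:
  fixes T :: "'a::complex_banach \<Rightarrow>\<^sub>L 'a"
    and \<xi> :: "nat \<Rightarrow> complex" and N :: nat
    and M :: "'w measure" and \<epsilon> :: "nat \<Rightarrow> 'w \<Rightarrow> real"
    and r s \<alpha> :: real
  assumes "N \<ge> 1" and "inj_on \<xi> {1..N}" and "\<xi> ` {1..N} \<subseteq> sphere 0 1"
    and "rademacher_seq M \<epsilon>"
    and "r \<in> {0<..<1}" and "Ritt_E_type \<xi> N r T"
    and "s \<in> {r<..<1}" and "quadratic_Hinf_calculus M \<epsilon> \<xi> N r s T"
    and "\<alpha> > 0"
  shows "\<exists>C>0. \<forall>x. square_fun M \<epsilon> \<xi> N T \<alpha> x \<le> ennreal (C * norm x)"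
proof -
  have unit: "cmod (\<xi> j) = 1" if "j \<in> {1..N}" for j
    using assms(3) that by (auto simp: image_subset_iff)
  interpret Ritt_type \<xi> N r T
    by unfold_locales (use assms unit in \<open>simp_all add: Ritt_E_type_def Ritt_E_def\<close>)
  interpret rademacher M \<epsilon>
    using assms by unfold_locales
  have s: "r < s" "s < 1" using assms by auto
  define FP where "FP = (\<lambda>j. frac_power (id_blinfun - cnj (\<xi> j) *\<^sub>C T) \<alpha>)"
  define tgt where "tgt = (\<lambda>x k. (real k powr (\<alpha> - 1/2)) *\<^sub>R blinfun_apply (op_power T (k - 1) o\<^sub>L op_prod FP N) x)"
  have reduce: ?thesis if "C > 0" "\<And>n x. Rad_norm M \<epsilon> n (tgt x) \<le> C * norm x" for C
  proof -
    have "square_fun M \<epsilon> \<xi> N T \<alpha> x = lim (\<lambda>n. ennreal (Rad_norm M \<epsilon> n (tgt x)))" for x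
      by (simp add: square_fun_def tgt_def FP_def)
    then show ?thesis using that lim_Rad_norm_le by metis
  qed
  show ?thesis
  \<comment> \<open>If one fractional power is 0, so is the product, and the square function
    vanishes; otherwise \<open>frac_power_approx\<close> applies to every factor.\<close>
  proof (cases "\<exists>j\<in>{1..N}. FP j = 0")
    case True
    then have "op_prod FP N = 0" using op_prod_eq_0 by blast
    then have "tgt x = (\<lambda>k. 0)" for x by (simp add: tgt_def)
    then have "Rad_norm M \<epsilon> n (tgt x) \<le> 1 * norm x" for n x by (simp add: Rad_norm_def)
    then show ?thesis by (intro reduce[of 1]) auto
  next
    case False
    define P where "P = (\<lambda>j C e b q Q g. 1 < b \<and> b \<le> 2 \<and> calculus (ball 0 b) q Q \<and>
      norm (Q - FP j) < e \<and> (\<forall>z. cmod z \<le> 1 \<longrightarrow> cmod (q z) \<le> C * cmod (\<xi> j - z) powr \<alpha>) \<and>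
      g holomorphic_on ball 0 b \<and> (\<forall>z. q z = (\<xi> j - z)\<^sup>2 * g z))"
    have "\<exists>C\<ge>0. \<forall>e>0. \<exists>b q Q g. P j C e b q Q g" if j: "j \<in> {1..N}" for j
    proof -
      have "frac_power (id_blinfun - cnj (\<xi> j) *\<^sub>C T) \<alpha> \<noteq> 0" using False j by (auto simp: FP_def)
      from frac_power_approx[OF assms(2) j assms(9) this] show ?thesis unfolding FP_def P_def .
    qed
    then obtain C where C0: "\<And>j. j \<in> {1..N} \<Longrightarrow> 0 \<le> C j" and
      C: "\<And>j e. j \<in> {1..N} \<Longrightarrow> 0 < e \<Longrightarrow> \<exists>b q Q g. P j (C j) e b q Q g"
      by metis
    \<comment> \<open>The accuracy is \<open>1 / Suc m\<close>, while the constants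
      \<open>C j\<close> are the same for all \<open>m\<close>.\<close>
    have "\<forall>m. \<forall>j\<in>{1..N}. \<exists>b q Q g. P j (C j) (1 / Suc m) b q Q g"
      using C by simp
    then obtain b q Q g where P: "\<And>m j. j \<in> {1..N} \<Longrightarrow> P j (C j) (1 / Suc m) (b m j) (q m j) (Q m j) (g m j)"
      by metis
    note approx = P[unfolded P_def]
    have b1: "1 < b m j" and b2: "b m j \<le> 2" and cal_q: "calculus (ball 0 (b m j)) (q m j) (Q m j)"
      and Q_close: "norm (Q m j - FP j) < 1 / Suc m"
      and hol_g: "g m j holomorphic_on ball 0 (b m j)" if "j \<in> {1..N}" for m j
      using approx[OF that, of m] by blast+
    have q_le: "cmod (q m j z) \<le> C j * cmod (\<xi> j - z) powr \<alpha>" if "j \<in> {1..N}" "cmod z \<le> 1" for m j z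
      using approx[OF that(1), of m] that(2) by blast
    have q_eq: "q m j z = (\<xi> j - z)\<^sup>2 * g m j z" if "j \<in> {1..N}" for m j z
      using approx[OF that, of m] by blast
    define c where "c = (\<Prod>j=1..N. C j)"
    have c0: "0 \<le> c" unfolding c_def using C0 by (intro prod_nonneg) auto
    define \<phi> where "\<phi> = (\<lambda>m l z. of_real (real l powr (\<alpha> - 1/2)) * (z ^ (l - 1) * (\<Prod>j=1..N. q m j z)))"
    define \<Phi> where "\<Phi> = (\<lambda>m l. of_real (real l powr (\<alpha> - 1/2)) *\<^sub>C (op_power T (l - 1) o\<^sub>L op_prod (Q m) N))"
    have \<phi>_le: "cmod (\<phi> m l z) \<le> c * (real l powr (\<alpha> - 1/2) * cmod z ^ (l - 1) * (\<Prod>j=1..N. cmod (\<xi> j - z) powr \<alpha>))"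
      if z: "cmod z \<le> 1" for m l z
    proof -
      have "(\<Prod>j=1..N. cmod (q m j z)) \<le> (\<Prod>j=1..N. C j * cmod (\<xi> j - z) powr \<alpha>)"
        using q_le[OF _ z] by (intro prod_mono conjI norm_ge_zero)
      also have "\<dots> = c * (\<Prod>j=1..N. cmod (\<xi> j - z) powr \<alpha>)" by (simp add: prod.distrib c_def)
      finally have "real l powr (\<alpha> - 1/2) * cmod z ^ (l - 1) * (\<Prod>j=1..N. cmod (q m j z))
         \<le> real l powr (\<alpha> - 1/2) * cmod z ^ (l - 1) * (c * (\<Prod>j=1..N. cmod (\<xi> j - z) powr \<alpha>))"
        by (intro mult_left_mono) auto
      then show ?thesis by (simp add: \<phi>_def norm_mult norm_power prod_norm mult_ac)
    qed
    have disc: "cmod z \<le> 1" if "z \<in> E_dom \<xi> N s" for z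
      using E_dom_subset_ball[of s] s that by auto
    obtain bb where bb: "\<And>m. 1 < bb m" "\<And>m. bb m \<le> 2" "\<And>m j. j \<in> {1..N} \<Longrightarrow> bb m \<le> b m j"
    proof
      \<comment> \<open>One ball for all factors. Its radius may depend on \<open>m\<close>, since
        the poles may approach the circle, but it exceeds 1.\<close>
      define bb where "bb = (\<lambda>m. Min (b m ` {1..N}))"
      have ne: "b m ` {1..N} \<noteq> {}" for m using nonempty by auto
      show "1 < bb m" for m unfolding bb_def using ne b1 by (subst Min_gr_iff) auto
      show le: "bb m \<le> b m j" if "j \<in> {1..N}" for m j unfolding bb_def using that by (intro Min_le) auto
      show "bb m \<le> 2" for m using le[of 1 m] b2[of 1 m] N by simp
    qed
    have cal: "calculus (ball 0 (bb m)) (\<phi> m l) (\<Phi> m l)" for m l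
      unfolding \<phi>_def \<Phi>_def
    proof (intro calculus_scale calculus_mult calculus_op_power calculus_id calculus_op_prod)
      fix j assume j: "j \<in> {1..N}"
      show "calculus (ball 0 (bb m)) (q m j) (Q m j)"
        by (rule calculus_mono[OF cal_q[OF j] subset_ball[OF bb(3)[OF j]]])
    qed
    have H0: "H0_calc \<xi> N r s (\<phi> m l) T = \<Phi> m l" for m l
    proof (rule H0_calc_eq[OF s bb(1,2) cal])
      \<comment> \<open>The double zeros of the \<open>N\<close> factors multiply to the square
        required by \<open>H0_calc_eq\<close>; this is the cofactor.\<close>
      show "(\<lambda>z. of_real (real l powr (\<alpha> - 1/2)) * (z ^ (l - 1) * (\<Prod>j=1..N. g m j z))) holomorphic_on ball 0 (bb m)"
      proof (intro holomorphic_intros)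
        fix j assume j: "j \<in> {1..N}"
        show "g m j holomorphic_on ball 0 (bb m)"
          by (rule holomorphic_on_subset[OF hol_g[OF j] subset_ball[OF bb(3)[OF j]]])
      qed
      fix z
      have "(\<Prod>j=1..N. q m j z) = (\<Prod>j=1..N. (\<xi> j - z)\<^sup>2 * g m j z)"
        by (rule prod.cong[OF refl]) (rule q_eq)
      then show "\<phi> m l z = (\<Prod>j=1..N. \<xi> j - z)\<^sup>2 * (of_real (real l powr (\<alpha> - 1/2)) * (z ^ (l - 1) * (\<Prod>j=1..N. g m j z)))"
        by (simp add: \<phi>_def prod.distrib prod_power_distrib mult_ac)
    qed
    have mem: "\<phi> m l \<in> H0_inf \<xi> N s" for m l
    proof -
      \<comment> \<open>The added 1 makes \<open>d\<close> positive even if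
        \<open>c = 0\<close>.\<close>
      define d where "d = c * real l powr (\<alpha> - 1/2) + 1"
      have d: "0 < d" using c0 by (simp add: d_def add_nonneg_pos)
      have le: "cmod (\<phi> m l z) \<le> d * (\<Prod>j=1..N. cmod (\<xi> j - z) powr \<alpha>)" if z: "z \<in> E_dom \<xi> N s" for z
      proof -
        define P where "P = (\<Prod>j=1..N. cmod (\<xi> j - z) powr \<alpha>)"
        have P: "0 \<le> P" by (simp add: P_def prod_nonneg)
        have "cmod (\<phi> m l z) \<le> c * (real l powr (\<alpha> - 1/2) * cmod z ^ (l - 1) * P)"
          using \<phi>_le[OF disc[OF z]] by (simp add: P_def)
        also have "\<dots> \<le> c * (real l powr (\<alpha> - 1/2) * 1 * P)"
          using c0 P disc[OF z] by (intro mult_left_mono mult_right_mono power_le_one) auto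
        also have "\<dots> \<le> d * P" using P by (simp add: d_def algebra_simps)
        finally show ?thesis by (simp add: P_def)
      qed
      have "cmod (\<phi> m l z) \<le> d * (\<Prod>j=1..N. 2 powr \<alpha>)" if z: "z \<in> E_dom \<xi> N s" for z
      proof (rule order_trans[OF le[OF z]], intro mult_left_mono prod_mono conjI powr_mono2)
        fix j assume j: "j \<in> {1..N}"
        show "cmod (\<xi> j - z) \<le> 2"
          using norm_triangle_ineq4[of "\<xi> j" z] unit[OF j] disc[OF z] by simp
      qed (use assms d in auto)
      then have "bounded (\<phi> m l ` E_dom \<xi> N s)" unfolding bounded_iff by blast
      moreover have "\<phi> m l holomorphic_on E_dom \<xi> N s"
        by (rule holomorphic_on_subset[OF calculus_holomorphic[OF cal[of m l]]])
          (use E_dom_subset_ball[of s] s subset_ball[of 1 "bb m" "0::complex"] bb(1)[of m] in auto)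
      ultimately show ?thesis
        unfolding H0_inf_def mem_Collect_eq
      proof (intro conjI)
        show "\<exists>d>0. \<exists>p. (\<forall>j\<in>{1..N}. 0 < p j) \<and>
            (\<forall>z\<in>E_dom \<xi> N s. cmod (\<phi> m l z) \<le> d * (\<Prod>j=1..N. cmod (\<xi> j - z) powr p j))"
          by (rule exI[of _ d], rule conjI[OF d], rule exI[of _ "\<lambda>_. \<alpha>"], intro conjI ballI le assms(9))
      qed
    qed
    obtain D where D: "0 \<le> D" "\<And>z n. z \<in> E_dom \<xi> N s \<Longrightarrow>
      (\<Sum>l=1..n. (real l powr (\<alpha> - 1/2) * cmod z ^ (l - 1) * (\<Prod>j=1..N. cmod (\<xi> j - z) powr \<alpha>))\<^sup>2) \<le> D"
      using square_function_symbol_bound[OF less_imp_le[OF s(1)] s(2) assms(9)] by blast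
    \<comment> \<open>The bound involves neither \<open>m\<close> nor \<open>n\<close>, so that the
      estimate survives first the limit of the approximants and then that of the square
      function.\<close>
    have sup: "(SUP z\<in>E_dom \<xi> N s. sqrt (\<Sum>l=1..n. (cmod (\<phi> m l z))\<^sup>2)) \<le> c * sqrt D" for m n
    proof (rule cSUP_least)
      have "of_real (1 - 0) * 0 + of_real 0 * \<xi> 1 \<in> E_dom \<xi> N s"
        using N s r by (intro E_domI) auto
      then show "E_dom \<xi> N s \<noteq> {}" by blast
      fix z assume z: "z \<in> E_dom \<xi> N s"
      define w where "w = (\<lambda>l. real l powr (\<alpha> - 1/2) * cmod z ^ (l - 1) * (\<Prod>j=1..N. cmod (\<xi> j - z) powr \<alpha>))"
      have "(\<Sum>l=1..n. (cmod (\<phi> m l z))\<^sup>2) \<le> (\<Sum>l=1..n. (c * w l)\<^sup>2)"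
        using \<phi>_le[OF disc[OF z]] by (intro sum_mono power_mono) (auto simp: w_def)
      also have "\<dots> = c\<^sup>2 * (\<Sum>l=1..n. (w l)\<^sup>2)" by (simp add: power_mult_distrib sum_distrib_left)
      also have "\<dots> \<le> c\<^sup>2 * D" using D(2)[OF z] by (intro mult_left_mono) (auto simp: w_def)
      finally have "sqrt (\<Sum>l=1..n. (cmod (\<phi> m l z))\<^sup>2) \<le> sqrt (c\<^sup>2 * D)" by (rule real_sqrt_le_mono)
      then show "sqrt (\<Sum>l=1..n. (cmod (\<phi> m l z))\<^sup>2) \<le> c * sqrt D" using c0 by (simp add: real_sqrt_mult)
    qed
    obtain K where K: "K > 0" "\<And>n \<phi> x. n \<ge> 1 \<Longrightarrow> \<forall>l\<in>{1..n}. \<phi> l \<in> H0_inf \<xi> N s \<Longrightarrow>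
       Rad_norm M \<epsilon> n (\<lambda>l. blinfun_apply (H0_calc \<xi> N r s (\<phi> l) T) x)
        \<le> K * norm x * (SUP z\<in>E_dom \<xi> N s. sqrt (\<Sum>l=1..n. (cmod (\<phi> l z))\<^sup>2))"
      using assms(8) unfolding quadratic_Hinf_calculus_def by blast
    have bound: "Rad_norm M \<epsilon> n (\<lambda>l. \<Phi> m l x) \<le> K * norm x * (c * sqrt D)" if n: "1 \<le> n" for n m x
    proof -
      have "Rad_norm M \<epsilon> n (\<lambda>l. H0_calc \<xi> N r s (\<phi> m l) T x)
          \<le> K * norm x * (SUP z\<in>E_dom \<xi> N s. sqrt (\<Sum>l=1..n. (cmod (\<phi> m l z))\<^sup>2))"
        using n mem by (intro K(2)) auto
      also have "\<dots> \<le> K * norm x * (c * sqrt D)" using sup K(1) by (intro mult_left_mono) auto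
      finally show ?thesis by (simp add: H0)
    qed
    have Qlim: "(\<lambda>m. Q m j) \<longlonglongrightarrow> FP j" if j: "j \<in> {1..N}" for j
    proof (rule LIM_zero_cancel, rule Lim_null_comparison[OF always_eventually])
      show "\<forall>m. norm (Q m j - FP j) \<le> 1 / Suc m" using Q_close[OF j] less_imp_le by blast
      show "(\<lambda>m. 1 / Suc m) \<longlonglongrightarrow> 0" by (rule LIMSEQ_Suc[OF lim_1_over_n])
    qed
    have lim: "(\<lambda>m. \<Phi> m l x) \<longlonglongrightarrow> tgt x l" for l x
    proof -
      have "(\<lambda>m. op_power T (l - 1) o\<^sub>L op_prod (Q m) N) \<longlonglongrightarrow> (op_power T (l - 1) o\<^sub>L op_prod FP N)"
        by (intro bounded_bilinear.tendsto[OF bounded_bilinear_blinfun_compose] tendsto_const tendsto_op_prod Qlim)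
      then show ?thesis
        unfolding \<Phi>_def tgt_def scaleC_of_real blinfun.scaleR_left
        by (intro tendsto_scaleR tendsto_const blinfun.tendsto)
    qed
    \<comment> \<open>The added 1 makes the constant positive. The empty sum is treated apart
      because the quadratic estimate starts at \<open>n = 1\<close>.\<close>
    have "Rad_norm M \<epsilon> n (tgt x) \<le> (K * (c * sqrt D) + 1) * norm x" for n x
    proof (cases "n = 0")
      case True
      then show ?thesis using K(1) c0 D(1) by (simp add: Rad_norm_def)
    next
      case False
      have "(\<lambda>m. Rad_norm M \<epsilon> n (\<lambda>l. \<Phi> m l x)) \<longlonglongrightarrow> Rad_norm M \<epsilon> n (tgt x)"
        by (rule Rad_norm_tendsto) (rule lim)
      then have "Rad_norm M \<epsilon> n (tgt x) \<le> K * norm x * (c * sqrt D)"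
        by (rule LIMSEQ_le_const2) (use bound False in auto)
      also have "\<dots> \<le> (K * (c * sqrt D) + 1) * norm x" by (simp add: algebra_simps)
      finally show ?thesis .
    qed
    moreover have "0 < K * (c * sqrt D) + 1" using K(1) c0 D(1) by (intro add_nonneg_pos) auto
    ultimately show ?thesis by (rule reduce[rotated])
  qed
qed

end
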